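(* Let $T=(T(s),s>0)$ be a $1$-SSA non-decreasing process with no drift, finite rate $\theta>0$ and key function $k$. Then $k(0+):=\lim_{x\to0+}k(x)=\theta$, and $$T(s)=\sum_{z\in\mathbb{Z}}S_zJ_z\,1(S_z\le s)\qquad(s>0),$$ where the $S_z$ are the jump times of $T$ and $J_z:=(T(S_z)-T(S_z-))/S_z$ are the normalized jumps, and where: (1) the jump times $(S_z,z\in\mathbb{Z})$ are the points of a scale invariant Poisson point process on $(0,\infty)$ with rate $\theta$. Moreover, assuming that the jump times are listed in an order depending only on the point process of jump times $\{s>0:T(s)>T(s-)\}$ (for instance in increasing order, with $S_0$ the time of the first jump after time $1$): (2) the normalized jumps $(J_z,z\in\mathbb{Z})$ form a sequence of i.i.d. copies of a positive random variable $J$ (the generic jump of $T$) with tail probability $$\mathbb{P}(J>x)=\frac{k(x)}{\theta}\qquad(x\ge0),$$ where $k(0):=k(0+)$; (3) the sequence of jump times $(S_z,z\in\mathbb{Z})$ is independent of the sequence of normalized jumps $(J_z,z\in\mathbb{Z})$.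
   Context: A stochastic process $T=(T(s),s>0)$ is $1$-self-similar additive ($1$-SSA) if (i) for all $c>0$, $(T(cs),s>0)$ and $(cT(s),s>0)$ have the same finite-dimensional distributions; and (ii) $T$ has independent increments, is stochastically continuous, has càdlàg paths, and $\lim_{s\to0+}T(s)=0$. For a non-decreasing $1$-SSA process, "no drift" means that its representation as a non-decreasing additive process (deterministic continuous part plus jumps) has no deterministic part; in that case there is a unique right-continuous non-increasing function $k:(0,\infty)\to[0,\infty)$, called the key function of $T$, with $\int_0^\infty (x\wedge 1)\frac{k(x)}{x}\,dx<\infty$ and $\log \mathbb{E}e^{-uT(1)}=\int_0^\infty (e^{-ux}-1)\frac{k(x)}{x}\,dx$ for $u\ge 0$. A scale invariant Poisson point process with rate $\theta$ is a Poisson point process on $(0,\infty)$ with intensity measure $\theta x^{-1}dx$. $T$ has finite rate $\theta<\infty$ if its set of jump times $\{s>0:T(s)>T(s-)\}$ is a scale invariant Poisson point process with rate $\theta$. All identities between random variables hold almost surely. *)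

theory Defs
  imports "HOL-Probability.Probability"
begin

section \<open>Self-similar additive processes\<close>

text \<open>A process \<open>(T(s), s > 0)\<close> on \<open>M\<close> is a function \<open>T :: real \<Rightarrow> 'a \<Rightarrow> real\<close>, read as
  \<open>T s \<omega>\<close>; the values at \<open>s \<le> 0\<close> are irrelevant.\<close>

definition is_process :: "'a measure \<Rightarrow> (real \<Rightarrow> 'a \<Rightarrow> real) \<Rightarrow> bool" where
  "is_process M T \<longleftrightarrow> (\<forall>s>0. T s \<in> borel_measurable M)"

definition one_self_similar :: "'a measure \<Rightarrow> (real \<Rightarrow> 'a \<Rightarrow> real) \<Rightarrow> bool" where
  "one_self_similar M T \<longleftrightarrow>
    (\<forall>c>0. \<forall>I. finite I \<and> I \<subseteq> {0<..} \<longrightarrow>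
      distr M (PiM I (\<lambda>_. borel)) (\<lambda>\<omega>. \<lambda>s\<in>I. T (c * s) \<omega>) =
      distr M (PiM I (\<lambda>_. borel)) (\<lambda>\<omega>. \<lambda>s\<in>I. c * T s \<omega>))"

definition independent_increments :: "'a measure \<Rightarrow> (real \<Rightarrow> 'a \<Rightarrow> real) \<Rightarrow> bool" where
  "independent_increments M T \<longleftrightarrow>
    (\<forall>(t :: nat \<Rightarrow> real) n. 0 < t 0 \<and> (\<forall>i<n. t i < t (Suc i)) \<longrightarrow>
      prob_space.indep_vars M (\<lambda>_. borel) (\<lambda>i \<omega>. T (t (Suc i)) \<omega> - T (t i) \<omega>) {..<n})"

definition stochastically_continuous :: "'a measure \<Rightarrow> (real \<Rightarrow> 'a \<Rightarrow> real) \<Rightarrow> bool" where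
  "stochastically_continuous M T \<longleftrightarrow>
    (\<forall>s>0. \<forall>\<epsilon>>0. ((\<lambda>r. measure M {\<omega> \<in> space M. \<bar>T r \<omega> - T s \<omega>\<bar> > \<epsilon>}) \<longlongrightarrow> 0) (at s))"

definition cadlag_on_pos :: "(real \<Rightarrow> real) \<Rightarrow> bool" where
  "cadlag_on_pos f \<longleftrightarrow>
    (\<forall>s>0. continuous (at_right s) f \<and> (\<exists>l. (f \<longlongrightarrow> l) (at_left s)))"

text \<open>Every path is cadlag, not just almost every one, so that left limits and jumps along
  random times are random variables without completing \<open>M\<close>.\<close>

definition one_SSA :: "'a measure \<Rightarrow> (real \<Rightarrow> 'a \<Rightarrow> real) \<Rightarrow> bool" where
  "one_SSA M T \<longleftrightarrow>
    is_process M T \<and> one_self_similar M T \<and> independent_increments M T \<and>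
    stochastically_continuous M T \<and>
    (\<forall>\<omega>\<in>space M. cadlag_on_pos (\<lambda>s. T s \<omega>)) \<and>
    (AE \<omega> in M. ((\<lambda>s. T s \<omega>) \<longlongrightarrow> 0) (at_right 0))"

definition nondecreasing_process :: "'a measure \<Rightarrow> (real \<Rightarrow> 'a \<Rightarrow> real) \<Rightarrow> bool" where
  "nondecreasing_process M T \<longleftrightarrow> (AE \<omega> in M. mono_on {0<..} (\<lambda>s. T s \<omega>))"

section \<open>Jumps, drift and key function\<close>

definition left_lim :: "(real \<Rightarrow> 'a \<Rightarrow> real) \<Rightarrow> real \<Rightarrow> 'a \<Rightarrow> real" where
  "left_lim T s \<omega> = Lim (at_left s) (\<lambda>r. T r \<omega>)"

definition jump :: "(real \<Rightarrow> 'a \<Rightarrow> real) \<Rightarrow> real \<Rightarrow> 'a \<Rightarrow> real" where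
  "jump T s \<omega> = T s \<omega> - left_lim T s \<omega>"

definition jump_times :: "(real \<Rightarrow> 'a \<Rightarrow> real) \<Rightarrow> 'a \<Rightarrow> real set" where
  "jump_times T \<omega> = {s. 0 < s \<and> T s \<omega> > left_lim T s \<omega>}"

text \<open>\<open>T(s) = a(s) + \<Sum>\<^bsub>0 < r \<le> s\<^esub> (T(r) - T(r-))\<close> with a deterministic continuous part \<open>a\<close>.\<close>

definition has_deterministic_part ::
  "'a measure \<Rightarrow> (real \<Rightarrow> 'a \<Rightarrow> real) \<Rightarrow> (real \<Rightarrow> real) \<Rightarrow> bool" where
  "has_deterministic_part M T a \<longleftrightarrow> continuous_on {0<..} a \<and>
    (AE \<omega> in M. \<forall>s>0. ((\<lambda>r. jump T r \<omega>) has_sum (T s \<omega> - a s)) {0<..s})"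

definition no_drift :: "'a measure \<Rightarrow> (real \<Rightarrow> 'a \<Rightarrow> real) \<Rightarrow> bool" where
  "no_drift M T \<longleftrightarrow> has_deterministic_part M T (\<lambda>_. 0)"

text \<open>The values of \<open>k\<close> outside \<open>(0,\<infinity>)\<close> are irrelevant.\<close>

definition key_function :: "'a measure \<Rightarrow> (real \<Rightarrow> 'a \<Rightarrow> real) \<Rightarrow> (real \<Rightarrow> real) \<Rightarrow> bool" where
  "key_function M T k \<longleftrightarrow>
    (\<forall>x>0. 0 \<le> k x) \<and> antimono_on {0<..} k \<and> (\<forall>x>0. continuous (at_right x) k) \<and>
    set_integrable lborel {0<..} (\<lambda>x. min x 1 * (k x / x)) \<and>
    (\<forall>u\<ge>0. ln (\<integral>\<omega>. exp (- u * T 1 \<omega>) \<partial>M) =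
      (LINT x:{0<..}|lborel. (exp (- u * x) - 1) * (k x / x)))"

section \<open>Point processes\<close>

text \<open>All point processes here are simple (the intensity \<open>\<theta> x\<^sup>-\<^sup>1 dx\<close> is diffuse), so they
  are represented by random sets of points. The Poisson weights are written out since \<open>poisson_pmf\<close> is
  only specified for positive rates, while \<open>\<mu> A = 0\<close> occurs.\<close>

definition num_points :: "('a \<Rightarrow> 'b set) \<Rightarrow> 'b set \<Rightarrow> 'a \<Rightarrow> ennreal" where
  "num_points X A \<omega> = emeasure (count_space UNIV) (X \<omega> \<inter> A)"

definition poisson_point_process ::
  "'a measure \<Rightarrow> 'b measure \<Rightarrow> ('a \<Rightarrow> 'b set) \<Rightarrow> bool" where
  "poisson_point_process M \<mu> X \<longleftrightarrow>
    (\<forall>\<omega>\<in>space M. X \<omega> \<subseteq> space \<mu>) \<and>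
    (\<forall>A\<in>sets \<mu>. num_points X A \<in> borel_measurable M) \<and>
    (\<forall>A\<in>sets \<mu>. emeasure \<mu> A < \<infinity> \<longrightarrow>
      (\<forall>n. measure M {\<omega> \<in> space M. num_points X A \<omega> = of_nat n} =
        measure \<mu> A ^ n / fact n * exp (- measure \<mu> A))) \<and>
    (\<forall>A\<in>sets \<mu>. emeasure \<mu> A = \<infinity> \<longrightarrow> (AE \<omega> in M. num_points X A \<omega> = \<infinity>)) \<and>
    (\<forall>(A :: nat \<Rightarrow> 'b set) n. (\<forall>i<n. A i \<in> sets \<mu>) \<and> disjoint_family_on A {..<n} \<longrightarrow>
      prob_space.indep_vars M (\<lambda>_. borel) (\<lambda>i. num_points X (A i)) {..<n})"

definition scale_invariant_intensity :: "real \<Rightarrow> real measure" where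
  "scale_invariant_intensity \<theta> =
    density (restrict_space lborel {0<..}) (\<lambda>x. ennreal (\<theta> / x))"

definition scale_invariant_ppp :: "'a measure \<Rightarrow> real \<Rightarrow> ('a \<Rightarrow> real set) \<Rightarrow> bool" where
  "scale_invariant_ppp M \<theta> X \<longleftrightarrow> poisson_point_process M (scale_invariant_intensity \<theta>) X"

definition has_rate :: "'a measure \<Rightarrow> (real \<Rightarrow> 'a \<Rightarrow> real) \<Rightarrow> real \<Rightarrow> bool" where
  "has_rate M T \<theta> \<longleftrightarrow> scale_invariant_ppp M \<theta> (jump_times T)"

section \<open>Listings of the jump times\<close>

text \<open>Random variables \<open>S\<^sub>z\<close> with values in \<open>(0,\<infinity>)\<close> which almost surely list every jump time exactly once.\<close>

definition lists_jump_times ::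
  "'a measure \<Rightarrow> (real \<Rightarrow> 'a \<Rightarrow> real) \<Rightarrow> (int \<Rightarrow> 'a \<Rightarrow> real) \<Rightarrow> bool" where
  "lists_jump_times M T S \<longleftrightarrow>
    (\<forall>z. S z \<in> M \<rightarrow>\<^sub>M restrict_space borel {0<..}) \<and>
    (AE \<omega> in M. bij_betw (\<lambda>z. S z \<omega>) UNIV (jump_times T \<omega>))"

definition point_process_algebra :: "'a measure \<Rightarrow> ('a \<Rightarrow> real set) \<Rightarrow> 'a measure" where
  "point_process_algebra M X = sigma (space M)
    {num_points X A -` B \<inter> space M | A B. A \<in> sets borel \<and> A \<subseteq> {0<..} \<and> B \<in> sets borel}"

text \<open>The listing depends only on the point process of jump times: each \<open>S\<^sub>z\<close> is a measurable
  function of it, i.e. measurable for the \<open>\<sigma>\<close>-algebra generated by its counts. (A set-theoretic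
  function of \<open>jump_times T \<omega>\<close> without this measurability would not suffice for independence.)\<close>

definition order_from_jump_times ::
  "'a measure \<Rightarrow> (real \<Rightarrow> 'a \<Rightarrow> real) \<Rightarrow> (int \<Rightarrow> 'a \<Rightarrow> real) \<Rightarrow> bool" where
  "order_from_jump_times M T S \<longleftrightarrow>
    (\<forall>z. S z \<in> borel_measurable (point_process_algebra M (jump_times T)))"

definition increasing_from_1 :: "'a measure \<Rightarrow> (int \<Rightarrow> 'a \<Rightarrow> real) \<Rightarrow> bool" where
  "increasing_from_1 M S \<longleftrightarrow>
    (AE \<omega> in M. strict_mono (\<lambda>z. S z \<omega>) \<and> S (-1) \<omega> \<le> 1 \<and> 1 < S 0 \<omega>)"

definition normalized_jump ::
  "(real \<Rightarrow> 'a \<Rightarrow> real) \<Rightarrow> (int \<Rightarrow> 'a \<Rightarrow> real) \<Rightarrow> int \<Rightarrow> 'a \<Rightarrow> real" where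
  "normalized_jump T S z \<omega> = jump T (S z \<omega>) \<omega> / S z \<omega>"

end

theory Submission
  imports Defs
begin

text \<open>Cut \<open>(0,\<infinity>)\<close> into geometric cells with ratio \<open>2\<^sup>1\<^sup>/\<^sup>m\<close>, \<open>m = 2\<^sup>n\<close>. The increments of \<open>T\<close> over the cells,
  divided by the left endpoints, are independent, and by self-similarity they have the same law. Without
  drift an increment vanishes iff its cell contains no jump time, so given the set of hit cells the
  nonzero normalized increments are i.i.d. As \<open>n\<close> grows the hit cells become single jump times and the
  increments become normalized jumps; hence on events that only prescribe which of finitely many
  cells of a fixed level are empty and which contain exactly one jump, the normalized jumps are i.i.d. and independent of
  the void events. Void events form a \<open>\<pi>\<close>-system which generates the point process of jump
  times up to null sets, and any listing separates its points by cells of a sufficiently fine level.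

  For the tail of the generic jump \<open>J\<close>, let \<open>L(u)\<close> be the Laplace transform of \<open>T(1)\<close>. Stationarity of the
  normalized increments gives \<open>-u L'(u) / L(u) = \<theta> E(1 - e\<^sup>-\<^sup>u\<^sup>J)\<close>, while differentiating the key function
  formula gives \<open>u \<integral> e\<^sup>-\<^sup>u\<^sup>x k(x) dx\<close> for the same quantity, and Laplace transforms are injective.\<close>

section \<open>Geometric cells\<close>

text \<open>Only the jump times are assumed to be Poisson; nothing is assumed about the joint law of
  times and sizes, so independence of the two has to be extracted from increments at deterministic
  times. Exponents with denominator \<open>2 ^ n\<close> make the levels nested: an event fixed at
  one level can be read off from hit patterns at every finer level. Increments approximate
  normalized jumps only pointwise, hence limits are taken for bounded continuous test functions and
  half-lines are reached afterwards. A listed point sits in a random cell, and a random index cannot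
  be substituted into a formula about fixed cells; this is why outcomes are split according to the
  finitely many cells that the chosen points may occupy. For the tail, \<open>u\<close> is
  multiplied by the cell ratio \<open>r\<close> itself: self-similarity gives
  \<open>L(u r) = E exp(- u T(r))\<close>, which factors through the increment over
  \<open>(1,r]\<close>, so the difference quotient of \<open>ln L\<close> in \<open>ln u\<close> is
  expressed by the same conditional means whose limit is already known.\<close>

definition grid :: "nat \<Rightarrow> int \<Rightarrow> real" where
  "grid n j = 2 powr (real_of_int j / 2 ^ n)"

definition idx :: "nat \<Rightarrow> real \<Rightarrow> int" where
  "idx n s = \<lceil>2 ^ n * log 2 s\<rceil> - 1"

text \<open>Level \<open>n\<close> consists of the cells \<open>(grid n l, grid n (l + 1)]\<close>; \<open>idx n s\<close> is the index of the one containing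
  \<open>s\<close>, and \<open>l div 2 ^ (n - q)\<close> is the level \<open>q\<close> cell containing the level \<open>n\<close> cell \<open>l\<close>.\<close>

definition window :: "nat \<Rightarrow> int set" where
  "window n = {- (int n * 2 ^ n)..<int n * 2 ^ n}"

lemma grid_pos [simp]: "0 < grid n j"
  by (simp add: grid_def)

lemma grid_less_iff [simp]: "grid n i < grid n j \<longleftrightarrow> i < j"
  by (simp add: grid_def divide_less_cancel)

lemma grid_0 [simp]: "grid n 0 = 1"
  by (simp add: grid_def)

lemma grid_add: "grid n (i + j) = grid n i * grid n j"
  by (simp add: grid_def powr_add [symmetric] add_divide_distrib)

lemma finite_window [simp]: "finite (window n)"
  by (simp add: window_def)

lemma idx_eq_iff:
  assumes "0 < s"
  shows "idx n s = l \<longleftrightarrow> grid n l < s \<and> s \<le> grid n (l + 1)"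
proof -
  have "grid n l < s \<longleftrightarrow> real_of_int l < 2 ^ n * log 2 s"
    using assms by (simp add: grid_def powr_less_iff field_simps)
  moreover have "s \<le> grid n (l + 1) \<longleftrightarrow> 2 ^ n * log 2 s \<le> real_of_int l + 1"
    using assms by (simp add: grid_def le_powr_iff field_simps)
  ultimately show ?thesis
    unfolding idx_def by linarith
qed

lemma idx_bounds:
  assumes "0 < s"
  shows "grid n (idx n s) < s" "s \<le> grid n (idx n s + 1)"
  using idx_eq_iff[OF assms, of n "idx n s"] by auto

lemma idx_mono: "0 < s \<Longrightarrow> s \<le> t \<Longrightarrow> idx n s \<le> idx n t"
  unfolding idx_def by (intro diff_right_mono ceiling_mono mult_left_mono) auto

text \<open>Dyadic exponents nest the levels: \<open>grid q j = grid n (j * 2 ^ (n - q))\<close>, so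
  a level \<open>q\<close> cell is a block of \<open>2 ^ (n - q)\<close> consecutive level
  \<open>n\<close> cells, and floor division of the index, negative indices included, finds
  it.\<close>

lemma idx_div:
  assumes "0 < s" "q \<le> n"
  shows "idx n s div 2 ^ (n - q) = idx q s"
proof -
  define l where "l = idx n s"
  define d :: int where "d = 2 ^ (n - q)"
  define i where "i = l div d"
  have d: "d > 0" by (simp add: d_def)
  have scale: "grid q j = grid n (j * d)" for j
  proof -
    have "(2::real) ^ n = 2 ^ (n - q) * 2 ^ q"
      using assms(2) by (simp add: power_add [symmetric])
    then show ?thesis
      by (simp add: grid_def d_def)
  qed
  have l: "i * d \<le> l" "l + 1 \<le> (i + 1) * d"
  proof -
    have "l = i * d + l mod d" using div_mult_mod_eq[of l d] by (simp add: i_def)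
    moreover have "0 \<le> l mod d" "l mod d < d" using d by auto
    moreover have "(i + 1) * d = i * d + d" by (simp add: distrib_right)
    ultimately show "i * d \<le> l" "l + 1 \<le> (i + 1) * d" by linarith+
  qed
  have mono: "a \<le> b \<Longrightarrow> grid n a \<le> grid n b" for a b
    by (metis grid_less_iff not_le)
  have "grid q i < s \<and> s \<le> grid q (i + 1)"
    using idx_bounds[OF assms(1), of n] mono[OF l(1)] mono[OF l(2)]
    by (auto simp: scale l_def)
  then show ?thesis
    using idx_eq_iff[OF assms(1), of q i] by (simp add: i_def l_def d_def)
qed

lemma grid_1_tendsto: "(\<lambda>n. grid n 1) \<longlonglongrightarrow> 1"
proof -
  have "(\<lambda>n. 2 powr ((1/2::real) ^ n)) \<longlonglongrightarrow> 2 powr 0"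
    by (intro tendsto_intros LIMSEQ_realpow_zero) auto
  then show ?thesis
    by (simp add: grid_def power_divide)
qed

text \<open>The left endpoint of the cell is within the factor \<open>grid n 1\<close> of
  \<open>s\<close>, and this factor tends to 1.\<close>

lemma grid_idx_tendsto:
  assumes "0 < s"
  shows "(\<lambda>n. grid n (idx n s)) \<longlonglongrightarrow> s"
proof (rule tendsto_sandwich)
  show "\<forall>\<^sub>F n in sequentially. s / grid n 1 \<le> grid n (idx n s)"
    using idx_bounds(2)[OF assms] by (auto simp: grid_add divide_le_eq)
  show "\<forall>\<^sub>F n in sequentially. grid n (idx n s) \<le> s"
    using idx_bounds(1)[OF assms] by (intro always_eventually allI less_imp_le)
  show "(\<lambda>n. s / grid n 1) \<longlonglongrightarrow> s"
    using tendsto_divide[OF tendsto_const grid_1_tendsto, of s] by simp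
qed simp

text \<open>A level \<open>q\<close> block occupies the indices from \<open>i * d\<close> to below
  \<open>(i + 1) * d\<close> with \<open>d = 2 ^ (n - q)\<close>, at most \<open>2 ^ n\<close>, so
  \<open>\<bar>i\<bar> + 1 \<le> n\<close> suffices. The windows grow in range as well as in
  resolution: they cover \<open>(2^-n, 2^n]\<close>.\<close>

lemma eventually_block_window:
  "\<forall>\<^sub>F n in sequentially. \<forall>l. l div 2 ^ (n - q) = i \<longrightarrow> l \<in> window n"
proof (rule eventually_sequentiallyI[of "max q (nat \<bar>i\<bar> + 1)"])
  fix n assume n: "n \<ge> max q (nat \<bar>i\<bar> + 1)"
  show "\<forall>l. l div 2 ^ (n - q) = i \<longrightarrow> l \<in> window n"
  proof (intro allI impI)
    fix l :: int assume l: "l div 2 ^ (n - q) = i"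
    define d :: int where "d = 2 ^ (n - q)"
    define w :: int where "w = 2 ^ n"
    have d: "d > 0" "d \<le> w" by (auto simp: d_def w_def)
    have ni: "\<bar>i\<bar> + 1 \<le> int n" using n by linarith
    have *: "l = i * d + l mod d" using l div_mult_mod_eq[of l d] by (simp add: d_def)
    have **: "0 \<le> l mod d" "l mod d < d" using d by auto
    have "- (int n * w) \<le> i * d"
    proof -
      have "- (i * d) \<le> \<bar>i\<bar> * d" using d by (simp add: abs_mult_pos [symmetric] flip: mult_minus_left)
      also have "\<dots> \<le> int n * w" using ni d by (intro mult_mono) auto
      finally show ?thesis by simp
    qed
    moreover have "(i + 1) * d \<le> int n * w"
    proof -
      have "(i + 1) * d \<le> (\<bar>i\<bar> + 1) * d" using d by (intro mult_right_mono) auto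
      also have "\<dots> \<le> int n * w" using ni d by (intro mult_mono) auto
      finally show ?thesis .
    qed
    then have "l < int n * w" using * ** by (simp add: algebra_simps)
    ultimately show "l \<in> window n" using * ** by (simp add: window_def w_def)
  qed
qed

lemma eventually_idx_window:
  assumes "0 < s"
  shows "\<forall>\<^sub>F n in sequentially. idx n s \<in> window n"
  using eventually_block_window[of 0 "idx 0 s"]
  by eventually_elim (use idx_div[OF assms, of 0] in auto)

lemma finite_block: "finite {l::int. l div 2 ^ m = i}"
proof (rule finite_subset)
  show "{l::int. l div 2 ^ m = i} \<subseteq> {i * 2 ^ m..<i * 2 ^ m + 2 ^ m}"
  proof
    fix l :: int assume "l \<in> {l. l div 2 ^ m = i}"
    then have "l = i * 2 ^ m + l mod 2 ^ m" using div_mult_mod_eq[of l "2 ^ m"] by simp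
    moreover have "0 \<le> l mod 2 ^ m" "l mod 2 ^ m < (2::int) ^ m" by auto
    ultimately show "l \<in> {i * 2 ^ m..<i * 2 ^ m + 2 ^ m}" unfolding atLeastLessThan_iff by linarith
  qed
qed simp

text \<open>For \<open>s < t\<close> the left endpoint of the cell of \<open>t\<close> tends to
  \<open>t\<close>, so it eventually exceeds \<open>s\<close>; a finite set has finitely many
  pairs.\<close>

lemma eventually_inj_idx:
  assumes "finite P" "P \<subseteq> {0<..}"
  shows "\<forall>\<^sub>F n in sequentially. inj_on (idx n) P"
proof -
  have neq: "\<forall>\<^sub>F n in sequentially. idx n s \<noteq> idx n t" if st: "0 < s" "s < t" for s t
  proof -
    have "\<forall>\<^sub>F n in sequentially. grid n (idx n t) > s"
      using grid_idx_tendsto[of t] st by (intro order_tendstoD) auto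
    then show ?thesis
    proof eventually_elim
      case (elim n)
      then have "grid n (idx n s) < grid n (idx n t)"
        using idx_bounds(1)[OF st(1), of n] by linarith
      then show ?case by simp
    qed
  qed
  have "\<forall>\<^sub>F n in sequentially. \<forall>s\<in>P. \<forall>t\<in>P. s < t \<longrightarrow> idx n s \<noteq> idx n t"
    using assms neq by (intro eventually_ball_finite ballI) (auto simp: subset_iff)
  then show ?thesis
    by eventually_elim (metis inj_onI linorder_less_linear)
qed

text \<open>A hit cell is counted once however many points it holds, which gives one bound; the
  other holds because every finite subset is eventually separated inside the window. Counts thus
  become suprema of finite sums of hit indicators, the form in which their measurability is
  proved.\<close>

lemma count_eq_SUP_idx:
  assumes "Y \<subseteq> {0<..}"
  shows "emeasure (count_space UNIV) Y =
    (SUP n. of_nat (card {l \<in> window n. \<exists>s\<in>Y. idx n s = l}))"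
    (is "?L = (SUP n. of_nat (card (?W n)))")
proof (rule antisym)
  have ge: "of_nat (card P) \<le> (SUP n. of_nat (card (?W n)) :: ennreal)"
    if P: "finite P" "P \<subseteq> Y" for P
  proof -
    have "\<forall>\<^sub>F n in sequentially. inj_on (idx n) P \<and> (\<forall>s\<in>P. idx n s \<in> window n)"
      using P assms by (intro eventually_conj eventually_inj_idx eventually_ball_finite ballI
          eventually_idx_window) auto
    then obtain n where n: "inj_on (idx n) P" "\<forall>s\<in>P. idx n s \<in> window n"
      by (auto simp: eventually_sequentially)
    have "card P = card (idx n ` P)" using n by (simp add: card_image)
    also have "\<dots> \<le> card (?W n)" using n P by (intro card_mono) auto
    finally have "of_nat (card P) \<le> (of_nat (card (?W n)) :: ennreal)" by simp
    also have "\<dots> \<le> (SUP n. of_nat (card (?W n)))" by (rule SUP_upper) simp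
    finally show ?thesis .
  qed
  show "?L \<le> (SUP n. of_nat (card (?W n)))"
  proof (cases "finite Y")
    case True
    then show ?thesis using ge[of Y] by simp
  next
    case False
    have "(SUP n. of_nat (card (?W n)) :: ennreal) = top"
    proof (rule ccontr)
      assume "(SUP n. of_nat (card (?W n)) :: ennreal) \<noteq> top"
      then obtain m :: nat where m: "(SUP n. of_nat (card (?W n)) :: ennreal) < of_nat m"
        using ennreal_Ex_less_of_nat[of "SUP n. of_nat (card (?W n))"] unfolding less_top by blast
      obtain P where "finite P" "P \<subseteq> Y" "card P = m"
        using infinite_arbitrarily_large[OF False] by blast
      then show False using ge[of P] m by (auto simp: not_le[symmetric])
    qed
    then show ?thesis by (simp only: top_greatest)
  qed
  show "(SUP n. of_nat (card (?W n))) \<le> ?L"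
  proof (rule SUP_least)
    fix n
    have "card (?W n) \<le> card Y" if "finite Y"
    proof -
      have "?W n \<subseteq> idx n ` Y" by auto
      then show ?thesis using that by (meson card_image_le card_mono finite_imageI le_trans)
    qed
    then show "of_nat (card (?W n)) \<le> ?L" by (cases "finite Y") auto
  qed
qed

section \<open>Independence and Poisson point processes\<close>

text \<open>Increments come indexed by natural numbers and cells by integers; injectivity keeps the
  factors for distinct cells distinct.\<close>

lemma (in prob_space) indep_vars_inj:
  assumes Y: "indep_vars N Y K" and h: "inj_on h L" "h ` L \<subseteq> K"
  shows "indep_vars (\<lambda>l. N (h l)) (\<lambda>l. Y (h l)) L"
  unfolding indep_vars_def2
proof (intro conjI indep_setsI ballI)
  show "random_variable (N (h l)) (Y (h l))" if "l \<in> L" for l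
    using Y h that by (auto simp: indep_vars_def2)
  show "{Y (h l) -` A \<inter> space M |A. A \<in> sets (N (h l))} \<subseteq> events" if "l \<in> L" for l
    using Y h that by (auto simp: indep_vars_def2 intro: measurable_sets)
  fix A J assume J: "J \<noteq> {}" "J \<subseteq> L" "finite J"
    and A: "\<forall>j\<in>J. A j \<in> {Y (h j) -` A \<inter> space M |A. A \<in> sets (N (h j))}"
  define B where "B = A \<circ> inv_into L h"
  have inv: "inv_into L h (h j) = j" if "j \<in> J" for j
    using that J h by (intro inv_into_f_f) auto
  have ind: "indep_sets (\<lambda>i. {Y i -` A \<inter> space M |A. A \<in> sets (N i)}) K"
    using Y by (simp add: indep_vars_def2)
  have "prob (\<Inter>i\<in>h ` J. B i) = (\<Prod>i\<in>h ` J. prob (B i))"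
    by (rule indep_setsD[OF ind]) (use J h A inv in \<open>auto simp: B_def\<close>)
  moreover have "inj_on h J" using h(1) J(2) by (rule inj_on_subset)
  ultimately show "prob (\<Inter>j\<in>J. A j) = (\<Prod>j\<in>J. prob (A j))"
    using inv by (simp add: prod.reindex B_def)
qed

text \<open>Each finite intersection changes only on a null set. This serves to pass from counts of
  jump times to counts of a listing, which agree only almost surely.\<close>

lemma (in prob_space) indep_vars_cong_AE:
  assumes X: "indep_vars N X I" and Y: "\<And>i. i \<in> I \<Longrightarrow> random_variable (N i) (Y i)"
    and eq: "\<And>i. i \<in> I \<Longrightarrow> AE \<omega> in M. X i \<omega> = Y i \<omega>"
  shows "indep_vars N Y I"
  unfolding indep_vars_def2
proof (intro conjI indep_setsI ballI Y)
  show "{Y i -` A \<inter> space M |A. A \<in> sets (N i)} \<subseteq> events" if "i \<in> I" for i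
    using Y[OF that] by (auto intro: measurable_sets)
  have Xm: "random_variable (N i) (X i)" if "i \<in> I" for i
    using X that by (auto simp: indep_vars_def2)
  fix A J assume J: "J \<noteq> {}" "J \<subseteq> I" "finite J"
    and A: "\<forall>j\<in>J. A j \<in> {Y j -` A \<inter> space M |A. A \<in> sets (N j)}"
  then have "\<forall>j\<in>J. \<exists>B. B \<in> sets (N j) \<and> A j = Y j -` B \<inter> space M" by auto
  then obtain B where B: "\<And>j. j \<in> J \<Longrightarrow> B j \<in> sets (N j)" "\<And>j. j \<in> J \<Longrightarrow> A j = Y j -` B j \<inter> space M"
    by metis
  have sets: "X j -` B j \<inter> space M \<in> events" "Y j -` B j \<inter> space M \<in> events" if "j \<in> J" for j
    using that J B Xm Y by (auto intro!: measurable_sets)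
  have AE: "AE \<omega> in M. \<forall>j\<in>J. X j \<omega> = Y j \<omega>"
    using J eq by (intro AE_finite_allI) auto
  have "prob (\<Inter>j\<in>J. A j) = prob (\<Inter>j\<in>J. X j -` B j \<inter> space M)"
  proof (rule measure_eq_AE)
    show "AE x in M. (x \<in> (\<Inter>j\<in>J. A j)) = (x \<in> (\<Inter>j\<in>J. X j -` B j \<inter> space M))"
      using AE by eventually_elim (use B in auto)
    show "(\<Inter>j\<in>J. A j) \<in> events" "(\<Inter>j\<in>J. X j -` B j \<inter> space M) \<in> events"
      using J sets B by (intro sets.finite_INT; simp)+
  qed
  also have "\<dots> = (\<Prod>j\<in>J. prob (X j -` B j \<inter> space M))"
    by (rule indep_setsD[where F="\<lambda>i. {X i -` A \<inter> space M |A. A \<in> sets (N i)}" and I=I])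
      (use X J B in \<open>auto simp: indep_vars_def2\<close>)
  also have "\<dots> = (\<Prod>j\<in>J. prob (A j))"
  proof (intro prod.cong refl measure_eq_AE)
    fix j assume j: "j \<in> J"
    show "AE x in M. (x \<in> X j -` B j \<inter> space M) = (x \<in> A j)"
      using AE by eventually_elim (use B j in auto)
  qed (use sets B in auto)
  finally show "prob (\<Inter>j\<in>J. A j) = (\<Prod>j\<in>J. prob (A j))" .
qed

lemma space_scale_invariant_intensity [simp]: "space (scale_invariant_intensity \<theta>) = {0<..}"
  by (simp add: scale_invariant_intensity_def space_restrict_space)

lemma sets_scale_invariant_intensity:
  "A \<in> sets (scale_invariant_intensity \<theta>) \<longleftrightarrow> A \<in> sets borel \<and> A \<subseteq> {0<..}"
  by (auto simp: scale_invariant_intensity_def sets_restrict_space_iff)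

lemma emeasure_scale_invariant_intensity:
  assumes "A \<in> sets borel" "A \<subseteq> {0<..}"
  shows "emeasure (scale_invariant_intensity \<theta>) A = (\<integral>\<^sup>+x. ennreal (\<theta> / x) * indicator A x \<partial>lborel)"
proof -
  have A: "A \<in> sets (restrict_space lborel {0<..})"
    using assms by (simp add: sets_restrict_space_iff)
  have m: "(\<lambda>x. ennreal (\<theta> / x)) \<in> borel_measurable (restrict_space lborel {0<..})"
    by (intro measurable_restrict_space1) measurable
  show ?thesis
    unfolding scale_invariant_intensity_def
    using assms by (subst emeasure_density[OF m A], subst nn_integral_restrict_space)
      (auto intro!: nn_integral_cong simp: indicator_def)
qed

lemma emeasure_scale_invariant_intensity_interval:
  assumes "0 < a" "a \<le> b" "0 \<le> \<theta>"
  shows "emeasure (scale_invariant_intensity \<theta>) {a<..b} = ennreal (\<theta> * ln (b / a))"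
proof -
  have "emeasure (scale_invariant_intensity \<theta>) {a<..b} = (\<integral>\<^sup>+x. ennreal (\<theta> / x) * indicator {a<..b} x \<partial>lborel)"
    using assms by (intro emeasure_scale_invariant_intensity) auto
  also have "\<dots> = (\<integral>\<^sup>+x. ennreal (\<theta> / x) * indicator {a..b} x \<partial>lborel)"
    by (rule nn_integral_cong_AE) (use AE_lborel_singleton[of a] in eventually_elim, auto simp: indicator_def)
  also have "\<dots> = \<theta> * ln b - \<theta> * ln a"
    using assms by (intro nn_integral_FTC_Icc) (auto intro!: derivative_eq_intros)
  finally show ?thesis
    using assms by (simp add: ln_div algebra_simps)
qed

lemma (in prob_space) poisson_prob_num_points:
  assumes "poisson_point_process M \<mu> X" "A \<in> sets \<mu>" "emeasure \<mu> A < \<infinity>"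
  shows "prob {\<omega> \<in> space M. num_points X A \<omega> = of_nat n} =
    measure \<mu> A ^ n / fact n * exp (- measure \<mu> A)"
  using assms by (auto simp: poisson_point_process_def)

text \<open>The Poisson weights sum to 1 and leave no mass for the value infinity.\<close>

lemma (in prob_space) poisson_finite_AE:
  assumes "poisson_point_process M \<mu> X" "A \<in> sets \<mu>" "emeasure \<mu> A < \<infinity>"
  shows "AE \<omega> in M. finite (X \<omega> \<inter> A)"
proof -
  define m where "m = measure \<mu> A"
  have meas [measurable]: "num_points X A \<in> borel_measurable M"
    using assms by (auto simp: poisson_point_process_def)
  have p: "prob {\<omega> \<in> space M. num_points X A \<omega> = of_nat n} = m ^ n / fact n * exp (- m)" for n
    using poisson_prob_num_points[OF assms] by (simp add: m_def)
  have "(\<lambda>n. prob {\<omega> \<in> space M. num_points X A \<omega> = of_nat n}) sums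
      prob (\<Union>n. {\<omega> \<in> space M. num_points X A \<omega> = of_nat n})"
    by (rule finite_measure_UNION) (auto simp: disjoint_family_on_def)
  moreover have "(\<lambda>n. prob {\<omega> \<in> space M. num_points X A \<omega> = of_nat n}) sums 1"
  proof -
    have "(\<lambda>n. m ^ n /\<^sub>R fact n * exp (- m)) sums (exp m * exp (- m))"
      by (intro sums_mult2 exp_converges)
    then show ?thesis
      by (simp add: p exp_minus field_simps)
  qed
  ultimately have "prob (\<Union>n. {\<omega> \<in> space M. num_points X A \<omega> = of_nat n}) = 1"
    by (rule sums_unique2)
  then have "AE \<omega> in M. \<omega> \<in> (\<Union>n. {\<omega> \<in> space M. num_points X A \<omega> = of_nat n})"
    by (subst (asm) prob_eq_1) auto
  then show ?thesis
  proof eventually_elim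
    case (elim \<omega>)
    then have "num_points X A \<omega> \<noteq> \<infinity>" by auto
    then show ?case by (auto simp: num_points_def emeasure_count_space split: if_splits)
  qed
qed

lemma (in prob_space) poisson_infinite_AE:
  assumes "poisson_point_process M \<mu> X" "A \<in> sets \<mu>" "emeasure \<mu> A = \<infinity>"
  shows "AE \<omega> in M. infinite (X \<omega> \<inter> A)"
proof -
  have "AE \<omega> in M. num_points X A \<omega> = \<infinity>"
    using assms by (auto simp: poisson_point_process_def)
  then show ?thesis
    by eventually_elim (auto simp: num_points_def)
qed

section \<open>Increments over cells\<close>

definition jump_cell :: "(real \<Rightarrow> 'a \<Rightarrow> real) \<Rightarrow> nat \<Rightarrow> int \<Rightarrow> 'a \<Rightarrow> real set" where
  "jump_cell T n l \<omega> = {s \<in> jump_times T \<omega>. idx n s = l}"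

definition cell_incr :: "(real \<Rightarrow> 'a \<Rightarrow> real) \<Rightarrow> nat \<Rightarrow> int \<Rightarrow> 'a \<Rightarrow> real" where
  "cell_incr T n l \<omega> = (T (grid n (l + 1)) \<omega> - T (grid n l) \<omega>) / grid n l"

locale finite_rate_SSA = prob_space M for M :: "'a measure" +
  fixes T :: "real \<Rightarrow> 'a \<Rightarrow> real" and \<theta> :: real
  assumes ssa: "one_SSA M T" and nondecr: "nondecreasing_process M T" and no_drift: "no_drift M T"
    and \<theta>_pos: "0 < \<theta>" and rate: "has_rate M T \<theta>"
begin

abbreviation "J \<equiv> jump_times T"

text \<open>The path properties used below, collected so that \<open>AE_good\<close> supplies them
  all at once. Finiteness is asked at level 0 only, since finer cells lie inside level 0
  cells.\<close>

definition good :: "'a \<Rightarrow> bool" where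
  "good \<omega> \<longleftrightarrow> \<omega> \<in> space M \<and> mono_on {0<..} (\<lambda>s. T s \<omega>) \<and>
    (\<forall>s>0. ((\<lambda>r. jump T r \<omega>) has_sum T s \<omega>) {0<..s}) \<and>
    (\<forall>i. finite (jump_cell T 0 i \<omega>)) \<and>
    infinite (J \<omega> \<inter> {0<..1}) \<and> infinite (J \<omega> \<inter> {1<..}) \<and>
    ((\<lambda>s. T s \<omega>) \<longlongrightarrow> 0) (at_right 0)"

lemma ppp: "poisson_point_process M (scale_invariant_intensity \<theta>) J"
  using rate by (simp add: has_rate_def scale_invariant_ppp_def)

lemma jump_times_pos: "s \<in> J \<omega> \<Longrightarrow> 0 < s"
  by (simp add: jump_times_def)

lemma jump_cell_eq: "jump_cell T n l \<omega> = J \<omega> \<inter> {grid n l<..grid n (l + 1)}"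
proof -
  have "idx n s = l \<longleftrightarrow> s \<in> {grid n l<..grid n (l + 1)}" if "s \<in> J \<omega>" for s
    using idx_eq_iff[OF jump_times_pos[OF that]] by simp
  then show ?thesis unfolding jump_cell_def by blast
qed

lemma measurable_T [measurable]: "0 < s \<Longrightarrow> T s \<in> borel_measurable M"
  using ssa by (simp add: one_SSA_def is_process_def)

lemma measurable_cell_incr [measurable]: "cell_incr T n l \<in> borel_measurable M"
  unfolding cell_incr_def by measurable

lemma measurable_num_points:
  "A \<in> sets borel \<Longrightarrow> A \<subseteq> {0<..} \<Longrightarrow> num_points J A \<in> borel_measurable M"
  using ppp by (auto simp: poisson_point_process_def sets_scale_invariant_intensity)

lemma emeasure_cell:
  "emeasure (scale_invariant_intensity \<theta>) {grid n l<..grid n (l + 1)} = ennreal (\<theta> * ln 2 / 2 ^ n)"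
proof -
  have "grid n l \<le> grid n (l + 1)" by (simp add: less_imp_le)
  moreover have "ln (grid n 1) = ln 2 / 2 ^ n"
    by (simp add: grid_def ln_powr)
  ultimately show ?thesis
    using \<theta>_pos by (subst emeasure_scale_invariant_intensity_interval)
      (auto simp: grid_add less_imp_neq[OF grid_pos, symmetric])
qed

text \<open>The intervals \<open>(2^-k, 1]\<close> have mass \<open>\<theta> * k * ln 2\<close>,
  unbounded in \<open>k\<close>. Infinite mass at both ends of the half-line is what allows a
  listing indexed by all integers.\<close>

lemma emeasure_near_0: "emeasure (scale_invariant_intensity \<theta>) {0<..1} = \<infinity>"
proof (rule ccontr)
  assume "\<not> ?thesis"
  then obtain m :: nat where m: "emeasure (scale_invariant_intensity \<theta>) {0<..1} < of_nat m"
    using ennreal_Ex_less_of_nat by (auto simp: less_top)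
  define k where "k = nat \<lceil>m / (\<theta> * ln 2)\<rceil>"
  have k: "real m \<le> \<theta> * ln (1 / (2 powr - real k))"
  proof -
    have "m / (\<theta> * ln 2) \<le> k" by (simp add: k_def real_nat_ceiling_ge)
    then show ?thesis using \<theta>_pos by (simp add: ln_div ln_powr divide_le_eq mult_ac)
  qed
  have "2 powr (- real k) \<le> 1"
    using ge_one_powr_ge_zero[of 2 "real k"] by (simp add: powr_minus inverse_le_1_iff)
  then have "of_nat m \<le> emeasure (scale_invariant_intensity \<theta>) {2 powr (- real k)<..1}"
    using \<theta>_pos k by (subst emeasure_scale_invariant_intensity_interval)
      (auto simp: ennreal_of_nat_eq_real_of_nat intro!: ennreal_leI)
  also have "\<dots> \<le> emeasure (scale_invariant_intensity \<theta>) {0<..1}"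
    by (rule emeasure_mono)
      (auto simp: sets_scale_invariant_intensity intro: le_less_trans[OF powr_ge_zero])
  finally show False using m by simp
qed

lemma emeasure_near_infinity: "emeasure (scale_invariant_intensity \<theta>) {1<..} = \<infinity>"
proof (rule ccontr)
  assume "\<not> ?thesis"
  then obtain m :: nat where m: "emeasure (scale_invariant_intensity \<theta>) {1<..} < of_nat m"
    using ennreal_Ex_less_of_nat by (auto simp: less_top)
  define k where "k = nat \<lceil>m / (\<theta> * ln 2)\<rceil>"
  have k: "real m \<le> \<theta> * ln ((2 powr real k) / 1)"
  proof -
    have "m / (\<theta> * ln 2) \<le> k" by (simp add: k_def real_nat_ceiling_ge)
    then show ?thesis using \<theta>_pos by (simp add: ln_powr divide_le_eq mult_ac)
  qed
  have "of_nat m \<le> emeasure (scale_invariant_intensity \<theta>) {1<..2 powr real k}"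
    using \<theta>_pos k by (subst emeasure_scale_invariant_intensity_interval)
      (auto simp: ge_one_powr_ge_zero ennreal_of_nat_eq_real_of_nat intro!: ennreal_leI)
  also have "\<dots> \<le> emeasure (scale_invariant_intensity \<theta>) {1<..}"
    by (rule emeasure_mono) (auto simp: sets_scale_invariant_intensity)
  finally show False using m by simp
qed

lemma AE_good: "AE \<omega> in M. good \<omega>"
proof -
  have "AE \<omega> in M. mono_on {0<..} (\<lambda>s. T s \<omega>)"
    using nondecr by (simp add: nondecreasing_process_def)
  moreover have "AE \<omega> in M. \<forall>s>0. ((\<lambda>r. jump T r \<omega>) has_sum T s \<omega>) {0<..s}"
    using no_drift by (simp add: no_drift_def has_deterministic_part_def)
  moreover have "AE \<omega> in M. \<forall>i. finite (jump_cell T 0 i \<omega>)"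
    unfolding AE_all_countable jump_cell_eq
    by (intro allI poisson_finite_AE[OF ppp])
      (auto simp: sets_scale_invariant_intensity emeasure_cell[simplified] intro: less_trans[OF grid_pos])
  moreover have "AE \<omega> in M. infinite (J \<omega> \<inter> {0<..1})" "AE \<omega> in M. infinite (J \<omega> \<inter> {1<..})"
    by (rule poisson_infinite_AE[OF ppp];
        auto simp: sets_scale_invariant_intensity emeasure_near_0 emeasure_near_infinity)+
  moreover have "AE \<omega> in M. ((\<lambda>s. T s \<omega>) \<longlongrightarrow> 0) (at_right 0)"
    using ssa by (simp add: one_SSA_def)
  ultimately show ?thesis
    using AE_space unfolding good_def by eventually_elim blast
qed

lemma left_lim_tendsto:
  assumes "\<omega> \<in> space M" "0 < s"
  shows "((\<lambda>r. T r \<omega>) \<longlongrightarrow> left_lim T s \<omega>) (at_left s)"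
proof -
  have "cadlag_on_pos (\<lambda>s. T s \<omega>)" using ssa assms by (auto simp: one_SSA_def)
  then obtain l where l: "((\<lambda>r. T r \<omega>) \<longlongrightarrow> l) (at_left s)"
    using assms by (auto simp: cadlag_on_pos_def)
  then have "left_lim T s \<omega> = l"
    unfolding left_lim_def by (intro tendsto_Lim) auto
  with l show ?thesis by simp
qed

lemma jump_nonneg:
  assumes "good \<omega>" "0 < s"
  shows "0 \<le> jump T s \<omega>"
proof -
  have "left_lim T s \<omega> \<le> T s \<omega>"
  proof (rule tendsto_upperbound[OF left_lim_tendsto])
    show "\<forall>\<^sub>F r in at_left s. T r \<omega> \<le> T s \<omega>"
      using assms by (auto simp: good_def mono_on_def eventually_at_left_field intro!: exI[of _ 0])
  qed (use assms in \<open>auto simp: good_def\<close>)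
  then show ?thesis by (simp add: jump_def)
qed

lemma jump_neq_0_iff: "good \<omega> \<Longrightarrow> 0 < s \<Longrightarrow> jump T s \<omega> \<noteq> 0 \<longleftrightarrow> s \<in> J \<omega>"
  using jump_nonneg[of \<omega> s] by (auto simp: jump_times_def jump_def)

lemma finite_jump_cell:
  assumes "good \<omega>"
  shows "finite (jump_cell T n l \<omega>)"
proof (rule finite_subset)
  show "jump_cell T n l \<omega> \<subseteq> jump_cell T 0 (l div 2 ^ n) \<omega>"
    using idx_div[of _ 0 n] by (auto simp: jump_cell_def jump_times_pos)
  show "finite (jump_cell T 0 (l div 2 ^ n) \<omega>)" using assms by (simp add: good_def)
qed

text \<open>Absence of drift enters here: \<open>T\<close> is the sum of its jumps up to either
  endpoint, the difference is the sum over the cell, and off the finitely many jump times the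
  summands vanish.\<close>

lemma cell_incr_eq_sum:
  assumes "good \<omega>"
  shows "cell_incr T n l \<omega> = (\<Sum>s\<in>jump_cell T n l \<omega>. jump T s \<omega>) / grid n l"
proof -
  let ?a = "grid n l" and ?b = "grid n (l + 1)"
  have ab: "?a < ?b" "0 < ?a" "0 < ?b" by auto
  have pos: "0 < x" if "?a < x" for x using that ab by linarith
  have "((\<lambda>r. jump T r \<omega>) has_sum (T ?b \<omega> - T ?a \<omega>)) ({0<..?b} - {0<..?a})"
    using assms ab by (intro has_sum_Diff) (auto simp: good_def simp del: grid_less_iff)
  also have "{0<..?b} - {0<..?a} = {?a<..?b}" using ab pos by auto
  finally have "((\<lambda>r. jump T r \<omega>) has_sum (T ?b \<omega> - T ?a \<omega>)) {?a<..?b}" .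
  then have "((\<lambda>r. jump T r \<omega>) has_sum (T ?b \<omega> - T ?a \<omega>)) (jump_cell T n l \<omega>)"
    using jump_neq_0_iff[OF assms] pos
    by (subst (asm) has_sum_cong_neutral[where T="jump_cell T n l \<omega>" and g="\<lambda>r. jump T r \<omega>"])
      (auto simp: jump_cell_eq)
  then have "T ?b \<omega> - T ?a \<omega> = (\<Sum>s\<in>jump_cell T n l \<omega>. jump T s \<omega>)"
    by (rule has_sum_unique) (simp add: finite_jump_cell[OF assms])
  then show ?thesis by (simp add: cell_incr_def)
qed

lemma cell_incr_eq_0_iff:
  assumes "good \<omega>"
  shows "cell_incr T n l \<omega> = 0 \<longleftrightarrow> jump_cell T n l \<omega> = {}"
proof -
  have "(\<Sum>s\<in>jump_cell T n l \<omega>. jump T s \<omega>) = 0 \<longleftrightarrow> (\<forall>s\<in>jump_cell T n l \<omega>. jump T s \<omega> = 0)"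
    using finite_jump_cell[OF assms] jump_nonneg[OF assms]
    by (intro sum_nonneg_eq_0_iff) (auto simp: jump_cell_def jump_times_pos)
  also have "\<dots> \<longleftrightarrow> jump_cell T n l \<omega> = {}"
    using jump_neq_0_iff[OF assms] by (fastforce simp: jump_cell_def dest: jump_times_pos)
  finally show ?thesis using grid_pos[of n l] by (simp add: cell_incr_eq_sum[OF assms] del: grid_pos)
qed

text \<open>Independence of increments is stated for finite increasing sequences of times. The
  endpoints of all consecutive cells from \<open>Min L\<close> to \<open>Max L\<close> form one, and
  \<open>L\<close> is a subfamily of these cells after shifting indices.\<close>

lemma indep_cell_incr:
  assumes "finite L"
  shows "indep_vars (\<lambda>_. borel) (cell_incr T n) L"
proof (cases "L = {}")
  case True
  then show ?thesis by (simp add: indep_vars_def2 indep_sets_def)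
next
  case False
  define a where "a = Min L"
  define t where "t i = grid n (a + int i)" for i
  define N where "N = nat (Max L - a) + 1"
  have "indep_vars (\<lambda>_. borel) (\<lambda>i \<omega>. T (t (Suc i)) \<omega> - T (t i) \<omega>) {..<N}"
    using ssa unfolding one_SSA_def independent_increments_def
    by (elim conjE allE[where x=t] allE[where x=N] impE) (auto simp: t_def)
  then have "indep_vars (\<lambda>_. borel) (\<lambda>i \<omega>. (T (t (Suc i)) \<omega> - T (t i) \<omega>) / t i) {..<N}"
    by (rule indep_vars_compose2[where Y="\<lambda>i x. x / t i"]) measurable
  moreover have bounds: "a \<le> l \<and> l \<le> Max L" if "l \<in> L" for l
    using that assms by (auto simp: a_def)
  have "inj_on (\<lambda>l. nat (l - a)) L"
    using bounds by (intro inj_onI) (metis diff_ge_0_iff_ge eq_nat_nat_iff diff_add_cancel)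
  moreover have "(\<lambda>l. nat (l - a)) ` L \<subseteq> {..<N}"
  proof
    fix i assume "i \<in> (\<lambda>l. nat (l - a)) ` L"
    then obtain l where "l \<in> L" "i = nat (l - a)" by blast
    with bounds[of l] show "i \<in> {..<N}" unfolding N_def by auto
  qed
  ultimately have "indep_vars (\<lambda>_. borel)
      (\<lambda>l \<omega>. (T (t (Suc (nat (l - a)))) \<omega> - T (t (nat (l - a))) \<omega>) / t (nat (l - a))) L"
    by (rule indep_vars_inj)
  then show ?thesis
  proof (rule indep_vars_cong[THEN iffD1, rotated -1])
    fix l assume "l \<in> L"
    then have "a \<le> l" using assms by (simp add: a_def)
    then show "(\<lambda>\<omega>. (T (t (Suc (nat (l - a)))) \<omega> - T (t (nat (l - a))) \<omega>) / t (nat (l - a))) = cell_incr T n l"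
      by (simp add: cell_incr_def t_def fun_eq_iff algebra_simps)
  qed auto
qed

text \<open>Pushing the finite-dimensional laws forward through \<open>f\<close> gives the form in
  which self-similarity is applied, to increments and to exponentials of a single value.\<close>

lemma distr_self_similar:
  assumes c: "0 < c" and I: "finite I" "I \<subseteq> {0<..}" and f: "f \<in> borel_measurable (PiM I (\<lambda>_. borel))"
  shows "distr M borel (\<lambda>\<omega>. f (\<lambda>s\<in>I. T (c * s) \<omega>)) = distr M borel (\<lambda>\<omega>. f (\<lambda>s\<in>I. c * T s \<omega>))"
proof -
  have eq: "distr M (PiM I (\<lambda>_. borel)) (\<lambda>\<omega>. \<lambda>s\<in>I. T (c * s) \<omega>) =
      distr M (PiM I (\<lambda>_. borel)) (\<lambda>\<omega>. \<lambda>s\<in>I. c * T s \<omega>)"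
    using ssa c I by (auto simp: one_SSA_def one_self_similar_def)
  have m: "(\<lambda>\<omega>. \<lambda>s\<in>I. T (c * s) \<omega>) \<in> measurable M (PiM I (\<lambda>_. borel))"
    "(\<lambda>\<omega>. \<lambda>s\<in>I. c * T s \<omega>) \<in> measurable M (PiM I (\<lambda>_. borel))"
    using c I by (auto intro!: measurable_restrict borel_measurable_times measurable_T)
  show ?thesis
    using distr_distr[OF f m(1)] distr_distr[OF f m(2)] by (simp add: o_def eq)
qed

text \<open>Scaling time by \<open>grid n l\<close> carries the cell \<open>(1, grid n 1]\<close> to
  cell \<open>l\<close>, and the same factor in space cancels against the normalization by the left
  endpoint.\<close>

lemma distr_cell_incr: "distr M borel (cell_incr T n l) = distr M borel (cell_incr T n 0)"
proof -
  define I where "I = {1, grid n 1}"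
  define f where "f x = (x (grid n 1) - x 1) / grid n l" for x :: "real \<Rightarrow> real"
  have "1 \<in> I" "grid n 1 \<in> I" by (auto simp: I_def)
  then have "f \<in> borel_measurable (PiM I (\<lambda>_. borel))"
    unfolding f_def by measurable
  then have "distr M borel (\<lambda>\<omega>. f (\<lambda>s\<in>I. T (grid n l * s) \<omega>)) = distr M borel (\<lambda>\<omega>. f (\<lambda>s\<in>I. grid n l * T s \<omega>))"
    by (intro distr_self_similar) (auto simp: I_def)
  also have "(\<lambda>\<omega>. f (\<lambda>s\<in>I. T (grid n l * s) \<omega>)) = cell_incr T n l"
    by (simp add: I_def f_def cell_incr_def fun_eq_iff grid_add)
  also have "(\<lambda>\<omega>. f (\<lambda>s\<in>I. grid n l * T s \<omega>)) = cell_incr T n 0"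
    using grid_pos[of n l] by (simp add: I_def f_def cell_incr_def fun_eq_iff right_diff_distrib [symmetric] del: grid_pos)
  finally show ?thesis .
qed

lemma cell_incr_law:
  assumes "f \<in> borel_measurable borel"
  shows "expectation (\<lambda>\<omega>. f (cell_incr T n l \<omega>) :: real) = expectation (\<lambda>\<omega>. f (cell_incr T n 0 \<omega>))"
  using assms integral_distr[of "cell_incr T n l" M borel f] integral_distr[of "cell_incr T n 0" M borel f]
  by (simp add: distr_cell_incr[of n l])

definition hit_prob :: "nat \<Rightarrow> real" where
  "hit_prob n = prob {\<omega> \<in> space M. cell_incr T n 0 \<omega> \<noteq> 0}"

text \<open>Up to a null set the cell is hit iff its Poisson count is nonzero, so this is one minus
  the void probability for mass \<open>\<theta> * ln 2 / 2 ^ n\<close>.\<close>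

lemma hit_prob: "hit_prob n = 1 - exp (- \<theta> * ln 2 / 2 ^ n)"
proof -
  define A where "A = {grid n 0<..grid n (0 + 1)}"
  have A: "A \<in> sets (scale_invariant_intensity \<theta>)"
    by (auto simp: A_def sets_scale_invariant_intensity)
  have em: "emeasure (scale_invariant_intensity \<theta>) A = ennreal (\<theta> * ln 2 / 2 ^ n)"
    unfolding A_def by (rule emeasure_cell)
  then have m: "measure (scale_invariant_intensity \<theta>) A = \<theta> * ln 2 / 2 ^ n"
    using \<theta>_pos by (simp add: measure_def)
  have [measurable]: "num_points J A \<in> borel_measurable M"
    using A by (auto intro: measurable_num_points simp: sets_scale_invariant_intensity)
  have "prob {\<omega> \<in> space M. num_points J A \<omega> = of_nat 0} = exp (- \<theta> * ln 2 / 2 ^ n)"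
  proof -
    have "prob {\<omega> \<in> space M. num_points J A \<omega> = of_nat 0} =
        measure (scale_invariant_intensity \<theta>) A ^ 0 / fact 0 * exp (- measure (scale_invariant_intensity \<theta>) A)"
      using ppp A em by (intro poisson_prob_num_points) auto
    then show ?thesis using m by simp
  qed
  also have "prob {\<omega> \<in> space M. num_points J A \<omega> = of_nat 0} = prob {\<omega> \<in> space M. cell_incr T n 0 \<omega> = 0}"
  proof (rule measure_eq_AE)
    show "AE x in M. (x \<in> {\<omega> \<in> space M. num_points J A \<omega> = of_nat 0}) =
        (x \<in> {\<omega> \<in> space M. cell_incr T n 0 \<omega> = 0})"
      using AE_good
    proof eventually_elim
      case (elim \<omega>)
      have "num_points J A \<omega> = of_nat 0 \<longleftrightarrow> jump_cell T n 0 \<omega> = {}"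
        using finite_jump_cell[OF elim, of n 0]
        by (simp add: num_points_def A_def jump_cell_eq emeasure_count_space)
      then show ?case
        using cell_incr_eq_0_iff[OF elim, of n 0] by simp
    qed
  qed auto
  also have "\<dots> = 1 - hit_prob n"
    unfolding hit_prob_def
    using prob_neg[of "\<lambda>\<omega>. cell_incr T n 0 \<omega> = 0"] by simp
  finally show ?thesis by simp
qed

lemma hit_prob_pos: "0 < hit_prob n"
  using \<theta>_pos by (simp add: hit_prob)

end

section \<open>Normalized jumps in distinct cells\<close>

text \<open>Grouping by the value of \<open>f\<close> leaves one factor per block when each block in
  \<open>I\<close> has a single element. It is applied once to the increments over hit cells and
  once to their conditional means.\<close>

lemma prod_one_per_block:
  fixes h :: "'b \<Rightarrow> 'c :: comm_monoid_mult"
  assumes B: "finite B" and I: "finite I" and r: "\<And>i. i \<in> I \<Longrightarrow> {l \<in> B. f l = i} = {r i}"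
  shows "(\<Prod>l\<in>B. if f l \<in> I then h l else 1) = (\<Prod>i\<in>I. h (r i))"
proof -
  have "(\<Prod>l\<in>B. if f l \<in> I then h l else 1) = prod h {l \<in> B. f l \<in> I}"
    using B by (simp add: prod.inter_filter)
  also have "\<dots> = (\<Prod>i\<in>I. prod h {l. l \<in> {l \<in> B. f l \<in> I} \<and> f l = i})"
    by (rule prod.group[symmetric]) (use B I in auto)
  also have "\<dots> = (\<Prod>i\<in>I. h (r i))"
  proof (rule prod.cong)
    fix i assume i: "i \<in> I"
    have "{l. l \<in> {l \<in> B. f l \<in> I} \<and> f l = i} = {l \<in> B. f l = i}" using i by auto
    then have "{l. l \<in> {l \<in> B. f l \<in> I} \<and> f l = i} = {r i}" using r[OF i] by simp
    then show "prod h {l. l \<in> {l \<in> B. f l \<in> I} \<and> f l = i} = h (r i)" by simp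
  qed simp
  finally show ?thesis .
qed

text \<open>A Dynkin class argument: the sets with equal integrals are closed under disjoint
  countable unions, and under complements because \<open>space M\<close> belongs to
  \<open>G\<close>.\<close>

lemma set_integral_eq_sigma_sets:
  fixes f h :: "'a \<Rightarrow> real"
  assumes G: "Int_stable G" "G \<subseteq> sets M" "space M \<in> G" and int: "integrable M f" "integrable M h"
    and eq: "\<And>A. A \<in> G \<Longrightarrow> (LINT x:A|M. f x) = (LINT x:A|M. h x)"
    and A: "A \<in> sigma_sets (space M) G"
  shows "(LINT x:A|M. f x) = (LINT x:A|M. h x)"
proof -
  have GP: "G \<subseteq> Pow (space M)" using G(2) sets.space_closed by blast
  have sub: "sigma_sets (space M) G \<subseteq> sets M"
    using G(2) by (rule sets.sigma_sets_subset)
  have sint: "set_integrable M A f" "set_integrable M A h" if "A \<in> sets M" for A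
    using int that unfolding set_integrable_def by (intro integrable_mult_indicator; simp)+
  from G(1) GP A show ?thesis
  proof (induction rule: sigma_sets_induct_disjoint)
    case (basic A)
    then show ?case by (rule eq)
  next
    case empty
    then show ?case by (simp add: set_lebesgue_integral_def)
  next
    case (compl A)
    then have A: "A \<in> sets M" using sub by blast
    have *: "(LINT x:space M - A|M. g x) = (LINT x:space M|M. g x) - (LINT x:A|M. g x)"
      if "integrable M g" for g :: "'a \<Rightarrow> real"
    proof -
      have s: "set_integrable M B g" if "B \<in> sets M" for B
        using \<open>integrable M g\<close> that unfolding set_integrable_def by (intro integrable_mult_indicator)
      have "(LINT x:(space M - A) \<union> A|M. g x) = (LINT x:space M - A|M. g x) + (LINT x:A|M. g x)"
        using A by (intro set_integral_Un s) auto
      moreover have "(space M - A) \<union> A = space M" using A sets.sets_into_space by blast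
      ultimately show ?thesis by simp
    qed
    show ?case using *[OF int(1)] *[OF int(2)] compl.IH eq[OF G(3)] by simp
  next
    case (union A)
    then have A: "range A \<subseteq> sets M" using sub by blast
    have "(LINT x:(\<Union>i. A i)|M. g x) = (\<Sum>i. (LINT x:A i|M. g x))"
      if "integrable M g" for g :: "'a \<Rightarrow> real"
    proof (rule lebesgue_integral_countable_add)
      show "set_integrable M (\<Union>i. A i) g"
        using A that unfolding set_integrable_def by (intro integrable_mult_indicator) auto
    qed (use A union(1) in \<open>auto simp: disjoint_family_on_def\<close>)
    then show ?case using int union.IH by simp
  qed
qed

section \<open>Independence given the set of hit cells\<close>

context finite_rate_SSA
begin

text \<open>Conditional expectation of \<open>g\<close> of the increment given that cell 0 is hit;
  by equality of laws it serves for every cell of the level. The value \<open>g 0\<close> must not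
  contribute, hence the case distinction.\<close>

definition cond_mean :: "nat \<Rightarrow> (real \<Rightarrow> real) \<Rightarrow> real" where
  "cond_mean n g = expectation (\<lambda>\<omega>. if cell_incr T n 0 \<omega> = 0 then 0 else g (cell_incr T n 0 \<omega>)) / hit_prob n"

text \<open>Cut off at the window, this random set has finitely many possible values, so
  expectations can be summed over them.\<close>

definition hit_cells :: "nat \<Rightarrow> 'a \<Rightarrow> int set" where
  "hit_cells n \<omega> = {l \<in> window n. cell_incr T n l \<omega> \<noteq> 0}"

lemma finite_hit_cells [simp]: "finite (hit_cells n \<omega>)"
  by (simp add: hit_cells_def)

lemma hit_cells_sub: "hit_cells n \<omega> \<subseteq> window n"
  by (auto simp: hit_cells_def)

lemma expectation_if_cell_incr:
  assumes [measurable]: "g \<in> borel_measurable borel"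
  shows "expectation (\<lambda>\<omega>. if cell_incr T n l \<omega> = 0 then 0 else g (cell_incr T n l \<omega>)) = hit_prob n * cond_mean n g"
proof -
  show "expectation (\<lambda>\<omega>. if cell_incr T n l \<omega> = 0 then 0 else g (cell_incr T n l \<omega>)) = hit_prob n * cond_mean n g"
    using hit_prob_pos[of n] cell_incr_law[of "\<lambda>x. if x = 0 then 0 else g x" n l]
    by (simp add: cond_mean_def)
qed

lemma expectation_not_hit: "expectation (\<lambda>\<omega>. of_bool (cell_incr T n l \<omega> = 0)) = 1 - hit_prob n"
proof -
  have "expectation (\<lambda>\<omega>. of_bool (cell_incr T n l \<omega> = 0) :: real) = expectation (\<lambda>\<omega>. of_bool (cell_incr T n 0 \<omega> = 0))"
    by (rule cell_incr_law[of "\<lambda>x. of_bool (x = 0)" n l]) (simp add: of_bool_def)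
  also have "\<dots> = expectation (indicator {\<omega> \<in> space M. cell_incr T n 0 \<omega> = 0})"
    by (intro Bochner_Integration.integral_cong) (auto simp: indicator_def)
  also have "\<dots> = 1 - hit_prob n"
    unfolding hit_prob_def using prob_neg[of "\<lambda>\<omega>. cell_incr T n 0 \<omega> = 0"] by simp
  finally show "expectation (\<lambda>\<omega>. of_bool (cell_incr T n l \<omega> = 0)) = 1 - hit_prob n" .
qed

lemma cond_mean_1: "cond_mean n (\<lambda>_. 1) = 1"
proof -
  have "expectation (\<lambda>\<omega>. if cell_incr T n 0 \<omega> = 0 then 0 else 1 :: real) =
      expectation (indicator {\<omega> \<in> space M. cell_incr T n 0 \<omega> \<noteq> 0})"
    by (intro Bochner_Integration.integral_cong) (auto simp: indicator_def)
  then show ?thesis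
    using hit_prob_pos[of n] by (simp add: cond_mean_def hit_prob_def)
qed

lemma measurable_hit_cells [measurable]: "hit_cells n \<in> measurable M (count_space UNIV)"
proof (rule measurableI)
  fix \<B> :: "int set set"
  have "hit_cells n -` \<B> \<inter> space M =
      (\<Union>B\<in>\<B> \<inter> Pow (window n). {\<omega> \<in> space M. \<forall>l\<in>window n. (cell_incr T n l \<omega> \<noteq> 0) = (l \<in> B)})"
  proof -
    have "(\<forall>l\<in>window n. (cell_incr T n l \<omega> \<noteq> 0) = (l \<in> B)) \<longleftrightarrow> hit_cells n \<omega> = B"
      if "B \<subseteq> window n" for \<omega> B
      using that by (auto simp: hit_cells_def)
    then show ?thesis using hit_cells_sub by auto
  qed
  also have "\<dots> \<in> events"
    by (intro sets.finite_UN) (simp, measurable)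
  finally show "hit_cells n -` \<B> \<inter> space M \<in> events" .
qed simp

text \<open>Summing over the possible hit patterns \<open>B\<close> turns the expectation into
  products over the whole window, where independence and equality of laws apply cell by
  cell.\<close>

lemma pattern_expansion:
  assumes G: "\<And>l. G l \<in> borel_measurable borel" "\<And>l x. \<bar>G l x\<bar> \<le> 1"
    and \<B>: "\<B> \<subseteq> Pow (window n)"
  shows "expectation (\<lambda>\<omega>. of_bool (hit_cells n \<omega> \<in> \<B>) * (\<Prod>l\<in>hit_cells n \<omega>. G l (cell_incr T n l \<omega>))) =
    (\<Sum>B\<in>\<B>. (\<Prod>l\<in>window n. if l \<in> B then hit_prob n else 1 - hit_prob n) * (\<Prod>l\<in>B. cond_mean n (G l)))"
proof -
  note [measurable] = G(1)
  \<comment> \<open>The factor of cell \<open>l\<close> under the demand that the pattern be exactly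
    \<open>B\<close>: a cell in \<open>B\<close> must be hit and carries \<open>G\<close>, any other
    must not be hit. Every pattern except the actual one therefore contains a zero factor.\<close>
  define h where "h B l x = (if l \<in> B then (if x = 0 then 0 else G l x) else of_bool (x = 0))" for B l and x :: real
  have h_meas [measurable]: "h B l \<in> borel_measurable borel" for B l
    unfolding h_def of_bool_def by measurable
  have h_bound: "\<bar>h B l x\<bar> \<le> 1" for B l x using G(2) by (simp add: h_def)
  have fin: "finite \<B>" using \<B> by (rule finite_subset) simp
  have pointwise: "of_bool (hit_cells n \<omega> \<in> \<B>) * (\<Prod>l\<in>hit_cells n \<omega>. G l (cell_incr T n l \<omega>)) =
      (\<Sum>B\<in>\<B>. \<Prod>l\<in>window n. h B l (cell_incr T n l \<omega>))" for \<omega>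
  proof -
    have zero: "(\<Prod>l\<in>window n. h B l (cell_incr T n l \<omega>)) = 0" if "B \<in> \<B>" "B \<noteq> hit_cells n \<omega>" for B
    proof -
      from that have "B \<noteq> hit_cells n \<omega>" by simp
      obtain l where "(l \<in> B) \<noteq> (l \<in> hit_cells n \<omega>)" using \<open>B \<noteq> hit_cells n \<omega>\<close> by (auto simp: set_eq_iff)
      then have "l \<in> window n" "(l \<in> B) \<noteq> (cell_incr T n l \<omega> \<noteq> 0)"
        using that \<B> by (auto simp: hit_cells_def)
      then show ?thesis by (intro prod_zero) (auto simp: h_def intro!: bexI[of _ l])
    qed
    have eq: "(\<Prod>l\<in>window n. h (hit_cells n \<omega>) l (cell_incr T n l \<omega>)) = (\<Prod>l\<in>hit_cells n \<omega>. G l (cell_incr T n l \<omega>))"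
      by (rule prod.mono_neutral_cong_right) (auto simp: h_def hit_cells_def)
    have "(\<Sum>B\<in>\<B>. \<Prod>l\<in>window n. h B l (cell_incr T n l \<omega>)) =
        (\<Sum>B\<in>\<B>. if B = hit_cells n \<omega> then \<Prod>l\<in>window n. h B l (cell_incr T n l \<omega>) else 0)"
      using zero by (intro sum.cong) auto
    then show ?thesis using fin eq by (simp add: sum.delta')
  qed
  have int: "integrable M (\<lambda>\<omega>. h B l (cell_incr T n l \<omega>))" for B l
    by (rule integrable_const_bound[of _ 1]) (use h_bound in auto)
  have ind: "indep_vars (\<lambda>_. borel) (\<lambda>l \<omega>. h B l (cell_incr T n l \<omega>)) (window n)" for B
    by (rule indep_vars_compose2[OF indep_cell_incr]) auto
  have "expectation (\<lambda>\<omega>. \<Sum>B\<in>\<B>. \<Prod>l\<in>window n. h B l (cell_incr T n l \<omega>)) =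
      (\<Sum>B\<in>\<B>. expectation (\<lambda>\<omega>. \<Prod>l\<in>window n. h B l (cell_incr T n l \<omega>)))"
    by (intro Bochner_Integration.integral_sum indep_vars_integrable ind int) simp
  also have "\<dots> = (\<Sum>B\<in>\<B>. \<Prod>l\<in>window n. expectation (\<lambda>\<omega>. h B l (cell_incr T n l \<omega>)))"
    by (intro sum.cong refl indep_vars_lebesgue_integral ind int) simp
  also have "\<dots> = (\<Sum>B\<in>\<B>. (\<Prod>l\<in>window n. if l \<in> B then hit_prob n else 1 - hit_prob n) * (\<Prod>l\<in>B. cond_mean n (G l)))"
  proof (intro sum.cong refl)
    fix B assume "B \<in> \<B>"
    then have B: "B \<subseteq> window n" using \<B> by auto
    have "(\<Prod>l\<in>window n. expectation (\<lambda>\<omega>. h B l (cell_incr T n l \<omega>))) =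
        (\<Prod>l\<in>window n. (if l \<in> B then hit_prob n else 1 - hit_prob n) * (if l \<in> B then cond_mean n (G l) else 1))"
      by (intro prod.cong refl) (simp add: h_def expectation_if_cell_incr expectation_not_hit)
    also have "\<dots> = (\<Prod>l\<in>window n. if l \<in> B then hit_prob n else 1 - hit_prob n) *
        (\<Prod>l\<in>window n. if l \<in> B then cond_mean n (G l) else 1)"
      by (rule prod.distrib)
    also have "(\<Prod>l\<in>window n. if l \<in> B then cond_mean n (G l) else 1) = (\<Prod>l\<in>B. cond_mean n (G l))"
      using B by (subst prod.inter_restrict[symmetric]) (auto simp: Int_absorb1)
    finally show "(\<Prod>l\<in>window n. expectation (\<lambda>\<omega>. h B l (cell_incr T n l \<omega>))) =
      (\<Prod>l\<in>window n. if l \<in> B then hit_prob n else 1 - hit_prob n) * (\<Prod>l\<in>B. cond_mean n (G l))" .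
  qed
  finally show ?thesis by (simp add: pointwise)
qed

text \<open>Given the set of hit cells, the normalized increments over them are i.i.d.\<close>

lemma pattern_expectation:
  assumes G: "\<And>l. G l \<in> borel_measurable borel" "\<And>l x. \<bar>G l x\<bar> \<le> 1"
    and \<B>: "\<B> \<subseteq> Pow (window n)" "\<And>B. B \<in> \<B> \<Longrightarrow> (\<Prod>l\<in>B. cond_mean n (G l)) = c"
  shows "expectation (\<lambda>\<omega>. of_bool (hit_cells n \<omega> \<in> \<B>) * (\<Prod>l\<in>hit_cells n \<omega>. G l (cell_incr T n l \<omega>))) =
    expectation (\<lambda>\<omega>. of_bool (hit_cells n \<omega> \<in> \<B>)) * c"
  \<comment> \<open>With \<open>G\<close> constantly 1 the expansion evaluates the probability of
    the patterns; comparison with the general expansion pulls out \<open>c\<close>.\<close>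
  using pattern_expansion[of "\<lambda>_ _. 1" \<B> n] pattern_expansion[of G \<B> n] assms
  by (simp add: cond_mean_1 sum_distrib_right)

end

section \<open>Patterns with isolated hit cells and their limits\<close>

context finite_rate_SSA
begin

text \<open>If the block has exactly one hit cell, this is the increment over it; summing avoids
  naming the random position of that cell.\<close>

definition block_sum :: "nat \<Rightarrow> nat \<Rightarrow> int \<Rightarrow> 'a \<Rightarrow> real" where
  "block_sum n q i \<omega> = (\<Sum>l | l \<in> window n \<and> l div 2 ^ (n - q) = i. cell_incr T n l \<omega>)"

text \<open>The level \<open>n\<close> counterpart of \<open>void p F \<inter> singles q I\<close>,
  expressed by hit cells alone. There are two levels \<open>p\<close> and \<open>q\<close> because
  void events of all levels have to be combined with cells of one fixed level.\<close>

definition isolated :: "nat \<Rightarrow> nat \<Rightarrow> int set \<Rightarrow> nat \<Rightarrow> int set \<Rightarrow> int set set" where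
  "isolated n p F q I = {B. B \<subseteq> window n \<and> (\<forall>l\<in>B. l div 2 ^ (n - p) \<notin> F) \<and>
    (\<forall>i\<in>I. card {l \<in> B. l div 2 ^ (n - q) = i} = 1)}"

lemma measurable_block_sum [measurable]: "block_sum n q i \<in> borel_measurable M"
  unfolding block_sum_def[abs_def] by measurable

text \<open>The factor attached to a hit cell depends only on its block, and each block in
  \<open>I\<close> has one hit cell. Hence the product of conditional means is the same for all
  these patterns, as \<open>pattern_expectation\<close> demands.\<close>

lemma isolated_expectation:
  fixes g :: "int \<Rightarrow> real \<Rightarrow> real"
  assumes I: "finite I" and g: "\<And>i. g i \<in> borel_measurable borel" "\<And>i x. \<bar>g i x\<bar> \<le> 1"
  shows "expectation (\<lambda>\<omega>. of_bool (hit_cells n \<omega> \<in> isolated n p F q I) * (\<Prod>i\<in>I. g i (block_sum n q i \<omega>))) =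
    expectation (\<lambda>\<omega>. of_bool (hit_cells n \<omega> \<in> isolated n p F q I)) * (\<Prod>i\<in>I. cond_mean n (g i))"
proof -
  define blk :: "int \<Rightarrow> int" where "blk l = l div 2 ^ (n - q)" for l
  \<comment> \<open>Hit cells outside the blocks in \<open>I\<close> receive the constant 1, whose
    conditional mean is 1.\<close>
  define G where "G l = (if blk l \<in> I then g (blk l) else (\<lambda>_. 1))" for l
  have choice: "\<exists>r. \<forall>i\<in>I. {l \<in> B. blk l = i} = {r i}" if "B \<in> isolated n p F q I" for B
  proof (intro bchoice ballI)
    fix i assume "i \<in> I"
    with that have "card {l \<in> B. blk l = i} = 1" unfolding isolated_def blk_def by blast
    then show "\<exists>x. {l \<in> B. blk l = i} = {x}" by (rule card_1_singletonE) blast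
  qed
  have "expectation (\<lambda>\<omega>. of_bool (hit_cells n \<omega> \<in> isolated n p F q I) * (\<Prod>i\<in>I. g i (block_sum n q i \<omega>))) =
    expectation (\<lambda>\<omega>. of_bool (hit_cells n \<omega> \<in> isolated n p F q I) * (\<Prod>l\<in>hit_cells n \<omega>. G l (cell_incr T n l \<omega>)))"
  proof (rule Bochner_Integration.integral_cong[OF refl])
    fix \<omega>
    show "of_bool (hit_cells n \<omega> \<in> isolated n p F q I) * (\<Prod>i\<in>I. g i (block_sum n q i \<omega>)) =
      of_bool (hit_cells n \<omega> \<in> isolated n p F q I) * (\<Prod>l\<in>hit_cells n \<omega>. G l (cell_incr T n l \<omega>))"
    proof (cases "hit_cells n \<omega> \<in> isolated n p F q I")
      case True
      from choice[OF this] obtain r where "\<forall>i\<in>I. {l \<in> hit_cells n \<omega>. blk l = i} = {r i}" ..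
      then have r: "\<And>i. i \<in> I \<Longrightarrow> {l \<in> hit_cells n \<omega>. blk l = i} = {r i}" by (rule bspec)
      have "(\<Prod>l\<in>hit_cells n \<omega>. G l (cell_incr T n l \<omega>)) =
          (\<Prod>l\<in>hit_cells n \<omega>. if blk l \<in> I then g (blk l) (cell_incr T n l \<omega>) else 1)"
        by (intro prod.cong) (auto simp: G_def)
      also have "\<dots> = (\<Prod>i\<in>I. g (blk (r i)) (cell_incr T n (r i) \<omega>))"
        by (rule prod_one_per_block) (use I r in auto)
      also have "\<dots> = (\<Prod>i\<in>I. g i (block_sum n q i \<omega>))"
      proof (intro prod.cong refl)
        fix i assume i: "i \<in> I"
        have "block_sum n q i \<omega> = (\<Sum>l\<in>{l \<in> hit_cells n \<omega>. blk l = i}. cell_incr T n l \<omega>)"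
          unfolding block_sum_def blk_def hit_cells_def by (rule sum.mono_neutral_right) auto
        moreover have "blk (r i) = i" using r[OF i] by auto
        ultimately show "g (blk (r i)) (cell_incr T n (r i) \<omega>) = g i (block_sum n q i \<omega>)"
          using r[OF i] by simp
      qed
      finally show ?thesis by simp
    qed simp
  qed
  also have "\<dots> = expectation (\<lambda>\<omega>. of_bool (hit_cells n \<omega> \<in> isolated n p F q I)) * (\<Prod>i\<in>I. cond_mean n (g i))"
  proof (rule pattern_expectation)
    show "isolated n p F q I \<subseteq> Pow (window n)" by (auto simp: isolated_def)
    fix B assume B: "B \<in> isolated n p F q I"
    from choice[OF this] obtain r where "\<forall>i\<in>I. {l \<in> B. blk l = i} = {r i}" ..
    then have r: "\<And>i. i \<in> I \<Longrightarrow> {l \<in> B. blk l = i} = {r i}" by (rule bspec)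
    have fB: "finite B" using B by (auto simp: isolated_def intro: finite_subset)
    have "(\<Prod>l\<in>B. cond_mean n (G l)) = (\<Prod>l\<in>B. if blk l \<in> I then cond_mean n (g (blk l)) else 1)"
      by (intro prod.cong) (auto simp: G_def cond_mean_1)
    also have "\<dots> = (\<Prod>i\<in>I. cond_mean n (g (blk (r i))))"
      by (rule prod_one_per_block) (use I r fB in auto)
    also have "\<dots> = (\<Prod>i\<in>I. cond_mean n (g i))"
    proof (intro prod.cong refl)
      fix i assume "i \<in> I"
      then have "blk (r i) = i" using r by blast
      then show "cond_mean n (g (blk (r i))) = cond_mean n (g i)" by simp
    qed
    finally show "(\<Prod>l\<in>B. cond_mean n (G l)) = (\<Prod>i\<in>I. cond_mean n (g i))" .
  qed (use g in \<open>auto simp: G_def\<close>)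
  finally show ?thesis .
qed

lemma jump_cell_refine:
  "q \<le> n \<Longrightarrow> jump_cell T q i \<omega> = {s \<in> J \<omega>. idx n s div 2 ^ (n - q) = i}"
  by (auto simp: jump_cell_def idx_div jump_times_pos)

text \<open>Once the window contains the block, each jump is counted once, divided by the left
  endpoint of its cell instead of by its time \<open>s\<close>; that endpoint tends to
  \<open>s\<close>, and the sum is finite.\<close>

lemma block_sum_tendsto:
  assumes "good \<omega>"
  shows "(\<lambda>n. block_sum n q i \<omega>) \<longlonglongrightarrow> (\<Sum>s\<in>jump_cell T q i \<omega>. jump T s \<omega> / s)"
proof -
  let ?P = "jump_cell T q i \<omega>"
  have "\<forall>\<^sub>F n in sequentially. (\<Sum>s\<in>?P. jump T s \<omega> / grid n (idx n s)) = block_sum n q i \<omega>"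
    using eventually_block_window[of q i] eventually_ge_at_top[of q]
  proof eventually_elim
    case (elim n)
    let ?L = "{l. l \<in> window n \<and> l div 2 ^ (n - q) = i}"
    have "(\<Sum>s\<in>?P. jump T s \<omega> / grid n (idx n s)) =
        (\<Sum>l\<in>?L. \<Sum>s | s \<in> ?P \<and> idx n s = l. jump T s \<omega> / grid n (idx n s))"
    proof (rule sum.group[symmetric])
      show "finite ?P" by (rule finite_jump_cell[OF assms])
      show "finite ?L" by simp
      show "idx n ` ?P \<subseteq> ?L"
        unfolding jump_cell_refine[OF elim(2)] using elim(1) by auto
    qed
    also have "\<dots> = block_sum n q i \<omega>"
      unfolding block_sum_def
    proof (intro sum.cong refl)
      fix l assume l: "l \<in> ?L"
      have "{s. s \<in> ?P \<and> idx n s = l} = jump_cell T n l \<omega>"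
        using l unfolding jump_cell_refine[OF elim(2)] by (auto simp: jump_cell_def)
      then show "(\<Sum>s | s \<in> ?P \<and> idx n s = l. jump T s \<omega> / grid n (idx n s)) = cell_incr T n l \<omega>"
        by (auto simp: cell_incr_eq_sum[OF assms] sum_divide_distrib jump_cell_def intro!: sum.cong)
    qed
    finally show ?case .
  qed
  moreover have "(\<lambda>n. \<Sum>s\<in>?P. jump T s \<omega> / grid n (idx n s)) \<longlonglongrightarrow> (\<Sum>s\<in>?P. jump T s \<omega> / s)"
    by (intro tendsto_intros grid_idx_tendsto) (auto simp: jump_cell_def dest: jump_times_pos)
  ultimately show ?thesis by (rule Lim_transform_eventually[rotated])
qed

definition void :: "nat \<Rightarrow> int set \<Rightarrow> 'a set" where
  "void p F = {\<omega> \<in> space M. \<forall>i\<in>F. jump_cell T p i \<omega> = {}}"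

definition singles :: "nat \<Rightarrow> int set \<Rightarrow> 'a set" where
  "singles q I = {\<omega> \<in> space M. \<forall>i\<in>I. card (jump_cell T q i \<omega>) = 1}"

text \<open>If the cell contains a single jump time, this is almost surely its normalized jump.\<close>

definition mark :: "nat \<Rightarrow> int \<Rightarrow> 'a \<Rightarrow> real" where
  "mark q i \<omega> = lim (\<lambda>n. block_sum n q i \<omega>)"

lemma measurable_mark [measurable]: "mark q i \<in> borel_measurable M"
  unfolding mark_def[abs_def] by measurable

lemma mark_eq: "good \<omega> \<Longrightarrow> mark q i \<omega> = (\<Sum>s\<in>jump_cell T q i \<omega>. jump T s \<omega> / s)"
  unfolding mark_def by (intro limI block_sum_tendsto)

lemma block_sum_tendsto_mark: "good \<omega> \<Longrightarrow> (\<lambda>n. block_sum n q i \<omega>) \<longlonglongrightarrow> mark q i \<omega>"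
  using block_sum_tendsto mark_eq by metis

lemma measurable_num_points_cell [measurable]:
  "num_points J {grid n l<..grid n (l + 1)} \<in> borel_measurable M"
  by (intro measurable_num_points) (auto intro: less_trans[OF grid_pos[of n l]] simp del: grid_pos)

lemma num_points_cell: "num_points J {grid n l<..grid n (l + 1)} \<omega> = emeasure (count_space UNIV) (jump_cell T n l \<omega>)"
  by (simp add: num_points_def jump_cell_eq)

lemma jump_cell_empty_iff: "jump_cell T n l \<omega> = {} \<longleftrightarrow> num_points J {grid n l<..grid n (l + 1)} \<omega> = 0"
  by (auto simp: num_points_cell emeasure_count_space_eq_0)

lemma card_jump_cell_1_iff: "card (jump_cell T n l \<omega>) = 1 \<longleftrightarrow> num_points J {grid n l<..grid n (l + 1)} \<omega> = 1"
  by (cases "finite (jump_cell T n l \<omega>)")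
    (auto simp: num_points_cell simp del: One_nat_def)

lemma void_sets [measurable]: "finite F \<Longrightarrow> void p F \<in> events"
  unfolding void_def jump_cell_empty_iff by (intro sets.sets_Collect_finite_All) measurable

lemma singles_sets [measurable]: "finite I \<Longrightarrow> singles q I \<in> events"
  unfolding singles_def card_jump_cell_1_iff by (intro sets.sets_Collect_finite_All) measurable

text \<open>At a fine level the hit cells of a block are in bijection with the jump times in it, so
  the hit pattern decides emptiness and cardinality 1 correctly. How fine the level must be depends
  on the outcome.\<close>

lemma eventually_isolated_iff:
  assumes \<omega>: "good \<omega>" and F: "finite F" and I: "finite I"
  shows "\<forall>\<^sub>F n in sequentially. hit_cells n \<omega> \<in> isolated n p F q I \<longleftrightarrow> \<omega> \<in> void p F \<inter> singles q I"
proof -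
  have hit: "{l \<in> hit_cells n \<omega>. l div 2 ^ (n - q) = i} = idx n ` jump_cell T q i \<omega>"
    if "\<forall>l. l div 2 ^ (n - q) = i \<longrightarrow> l \<in> window n" "q \<le> n" for n q i
    using that by (auto simp: hit_cells_def cell_incr_eq_0_iff[OF \<omega>] jump_cell_refine) (auto simp: jump_cell_def)
  have 1: "\<forall>\<^sub>F n in sequentially. \<forall>i\<in>F. \<forall>l. l div 2 ^ (n - p) = i \<longrightarrow> l \<in> window n"
    using F by (intro eventually_ball_finite ballI eventually_block_window)
  have 2: "\<forall>\<^sub>F n in sequentially. \<forall>i\<in>I. (\<forall>l. l div 2 ^ (n - q) = i \<longrightarrow> l \<in> window n) \<and> inj_on (idx n) (jump_cell T q i \<omega>)"
    using I by (intro eventually_ball_finite ballI eventually_conj eventually_block_window eventually_inj_idx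
        finite_jump_cell[OF \<omega>]) (auto simp: jump_cell_def jump_times_pos)
  from 1 2 eventually_ge_at_top[of "max p q"] show ?thesis
  proof eventually_elim
    case (elim n)
    have "(\<forall>l\<in>hit_cells n \<omega>. l div 2 ^ (n - p) \<notin> F) \<longleftrightarrow> (\<forall>i\<in>F. {l \<in> hit_cells n \<omega>. l div 2 ^ (n - p) = i} = {})"
      by auto
    also have "\<dots> \<longleftrightarrow> (\<forall>i\<in>F. jump_cell T p i \<omega> = {})"
      using elim hit[of n p] by auto
    finally have v: "(\<forall>l\<in>hit_cells n \<omega>. l div 2 ^ (n - p) \<notin> F) \<longleftrightarrow> (\<forall>i\<in>F. jump_cell T p i \<omega> = {})" .
    have s: "(\<forall>i\<in>I. card {l \<in> hit_cells n \<omega>. l div 2 ^ (n - q) = i} = 1) \<longleftrightarrow> (\<forall>i\<in>I. card (jump_cell T q i \<omega>) = 1)"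
      using elim hit[of n q] by (intro ball_cong refl) (simp add: card_image)
    show ?case
      using v s \<omega> by (simp add: isolated_def void_def singles_def good_def hit_cells_sub)
  qed
qed

text \<open>The Poisson weight at 1 is positive, which makes conditioning on a single jump
  legitimate.\<close>

lemma single_prob_pos: "0 < prob (singles q {i})"
proof -
  define A where "A = {grid q i<..grid q (i + 1)}"
  have A: "A \<in> sets (scale_invariant_intensity \<theta>)"
    by (auto simp: A_def sets_scale_invariant_intensity intro: less_trans[OF grid_pos[of q i]] simp del: grid_pos)
  have em: "emeasure (scale_invariant_intensity \<theta>) A = ennreal (\<theta> * ln 2 / 2 ^ q)"
    unfolding A_def by (rule emeasure_cell)
  then have m: "measure (scale_invariant_intensity \<theta>) A = \<theta> * ln 2 / 2 ^ q"
    using \<theta>_pos by (simp add: measure_def)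
  have "prob {\<omega> \<in> space M. num_points J A \<omega> = of_nat 1} =
      measure (scale_invariant_intensity \<theta>) A ^ 1 / fact 1 * exp (- measure (scale_invariant_intensity \<theta>) A)"
    using ppp A em by (intro poisson_prob_num_points) auto
  then have "prob {\<omega> \<in> space M. num_points J A \<omega> = 1} = \<theta> * ln 2 / 2 ^ q * exp (- (\<theta> * ln 2 / 2 ^ q))"
    using m by simp
  then have "prob (singles q {i}) = \<theta> * ln 2 / 2 ^ q * exp (- (\<theta> * ln 2 / 2 ^ q))"
    by (simp add: singles_def card_jump_cell_1_iff A_def del: One_nat_def)
  then show ?thesis using \<theta>_pos by simp
qed

text \<open>Law of the mark of the reference cell \<open>(1,2]\<close>, conditioned on a single jump
  there. The choice of the cell is arbitrary; this turns out to be the law of the generic jump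
  \<open>J\<close>.\<close>

definition mark_law :: "real measure" where
  "mark_law = distr (uniform_measure M (singles 0 {0})) borel (mark 0 0)"

lemma real_distribution_mark_law: "real_distribution mark_law"
proof -
  have "emeasure M (singles 0 {0}) \<noteq> 0" using single_prob_pos[of 0 0] by (simp add: emeasure_eq_measure)
  then interpret U: prob_space "uniform_measure M (singles 0 {0})"
    by (intro prob_space_uniform_measure) auto
  interpret D: prob_space mark_law
    unfolding mark_law_def by (rule U.prob_space_distr) simp
  show ?thesis by standard (simp_all add: mark_law_def)
qed

lemma integral_mark_law:
  assumes [measurable]: "g \<in> borel_measurable borel"
  shows "(LINT x|mark_law. g x) = (LINT \<omega>:singles 0 {0}|M. g (mark 0 0 \<omega>)) / prob (singles 0 {0})"
proof -
  have "(LINT x|mark_law. g x) = (LINT \<omega>|uniform_measure M (singles 0 {0}). g (mark 0 0 \<omega>))"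
    unfolding mark_law_def by (rule integral_distr) simp_all
  also have "uniform_measure M (singles 0 {0}) =
      density M (\<lambda>\<omega>. ennreal (indicator (singles 0 {0}) \<omega> / prob (singles 0 {0})))"
    unfolding uniform_measure_def
    using single_prob_pos[of 0 0]
    by (intro density_cong) (auto simp: emeasure_eq_measure divide_ennreal simp flip: ennreal_1 split: split_indicator)
  also have "(LINT \<omega>|\<dots>. g (mark 0 0 \<omega>)) =
      (LINT \<omega>|M. (indicator (singles 0 {0}) \<omega> / prob (singles 0 {0})) *\<^sub>R g (mark 0 0 \<omega>))"
    by (rule integral_density) auto
  finally show ?thesis
    by (simp add: set_lebesgue_integral_def)
qed

text \<open>Dominated convergence with bound 1: block sums tend to marks and \<open>g i\<close> is
  continuous, while the pattern indicator is eventually constant for almost every outcome.\<close>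

lemma isolated_limit:
  fixes g :: "int \<Rightarrow> real \<Rightarrow> real"
  assumes F: "finite F" and I: "finite I" and g: "\<And>i. continuous_on UNIV (g i)" "\<And>i x. \<bar>g i x\<bar> \<le> 1"
  shows "(\<lambda>n. expectation (\<lambda>\<omega>. of_bool (hit_cells n \<omega> \<in> isolated n p F q I) * (\<Prod>i\<in>I. g i (block_sum n q i \<omega>))))
    \<longlonglongrightarrow> (LINT \<omega>:void p F \<inter> singles q I|M. \<Prod>i\<in>I. g i (mark q i \<omega>))"
  unfolding set_lebesgue_integral_def
proof (rule integral_dominated_convergence[where w="\<lambda>_. 1"
      and s="\<lambda>n \<omega>. of_bool (hit_cells n \<omega> \<in> isolated n p F q I) * (\<Prod>i\<in>I. g i (block_sum n q i \<omega>))"])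
  have [measurable]: "g i \<in> borel_measurable borel" for i
    using g(1) by (rule borel_measurable_continuous_onI)
  note [measurable] = void_sets[OF F] singles_sets[OF I]
  show "(\<lambda>\<omega>. indicator (void p F \<inter> singles q I) \<omega> *\<^sub>R (\<Prod>i\<in>I. g i (mark q i \<omega>))) \<in> borel_measurable M"
    by measurable
  show "(\<lambda>\<omega>. of_bool (hit_cells n \<omega> \<in> isolated n p F q I) * (\<Prod>i\<in>I. g i (block_sum n q i \<omega>))) \<in> borel_measurable M" for n
  proof -
    have [measurable]: "Measurable.pred M (\<lambda>\<omega>. hit_cells n \<omega> \<in> isolated n p F q I)"
      by (rule measurable_compose[OF measurable_hit_cells]) simp
    have "(\<lambda>\<omega>. of_bool (hit_cells n \<omega> \<in> isolated n p F q I) :: real) \<in> borel_measurable M"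
      unfolding of_bool_def by measurable
    moreover have "(\<lambda>\<omega>. \<Prod>i\<in>I. g i (block_sum n q i \<omega>)) \<in> borel_measurable M"
      by (intro borel_measurable_prod measurable_compose[OF measurable_block_sum]) simp
    ultimately show ?thesis by (rule borel_measurable_times)
  qed
  have bound: "\<bar>\<Prod>i\<in>I. g i (f i)\<bar> \<le> 1" for f
    unfolding abs_prod by (intro prod_le_1) (auto simp: g)
  show "AE \<omega> in M. norm (of_bool (hit_cells n \<omega> \<in> isolated n p F q I) * (\<Prod>i\<in>I. g i (block_sum n q i \<omega>))) \<le> 1" for n
    using bound by (auto simp: abs_mult)
  show "AE \<omega> in M. (\<lambda>n. of_bool (hit_cells n \<omega> \<in> isolated n p F q I) * (\<Prod>i\<in>I. g i (block_sum n q i \<omega>)))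
      \<longlonglongrightarrow> indicator (void p F \<inter> singles q I) \<omega> *\<^sub>R (\<Prod>i\<in>I. g i (mark q i \<omega>))"
    using AE_good
  proof eventually_elim
    case (elim \<omega>)
    have "(\<lambda>n. g i (block_sum n q i \<omega>)) \<longlonglongrightarrow> g i (mark q i \<omega>)" for i
      using continuous_on_tendsto_compose[OF g(1)[of i] block_sum_tendsto_mark[OF elim]] by simp
    then have "(\<lambda>n. indicator (void p F \<inter> singles q I) \<omega> *\<^sub>R (\<Prod>i\<in>I. g i (block_sum n q i \<omega>)))
        \<longlonglongrightarrow> indicator (void p F \<inter> singles q I) \<omega> *\<^sub>R (\<Prod>i\<in>I. g i (mark q i \<omega>))"
      by (intro tendsto_intros)
    then show ?case
      by (rule Lim_transform_eventually)
        (use eventually_isolated_iff[OF elim F I, of p q] in eventually_elim, auto simp: indicator_def)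
  qed
qed auto

lemma isolated_prob_limit:
  assumes "finite F" "finite I"
  shows "(\<lambda>n. expectation (\<lambda>\<omega>. of_bool (hit_cells n \<omega> \<in> isolated n p F q I))) \<longlonglongrightarrow> prob (void p F \<inter> singles q I)"
proof -
  have "void p F \<inter> singles q I \<in> events" using assms by simp
  then have "(LINT \<omega>:void p F \<inter> singles q I|M. 1) = prob (void p F \<inter> singles q I)"
    by (simp add: set_lebesgue_integral_def)
  then show ?thesis using isolated_limit[OF assms, of "\<lambda>_ _. 1" p q] by simp
qed

text \<open>With one block and no void constraint, \<open>isolated_expectation\<close> exhibits
  \<open>cond_mean n g\<close> as a mean conditioned on an isolated pattern in the reference cell,
  as soon as such patterns have positive probability. This quotient tends to the mean under
  \<open>mark_law\<close>.\<close>

lemma cond_mean_tendsto: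
  fixes g :: "real \<Rightarrow> real"
  assumes g: "continuous_on UNIV g" "\<And>x. \<bar>g x\<bar> \<le> 1"
  shows "(\<lambda>n. cond_mean n g) \<longlonglongrightarrow> (LINT x|mark_law. g x)"
proof -
  have [measurable]: "g \<in> borel_measurable borel"
    using g(1) by (rule borel_measurable_continuous_onI)
  have void: "void 0 {} \<inter> singles 0 {0} = singles 0 {0}" by (auto simp: void_def singles_def)
  let ?c = "\<lambda>n. expectation (\<lambda>\<omega>. of_bool (hit_cells n \<omega> \<in> isolated n 0 {} 0 {0}))"
  let ?e = "\<lambda>n. expectation (\<lambda>\<omega>. of_bool (hit_cells n \<omega> \<in> isolated n 0 {} 0 {0}) * (\<Prod>i\<in>{0}. g (block_sum n 0 i \<omega>)))"
  have c: "?c \<longlonglongrightarrow> prob (singles 0 {0})"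
    using isolated_prob_limit[of "{}" "{0}" 0 0] unfolding void by blast
  have e: "?e \<longlonglongrightarrow> (LINT \<omega>:singles 0 {0}|M. g (mark 0 0 \<omega>))"
    using isolated_limit[of "{}" "{0}" "\<lambda>_. g" 0 0] g unfolding void by simp
  have "(\<lambda>n. ?e n / ?c n) \<longlonglongrightarrow> (LINT x|mark_law. g x)"
    using tendsto_divide[OF e c] single_prob_pos[of 0 0] by (simp add: integral_mark_law)
  moreover have "\<forall>\<^sub>F n in sequentially. ?e n / ?c n = cond_mean n g"
    using order_tendstoD(1)[OF c single_prob_pos]
  proof eventually_elim
    case (elim n)
    then show ?case
      using isolated_expectation[of "{0}" "\<lambda>_. g" n 0 "{}" 0] g by simp
  qed
  ultimately show ?thesis by (rule Lim_transform_eventually)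
qed

text \<open>The limit of \<open>isolated_expectation\<close> on both sides. The factor on the right
  is the probability of the whole event, so the independence obtained is conditional on each cell in
  \<open>I\<close> holding a single jump.\<close>

lemma void_formula:
  fixes g :: "int \<Rightarrow> real \<Rightarrow> real"
  assumes F: "finite F" and I: "finite I" and g: "\<And>i. continuous_on UNIV (g i)" "\<And>i x. \<bar>g i x\<bar> \<le> 1"
  shows "(LINT \<omega>:void p F \<inter> singles q I|M. \<Prod>i\<in>I. g i (mark q i \<omega>)) =
    prob (void p F \<inter> singles q I) * (\<Prod>i\<in>I. LINT x|mark_law. g i x)"
proof (rule LIMSEQ_unique[OF isolated_limit[OF assms]])
  have "(\<lambda>n. expectation (\<lambda>\<omega>. of_bool (hit_cells n \<omega> \<in> isolated n p F q I)) * (\<Prod>i\<in>I. cond_mean n (g i)))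
      \<longlonglongrightarrow> prob (void p F \<inter> singles q I) * (\<Prod>i\<in>I. LINT x|mark_law. g i x)"
    by (intro tendsto_mult tendsto_prod isolated_prob_limit cond_mean_tendsto F I g)
  then show "(\<lambda>n. expectation (\<lambda>\<omega>. of_bool (hit_cells n \<omega> \<in> isolated n p F q I) * (\<Prod>i\<in>I. g i (block_sum n q i \<omega>))))
      \<longlonglongrightarrow> prob (void p F \<inter> singles q I) * (\<Prod>i\<in>I. LINT x|mark_law. g i x)"
    by (subst isolated_expectation[OF I borel_measurable_continuous_onI[OF g(1)] g(2)])
qed

end

section \<open>Listing the jump times\<close>

lemma grid_less_iff_idx:
  assumes "0 < s"
  shows "grid n a < s \<longleftrightarrow> a \<le> idx n s"
proof (cases "a \<le> idx n s")
  case True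
  then have "grid n a \<le> grid n (idx n s)" by (simp add: not_less[symmetric])
  then show ?thesis using True idx_bounds(1)[OF assms, of n] by linarith
next
  case False
  then have "grid n (idx n s + 1) \<le> grid n a" by (simp add: not_less[symmetric])
  then show ?thesis using False idx_bounds(2)[OF assms, of n] by linarith
qed

lemma le_grid_iff_idx: "0 < s \<Longrightarrow> s \<le> grid n b \<longleftrightarrow> idx n s < b"
  by (metis grid_less_iff_idx not_le)

text \<open>Whether some point of the range hits a given cell inside \<open>A\<close> is a countable
  union over \<open>z\<close>, so the supremum formula for counts applies.\<close>

lemma measurable_count_range:
  fixes X :: "int \<Rightarrow> 'a \<Rightarrow> real"
  assumes X: "\<And>z. X z \<in> borel_measurable N" and A: "A \<in> sets borel" "A \<subseteq> {0<..}"
  shows "num_points (\<lambda>\<omega>. range (\<lambda>z. X z \<omega>)) A \<in> borel_measurable N"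
proof -
  note [measurable] = X A(1)
  have eq: "num_points (\<lambda>\<omega>. range (\<lambda>z. X z \<omega>)) A \<omega> =
      (SUP n. \<Sum>l\<in>window n. of_bool (\<exists>z. X z \<omega> \<in> A \<and> idx n (X z \<omega>) = l))" for \<omega>
  proof -
    have "num_points (\<lambda>\<omega>. range (\<lambda>z. X z \<omega>)) A \<omega> =
        (SUP n. of_nat (card {l \<in> window n. \<exists>s\<in>range (\<lambda>z. X z \<omega>) \<inter> A. idx n s = l}))"
      unfolding num_points_def by (rule count_eq_SUP_idx) (use A in auto)
    also have "\<dots> = (SUP n. \<Sum>l\<in>window n. of_bool (\<exists>z. X z \<omega> \<in> A \<and> idx n (X z \<omega>) = l))"
    proof (intro SUP_cong refl)
      fix n
      have "{l \<in> window n. \<exists>s\<in>range (\<lambda>z. X z \<omega>) \<inter> A. idx n s = l} =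
          window n \<inter> {l. \<exists>z. X z \<omega> \<in> A \<and> idx n (X z \<omega>) = l}" by auto
      then show "of_nat (card {l \<in> window n. \<exists>s\<in>range (\<lambda>z. X z \<omega>) \<inter> A. idx n s = l}) =
          (\<Sum>l\<in>window n. of_bool (\<exists>z. X z \<omega> \<in> A \<and> idx n (X z \<omega>) = l) :: ennreal)"
        by (simp add: sum_of_bool_eq)
    qed
    finally show ?thesis .
  qed
  have [measurable]: "Measurable.pred N (\<lambda>\<omega>. idx n (X z \<omega>) = l)" for n z l
    unfolding idx_def by measurable
  show ?thesis
    unfolding eq of_bool_def by measurable
qed

section \<open>Increasing enumeration of a locally finite point set infinite towards both
  ends\<close>

text \<open>The counting function of \<open>P\<close>, normalized to vanish at 1 and hence
  nonpositive to the left of 1.\<close>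

definition signed_count :: "real set \<Rightarrow> real \<Rightarrow> int" where
  "signed_count P s = (if 1 \<le> s then int (card (P \<inter> {1<..s})) else - int (card (P \<inter> {s<..1})))"

locale bilateral_points =
  fixes P :: "real set"
  assumes pos: "P \<subseteq> {0<..}" and locally_finite: "0 < a \<Longrightarrow> finite (P \<inter> {a<..b})"
    and unbounded_above: "\<exists>s>0. z \<le> signed_count P s" and unbounded_below: "\<exists>s>0. signed_count P s \<le> z"
begin

lemma signed_count_diff:
  assumes "0 < a" "a \<le> b"
  shows "signed_count P b = signed_count P a + int (card (P \<inter> {a<..b}))"
proof -
  have split: "card (P \<inter> {a<..c}) = card (P \<inter> {a<..b}) + card (P \<inter> {b<..c})"
    if "0 < a" "a \<le> b" "b \<le> c" for a b c
  proof -
    have "P \<inter> {a<..c} = (P \<inter> {a<..b}) \<union> (P \<inter> {b<..c})" using that by auto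
    also have "card \<dots> = card (P \<inter> {a<..b}) + card (P \<inter> {b<..c})"
      using that by (intro card_Un_disjoint locally_finite) auto
    finally show ?thesis .
  qed
  consider "1 \<le> a" | "a < 1" "1 \<le> b" | "b < 1" by linarith
  then show ?thesis
  proof cases
    case 1
    then show ?thesis using split[of 1 a b] assms by (simp add: signed_count_def)
  next
    case 2
    then show ?thesis using split[of a 1 b] assms by (simp add: signed_count_def)
  next
    case 3
    then show ?thesis using split[of a b 1] assms by (simp add: signed_count_def)
  qed
qed

lemma signed_count_mono: "0 < a \<Longrightarrow> a \<le> b \<Longrightarrow> signed_count P a \<le> signed_count P b"
  using signed_count_diff[of a b] by simp

lemma signed_count_less:
  assumes "0 < a" "a < b" "b \<in> P"
  shows "signed_count P a < signed_count P b"
proof -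
  have "card (P \<inter> {a<..b}) > 0"
    using assms locally_finite[OF assms(1), of b] by (auto simp: card_gt_0_iff)
  then show ?thesis using signed_count_diff[of a b] assms by simp
qed

text \<open>A discrete intermediate value argument: the leftmost point beyond \<open>a\<close> whose
  count is at least \<open>z\<close> has count exactly \<open>z\<close>.\<close>

lemma ex_signed_count: "\<exists>s\<in>P. signed_count P s = z"
proof -
  obtain a where a: "0 < a" "signed_count P a \<le> z - 1" using unbounded_below by blast
  obtain b where b: "0 < b" "z \<le> signed_count P b" using unbounded_above by blast
  have ab: "a \<le> b" using signed_count_mono[of b a] a b by linarith
  define Q where "Q = {s \<in> P \<inter> {a<..b}. z \<le> signed_count P s}"
  have fin: "finite (P \<inter> {a<..c})" for c using locally_finite a by blast
  have last: "\<exists>s\<in>P \<inter> {a<..c}. P \<inter> {s<..c} = {}" if "P \<inter> {a<..c} \<noteq> {}" for c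
  proof (intro bexI)
    show "Max (P \<inter> {a<..c}) \<in> P \<inter> {a<..c}" using fin that by (rule Max_in)
    then show "P \<inter> {Max (P \<inter> {a<..c})<..c} = {}"
      using Max_ge[OF fin[of c]] by force
  qed
  have "P \<inter> {a<..b} \<noteq> {}" using signed_count_diff[OF a(1) ab] a b by auto
  from last[OF this] obtain s where s: "s \<in> P" "a < s" "s \<le> b" "P \<inter> {s<..b} = {}" by auto
  then have "signed_count P s = signed_count P b" using signed_count_diff[of s b] a by simp
  then have "Q \<noteq> {}" using s b by (auto simp: Q_def)
  moreover have finQ: "finite Q" unfolding Q_def by (rule finite_subset[OF _ fin[of b]]) auto
  ultimately have m: "Min Q \<in> Q" by simp
  define m where "m = Min Q"
  have m: "m \<in> P" "a < m" "m \<le> b" "z \<le> signed_count P m" using m by (auto simp: Q_def m_def)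
  have "signed_count P m = z"
  proof (rule ccontr)
    \<comment> \<open>An excess leaves a further point between \<open>a\<close> and
      \<open>m\<close>; the last such point \<open>r\<close> has count one lower, which is still at
      least \<open>z\<close>, against the minimality of \<open>m\<close>.\<close>
    assume "signed_count P m \<noteq> z"
    then have "2 \<le> card (P \<inter> {a<..m})" using m a signed_count_diff[of a m] by simp
    moreover have "P \<inter> {a<..m} = insert m (P \<inter> {a<..<m})" using m by auto
    moreover have "finite (P \<inter> {a<..<m})" by (rule finite_subset[OF _ fin[of m]]) auto
    ultimately have ne: "P \<inter> {a<..<m} \<noteq> {}" by auto
    define r where "r = Max (P \<inter> {a<..<m})"
    have finm: "finite (P \<inter> {a<..<m})" by fact
    have r: "r \<in> P \<inter> {a<..<m}" unfolding r_def by (rule Max_in[OF finm ne])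
    have "P \<inter> {r<..m} = {m}"
    proof (intro equalityI subsetI)
      fix s assume s: "s \<in> P \<inter> {r<..m}"
      show "s \<in> {m}"
      proof (rule ccontr)
        assume "s \<notin> {m}"
        then have "s \<in> P \<inter> {a<..<m}" using s r by auto
        then have "s \<le> r" unfolding r_def using finm by (rule Max_ge[rotated])
        then show False using s by simp
      qed
    qed (use r m in auto)
    then have "signed_count P m = signed_count P r + 1"
      using signed_count_diff[of r m] r a by simp
    then have "r \<in> Q" using r m \<open>signed_count P m \<noteq> z\<close> by (auto simp: Q_def)
    then have "m \<le> r" unfolding m_def using finQ by simp
    then show False using r by simp
  qed
  then show ?thesis using m by blast
qed

lemma inj_signed_count: "inj_on (signed_count P) P"
proof (rule inj_onI)
  fix s t assume st: "s \<in> P" "t \<in> P" "signed_count P s = signed_count P t"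
  then have "0 < s" "0 < t" using pos by auto
  then show "s = t"
    using st signed_count_less[of s t] signed_count_less[of t s] by (cases s t rule: linorder_cases) auto
qed

text \<open>The shift by one makes \<open>enum 0\<close> the first point after 1, where the count is
  1.\<close>

definition enum :: "int \<Rightarrow> real" where
  "enum z = (THE s. s \<in> P \<and> signed_count P s = z + 1)"

lemma enum: "enum z \<in> P" "signed_count P (enum z) = z + 1"
proof -
  have "\<exists>!s. s \<in> P \<and> signed_count P s = z + 1"
    using ex_signed_count[of "z + 1"] inj_onD[OF inj_signed_count] by metis
  from theI'[OF this] show "enum z \<in> P" "signed_count P (enum z) = z + 1"
    by (auto simp: enum_def)
qed

lemma enum_pos: "0 < enum z"
  using enum(1) pos by auto

text \<open>Translates the position of a listed point into a statement about counts, which is the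
  source of measurability of the listing.\<close>

lemma enum_le_iff: "0 < s \<Longrightarrow> enum z \<le> s \<longleftrightarrow> z + 1 \<le> signed_count P s"
  using signed_count_mono[OF enum_pos, of z s] signed_count_less[of s "enum z"] enum[of z]
  by (cases "enum z \<le> s") auto

lemma strict_mono_enum: "strict_mono enum"
proof (rule strict_monoI)
  fix z w :: int assume "z < w"
  then have "\<not> enum w \<le> enum z"
    using enum_le_iff[OF enum_pos, of w z] by (simp add: enum(2))
  then show "enum z < enum w" by simp
qed

lemma bij_betw_enum: "bij_betw enum UNIV P"
proof (rule bij_betw_imageI)
  show "inj enum" using strict_mono_enum by (rule strict_mono_imp_inj_on)
  show "range enum = P"
  proof (intro equalityI subsetI)
    fix s assume s: "s \<in> P"
    have "enum (signed_count P s - 1) = s"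
      by (rule inj_onD[OF inj_signed_count]) (use s enum in auto)
    then show "s \<in> range enum" by (metis rangeI)
  qed (use enum in auto)
qed

lemma enum_around_1: "enum (- 1) \<le> 1" "1 < enum 0"
  using enum_le_iff[of 1 "-1"] enum_le_iff[of 1 0] by (auto simp: signed_count_def)

end

section \<open>The algebra of void events and the canonical listing\<close>

context finite_rate_SSA
begin

text \<open>The counts of all cells are measurable for the algebra generated by the void events, whereas counts of
  arbitrary Borel sets only agree with such functions almost surely.\<close>

definition voids :: "'a set set" where
  "voids = {void p F | p F. finite F}"

definition hit_algebra :: "'a measure" where
  "hit_algebra = sigma (space M) voids"

lemma void_alt: "void p F = {\<omega> \<in> space M. \<forall>s\<in>J \<omega>. idx p s \<notin> F}"
  by (auto simp: void_def jump_cell_def)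

lemma finite_blocks: "finite F \<Longrightarrow> finite {l::int. l div 2 ^ m \<in> F}"
proof -
  assume "finite F"
  then have "finite (\<Union>i\<in>F. {l::int. l div 2 ^ m = i})" by (intro finite_UN_I finite_block)
  also have "(\<Union>i\<in>F. {l::int. l div 2 ^ m = i}) = {l. l div 2 ^ m \<in> F}" by auto
  finally show ?thesis .
qed

lemma void_refine: "p \<le> n \<Longrightarrow> void p F = void n {l. l div 2 ^ (n - p) \<in> F}"
  by (auto simp: void_alt idx_div jump_times_pos)

lemma void_Int: "void n F \<inter> void n F' = void n (F \<union> F')"
  by (auto simp: void_alt)

text \<open>Both events are rewritten at the common level \<open>max p q\<close>, where the
  intersection is the void event of the union of the two sets of cells.\<close>

lemma Int_stable_voids: "Int_stable voids"
proof (rule Int_stableI)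
  fix A B assume "A \<in> voids" "B \<in> voids"
  then obtain p F q F' where AB: "A = void p F" "B = void q F'" "finite F" "finite F'"
    by (auto simp: voids_def)
  define n where "n = max p q"
  have "A \<inter> B = void n ({l. l div 2 ^ (n - p) \<in> F} \<union> {l. l div 2 ^ (n - q) \<in> F'})"
    using void_refine[of p n F] void_refine[of q n F'] by (simp add: AB n_def void_Int)
  moreover have "finite ({l::int. l div 2 ^ (n - p) \<in> F} \<union> {l. l div 2 ^ (n - q) \<in> F'})"
    using AB by (intro finite_UnI finite_blocks)
  ultimately show "A \<inter> B \<in> voids" by (auto simp: voids_def)
qed

lemma voids_subset: "voids \<subseteq> events"
  by (auto simp: voids_def)

lemma space_in_voids: "space M \<in> voids"
  by (auto simp: voids_def void_def intro!: exI[of _ "{}"])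

lemma voids_Pow: "voids \<subseteq> Pow (space M)"
  using voids_subset sets.space_closed by blast

lemma space_hit_algebra [simp]: "space hit_algebra = space M"
  by (simp add: hit_algebra_def voids_Pow)

lemma sets_hit_algebra: "sets hit_algebra = sigma_sets (space M) voids"
  by (simp add: hit_algebra_def voids_Pow)

lemma hit_algebra_subset: "sets hit_algebra \<subseteq> events"
  unfolding sets_hit_algebra using voids_subset by (rule sets.sigma_sets_subset)

text \<open>Void events form a generating \<pi>-system containing the whole space, so
  \<open>void_formula\<close> extends to all of \<open>hit_algebra\<close>.\<close>

lemma hit_formula:
  fixes g :: "int \<Rightarrow> real \<Rightarrow> real"
  assumes I: "finite I" and g: "\<And>i. continuous_on UNIV (g i)" "\<And>i x. \<bar>g i x\<bar> \<le> 1" and C: "C \<in> sets hit_algebra"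
  shows "(LINT \<omega>:C|M. indicator (singles q I) \<omega> * (\<Prod>i\<in>I. g i (mark q i \<omega>))) =
    (LINT \<omega>:C|M. indicator (singles q I) \<omega> * (\<Prod>i\<in>I. LINT x|mark_law. g i x))"
proof (rule set_integral_eq_sigma_sets[OF Int_stable_voids voids_subset space_in_voids])
  have [measurable]: "g i \<in> borel_measurable borel" for i
    using g(1) by (rule borel_measurable_continuous_onI)
  have bound: "\<bar>\<Prod>i\<in>I. g i (f i)\<bar> \<le> 1" for f
    unfolding abs_prod by (intro prod_le_1) (auto simp: g)
  note [measurable] = singles_sets[OF I]
  show "integrable M (\<lambda>\<omega>. indicator (singles q I) \<omega> * (\<Prod>i\<in>I. g i (mark q i \<omega>)))"
    by (rule integrable_const_bound[of _ 1]) (use bound in \<open>auto simp: indicator_def\<close>)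
  show "integrable M (\<lambda>\<omega>. indicator (singles q I) \<omega> * (\<Prod>i\<in>I. LINT x|mark_law. g i x))"
    by (intro integrable_mult_left integrable_real_indicator) (auto simp: emeasure_eq_measure)
  fix A assume "A \<in> voids"
  then obtain p F where A: "A = void p F" and F: "finite F" by (auto simp: voids_def)
  note [measurable] = void_sets[OF F]
  have "(LINT \<omega>:A|M. indicator (singles q I) \<omega> * (\<Prod>i\<in>I. g i (mark q i \<omega>))) =
      (LINT \<omega>:void p F \<inter> singles q I|M. \<Prod>i\<in>I. g i (mark q i \<omega>))"
    unfolding set_lebesgue_integral_def A by (intro Bochner_Integration.integral_cong) (auto simp: indicator_def)
  also have "\<dots> = prob (void p F \<inter> singles q I) * (\<Prod>i\<in>I. LINT x|mark_law. g i x)"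
    by (rule void_formula[OF F I g])
  also have "\<dots> = (LINT \<omega>|M. indicator (void p F \<inter> singles q I) \<omega> * (\<Prod>i\<in>I. LINT x|mark_law. g i x))"
    by simp
  also have "\<dots> = (LINT \<omega>:A|M. indicator (singles q I) \<omega> * (\<Prod>i\<in>I. LINT x|mark_law. g i x))"
    unfolding set_lebesgue_integral_def A by (intro Bochner_Integration.integral_cong) (auto simp: indicator_def)
  finally show "(LINT \<omega>:A|M. indicator (singles q I) \<omega> * (\<Prod>i\<in>I. g i (mark q i \<omega>))) =
      (LINT \<omega>:A|M. indicator (singles q I) \<omega> * (\<Prod>i\<in>I. LINT x|mark_law. g i x))" .
qed (use C in \<open>simp add: sets_hit_algebra\<close>)

text \<open>A level \<open>n\<close> cell contains a jump time of the level \<open>q\<close> cell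
  \<open>i\<close> iff the finitely many cells of the common level \<open>N\<close> lying in both
  are not all void. The count is a supremum of sums of such indicators.\<close>

lemma measurable_hit_num_points:
  "num_points J {grid q i<..grid q (i + 1)} \<in> borel_measurable hit_algebra"
proof -
  have hit: "{\<omega> \<in> space hit_algebra. \<exists>s\<in>jump_cell T q i \<omega>. idx n s = l} \<in> sets hit_algebra" for n l
  proof -
    define N where "N = max n q"
    define F where "F = {m::int. m div 2 ^ (N - q) = i \<and> m div 2 ^ (N - n) = l}"
    have fin: "finite F" unfolding F_def by (rule finite_subset[OF _ finite_block[of "N - q" i]]) auto
    have "q \<le> N" "n \<le> N" by (auto simp: N_def)
    then have "{\<omega> \<in> space hit_algebra. \<exists>s\<in>jump_cell T q i \<omega>. idx n s = l} = space M - void N F"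
      by (auto simp: void_alt F_def idx_div jump_times_pos jump_cell_def)
    moreover have "void N F \<in> sets hit_algebra"
      using fin by (auto simp: sets_hit_algebra voids_def)
    ultimately show ?thesis using sets.compl_sets[of "void N F" hit_algebra] by simp
  qed
  have eq: "num_points J {grid q i<..grid q (i + 1)} \<omega> =
      (SUP n. \<Sum>l\<in>window n. of_bool (\<exists>s\<in>jump_cell T q i \<omega>. idx n s = l))" for \<omega>
  proof -
    have "num_points J {grid q i<..grid q (i + 1)} \<omega> =
        (SUP n. of_nat (card {l \<in> window n. \<exists>s\<in>jump_cell T q i \<omega>. idx n s = l}))"
      unfolding num_points_cell by (rule count_eq_SUP_idx) (auto simp: jump_cell_def jump_times_pos)
    also have "\<dots> = (SUP n. \<Sum>l\<in>window n. of_bool (\<exists>s\<in>jump_cell T q i \<omega>. idx n s = l))"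
      by (intro SUP_cong refl) (simp add: sum_of_bool_eq Int_def)
    finally show ?thesis .
  qed
  have [measurable]: "Measurable.pred hit_algebra (\<lambda>\<omega>. \<exists>s\<in>jump_cell T q i \<omega>. idx n s = l)" for n l
    using hit by (simp add: pred_def)
  show ?thesis
    unfolding eq of_bool_def by measurable
qed

text \<open>The signed count at a grid point, written with cell counts so that measurability is
  immediate. \<open>enn2real\<close> sends infinity to 0, but infinite cell counts occur only
  outside \<open>regular\<close>.\<close>

definition grid_count :: "nat \<Rightarrow> int \<Rightarrow> 'a \<Rightarrow> real" where
  "grid_count n j \<omega> = (\<Sum>l\<in>{0..<j}. enn2real (num_points J {grid n l<..grid n (l + 1)} \<omega>)) -
    (\<Sum>l\<in>{j..<0}. enn2real (num_points J {grid n l<..grid n (l + 1)} \<omega>))"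

text \<open>In contrast to \<open>good\<close>, this event depends on the cell counts only.\<close>

definition regular :: "'a \<Rightarrow> bool" where
  "regular \<omega> \<longleftrightarrow> (\<forall>i. num_points J {grid 0 i<..grid 0 (i + 1)} \<omega> \<noteq> \<infinity>) \<and>
    (\<forall>m::int. \<exists>j. of_int m \<le> grid_count 0 j \<omega>) \<and> (\<forall>m::int. \<exists>j. grid_count 0 j \<omega> \<le> of_int m)"

lemma measurable_grid_count: "grid_count n j \<in> borel_measurable hit_algebra"
proof -
  note [measurable] = measurable_hit_num_points
  show ?thesis unfolding grid_count_def[abs_def] by measurable
qed

lemma measurable_regular: "Measurable.pred hit_algebra regular"
proof -
  note [measurable] = measurable_hit_num_points measurable_grid_count
  show ?thesis unfolding regular_def[abs_def] by measurable
qed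

lemma finite_between:
  assumes "\<And>i. finite (jump_cell T 0 i \<omega>)" "0 < a"
  shows "finite (J \<omega> \<inter> {a<..b})"
proof (rule finite_subset)
  show "J \<omega> \<inter> {a<..b} \<subseteq> (\<Union>i\<in>{idx 0 a..idx 0 b}. jump_cell T 0 i \<omega>)"
  proof
    fix s assume s: "s \<in> J \<omega> \<inter> {a<..b}"
    then have "idx 0 a \<le> idx 0 s" "idx 0 s \<le> idx 0 b"
      using assms(2) jump_times_pos[of s \<omega>] by (auto intro!: idx_mono)
    then show "s \<in> (\<Union>i\<in>{idx 0 a..idx 0 b}. jump_cell T 0 i \<omega>)"
      using s by (auto simp: jump_cell_def)
  qed
qed (use assms in auto)

text \<open>Adjacent cells fill the interval between two grid points, and one of the two sums in
  \<open>grid_count\<close> is always empty.\<close>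

lemma grid_count_eq:
  assumes fin: "\<And>i. finite (jump_cell T 0 i \<omega>)"
  shows "grid_count n j \<omega> = of_int (signed_count (J \<omega>) (grid n j))"
proof -
  have cells: "(\<Sum>l\<in>{a..<b}. enn2real (num_points J {grid n l<..grid n (l + 1)} \<omega>)) =
      real (card (J \<omega> \<inter> {grid n a<..grid n b}))" for a b
  proof -
    have fin': "finite (jump_cell T n l \<omega>)" for l
      using finite_between[OF fin grid_pos] by (simp add: jump_cell_eq)
    have "(\<Sum>l\<in>{a..<b}. enn2real (num_points J {grid n l<..grid n (l + 1)} \<omega>)) =
        real (\<Sum>l\<in>{a..<b}. card (jump_cell T n l \<omega>))"
      using fin' by (simp add: num_points_cell ennreal_of_nat_eq_real_of_nat)
    also have "(\<Sum>l\<in>{a..<b}. card (jump_cell T n l \<omega>)) = card (\<Union>l\<in>{a..<b}. jump_cell T n l \<omega>)"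
      using fin' by (intro card_UN_disjoint[symmetric]) (auto simp: jump_cell_def)
    also have "(\<Union>l\<in>{a..<b}. jump_cell T n l \<omega>) = J \<omega> \<inter> {grid n a<..grid n b}"
      using grid_less_iff_idx le_grid_iff_idx by (auto simp: jump_cell_def jump_times_pos)
    finally show ?thesis .
  qed
  have "1 \<le> grid n j \<longleftrightarrow> 0 \<le> j" using grid_less_iff[of n j 0] by (simp add: not_less[symmetric])
  then show ?thesis
    using cells[of 0 j] cells[of j 0] by (auto simp: grid_count_def signed_count_def)
qed

lemma regular_iff:
  "regular \<omega> \<longleftrightarrow> (\<forall>i. finite (jump_cell T 0 i \<omega>)) \<and>
    (\<forall>m. \<exists>j. m \<le> signed_count (J \<omega>) (grid 0 j)) \<and> (\<forall>m. \<exists>j. signed_count (J \<omega>) (grid 0 j) \<le> m)"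
proof -
  have "num_points J {grid 0 i<..grid 0 (i + 1)} \<omega> \<noteq> \<infinity> \<longleftrightarrow> finite (jump_cell T 0 i \<omega>)" for i
    unfolding num_points_cell by (cases "finite (jump_cell T 0 i \<omega>)") auto
  then show ?thesis
    using grid_count_eq[of \<omega> 0] unfolding regular_def by (auto cong: conj_cong)
qed

lemma bilateral_points_regular:
  assumes "regular \<omega>"
  shows "bilateral_points (J \<omega>)"
proof
  show "J \<omega> \<subseteq> {0<..}" using jump_times_pos by auto
  show "finite (J \<omega> \<inter> {a<..b})" if "0 < a" for a b
    using assms that by (intro finite_between) (auto simp: regular_iff)
  show "\<exists>s>0. z \<le> signed_count (J \<omega>) s" "\<exists>s>0. signed_count (J \<omega>) s \<le> z" for z
    using assms grid_pos unfolding regular_iff by blast+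
qed

text \<open>Each side of 1 supplies \<open>\<bar>m\<bar>\<close> jump times; a grid point beyond all
  of them has signed count at least \<open>m\<close> on the right and at most \<open>m\<close> on
  the left.\<close>

lemma good_imp_regular:
  assumes "good \<omega>"
  shows "regular \<omega>"
  unfolding regular_iff
proof (intro conjI allI)
  show fin: "finite (jump_cell T 0 i \<omega>)" for i using assms by (rule finite_jump_cell)
  fix m :: int
  have "infinite (J \<omega> \<inter> {1<..})" "infinite (J \<omega> \<inter> {0<..1})" using assms by (auto simp: good_def)
  then obtain F F' where F: "finite F" "F \<subseteq> J \<omega> \<inter> {1<..}" "card F = nat \<bar>m\<bar>"
    and F': "finite F'" "F' \<subseteq> J \<omega> \<inter> {0<..1}" "card F' = nat \<bar>m\<bar>"
    using infinite_arbitrarily_large by metis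
  obtain i where i: "\<forall>s\<in>insert 1 F. s \<le> grid 0 i"
  proof
    show "\<forall>s\<in>insert 1 F. s \<le> grid 0 (idx 0 (Max (insert 1 F)) + 1)"
    proof
      fix s assume "s \<in> insert 1 F"
      then have "s \<le> Max (insert 1 F)" "0 < Max (insert 1 F)"
        using F(1) by (auto intro: Max_ge less_le_trans[of 0 1])
      then show "s \<le> grid 0 (idx 0 (Max (insert 1 F)) + 1)"
        using idx_bounds(2)[of "Max (insert 1 F)" 0] by linarith
    qed
  qed
  have "int (card F) \<le> signed_count (J \<omega>) (grid 0 i)"
    using i F card_mono[OF finite_between[OF fin, of 1 "grid 0 i"], of F]
    by (auto simp: signed_count_def subset_iff)
  then show "\<exists>j. m \<le> signed_count (J \<omega>) (grid 0 j)" using F by (intro exI[of _ i]) auto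
  obtain j where j: "\<forall>s\<in>insert 1 F'. grid 0 j < s"
  proof
    have "0 < Min (insert 1 F')" using F' by (subst Min_gr_iff) auto
    show "\<forall>s\<in>insert 1 F'. grid 0 (idx 0 (Min (insert 1 F'))) < s"
    proof
      fix s assume "s \<in> insert 1 F'"
      then have "Min (insert 1 F') \<le> s" using F'(1) by (auto intro: Min_le)
      then show "grid 0 (idx 0 (Min (insert 1 F'))) < s"
        using idx_bounds(1)[OF \<open>0 < Min (insert 1 F')\<close>, of 0] by linarith
    qed
  qed
  have "signed_count (J \<omega>) (grid 0 j) \<le> - int (card F')"
    using j F' card_mono[OF finite_between[OF fin grid_pos, of 0 j 1], of F']
    by (auto simp: signed_count_def subset_iff)
  then show "\<exists>j. signed_count (J \<omega>) (grid 0 j) \<le> m" using F' by (intro exI[of _ j]) auto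
qed

text \<open>The default 1 keeps every value positive and the listing measurable on the exceptional
  outcomes too.\<close>

definition listing :: "int \<Rightarrow> 'a \<Rightarrow> real" where
  "listing z \<omega> = (if regular \<omega> then bilateral_points.enum (J \<omega>) z else 1)"

lemma listing_pos: "0 < listing z \<omega>"
  using bilateral_points.enum_pos[OF bilateral_points_regular] by (simp add: listing_def)

lemma bij_betw_listing: "regular \<omega> \<Longrightarrow> bij_betw (\<lambda>z. listing z \<omega>) UNIV (J \<omega>)"
  using bilateral_points.bij_betw_enum[OF bilateral_points_regular, of \<omega>] by (simp add: listing_def cong: bij_betw_cong)

lemma ex_grid_between:
  assumes "0 < t" "s < t"
  shows "\<exists>n j. s < grid n j \<and> grid n j < t"
proof -
  have "\<forall>\<^sub>F n in sequentially. s < grid n (idx n t)"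
    using grid_idx_tendsto[OF assms(1)] assms(2) by (rule order_tendstoD)
  then obtain n where "s < grid n (idx n t)" by (auto simp: eventually_sequentially)
  then show ?thesis using idx_bounds(1)[OF assms(1), of n] by blast
qed

text \<open>A listed point lies before \<open>t\<close> iff at some grid point before
  \<open>t\<close> the signed count has reached \<open>z + 1\<close>. Grid points are dense, so this
  is a countable union of events about counts.\<close>

lemma measurable_listing: "listing z \<in> borel_measurable hit_algebra"
proof (rule borel_measurableI_less)
  fix t
  note [measurable] = measurable_grid_count measurable_regular
  have "listing z \<omega> < t \<longleftrightarrow> (if regular \<omega> then \<exists>n j. grid n j < t \<and> of_int (z + 1) \<le> grid_count n j \<omega> else 1 < t)" for \<omega>
  proof (cases "regular \<omega>")
    case True
    interpret bilateral_points "J \<omega>" using True by (rule bilateral_points_regular)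
    have count: "of_int (z + 1) \<le> grid_count n j \<omega> \<longleftrightarrow> enum z \<le> grid n j" for n j
    proof -
      have "grid_count n j \<omega> = of_int (signed_count (J \<omega>) (grid n j))"
        using True by (intro grid_count_eq) (simp add: regular_iff)
      then show ?thesis using enum_le_iff[of "grid n j" z] by (simp only: of_int_le_iff grid_pos simp_thms)
    qed
    have "enum z < t \<longleftrightarrow> (\<exists>n j. grid n j < t \<and> enum z \<le> grid n j)"
    proof
      assume "enum z < t"
      then show "\<exists>n j. grid n j < t \<and> enum z \<le> grid n j"
        using ex_grid_between[of t "enum z"] enum_pos[of z] by (meson less_imp_le less_trans)
    qed auto
    then show ?thesis using True unfolding listing_def count by simp
  qed (simp add: listing_def)
  moreover have "Measurable.pred hit_algebra
      (\<lambda>\<omega>. if regular \<omega> then \<exists>n j. grid n j < t \<and> of_int (z + 1) \<le> grid_count n j \<omega> else 1 < t)"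
    by measurable
  ultimately show "{\<omega> \<in> space hit_algebra. listing z \<omega> < t} \<in> sets hit_algebra"
    unfolding pred_def by (simp only:)
qed

section \<open>Counts of arbitrary Borel sets\<close>

abbreviation "jump_algebra \<equiv> point_process_algebra M J"

lemma space_jump_algebra [simp]: "space jump_algebra = space M"
  unfolding point_process_algebra_def by (rule space_measure_of) auto

lemma sets_jump_algebra: "sets jump_algebra = sigma_sets (space M)
    {num_points J A -` B \<inter> space M | A B. A \<in> sets borel \<and> A \<subseteq> {0<..} \<and> B \<in> sets borel}"
  unfolding point_process_algebra_def by (rule sets_measure_of) auto

lemma jump_algebra_subset: "sets jump_algebra \<subseteq> events"
  unfolding sets_jump_algebra
  by (rule sets.sigma_sets_subset) (auto intro: measurable_sets[OF measurable_num_points])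

text \<open>A void event says that the count of a finite union of cells is 0.\<close>

lemma hit_algebra_subset_jump_algebra: "sets hit_algebra \<subseteq> sets jump_algebra"
proof -
  have "void p F \<in> sets jump_algebra" if "finite F" for p F
  proof -
    define A where "A = (\<Union>i\<in>F. {grid p i<..grid p (i + 1)})"
    have "A \<in> sets borel" "A \<subseteq> {0<..}"
      using that by (auto simp: A_def intro: less_trans[OF grid_pos] simp del: grid_pos)
    moreover have "void p F = num_points J A -` {0} \<inter> space M"
    proof -
      have "num_points J A \<omega> = 0 \<longleftrightarrow> (\<forall>i\<in>F. jump_cell T p i \<omega> = {})" for \<omega>
        unfolding num_points_def A_def jump_cell_eq by (subst emeasure_count_space_eq_0) blast
      then show ?thesis unfolding void_def by auto
    qed
    ultimately show ?thesis
      unfolding sets_jump_algebra by (intro sigma_sets.Basic CollectI exI[of _ A] exI[of _ "{0}"]) auto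
  qed
  then have "voids \<subseteq> sets jump_algebra" by (auto simp: voids_def)
  then show ?thesis
    using sets.sigma_sets_subset[of voids jump_algebra] by (simp add: sets_hit_algebra)
qed

text \<open>The listing is measurable for \<open>hit_algebra\<close> and almost surely exhausts the
  jump times, so the count of a Borel set may be replaced by the count of listed points. Agreement
  up to null sets passes to complements and countable unions.\<close>

lemma jump_algebra_AE_eq:
  assumes "C \<in> sets jump_algebra"
  shows "\<exists>C'\<in>sets hit_algebra. AE \<omega> in M. \<omega> \<in> C \<longleftrightarrow> \<omega> \<in> C'"
  using assms unfolding sets_jump_algebra
proof (induction rule: sigma_sets.induct)
  case (Basic C)
  then obtain A B where C: "C = num_points J A -` B \<inter> space M" "A \<in> sets borel" "A \<subseteq> {0<..}" "B \<in> sets borel"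
    by blast
  define f where "f = num_points (\<lambda>\<omega>. range (\<lambda>z. listing z \<omega>)) A"
  have [measurable]: "f \<in> borel_measurable hit_algebra"
    unfolding f_def using C by (intro measurable_count_range measurable_listing)
  have "f -` B \<inter> space hit_algebra \<in> sets hit_algebra"
    using C(4) by measurable
  moreover have "AE \<omega> in M. \<omega> \<in> C \<longleftrightarrow> \<omega> \<in> f -` B \<inter> space hit_algebra"
    using AE_good
  proof eventually_elim
    case (elim \<omega>)
    then have "range (\<lambda>z. listing z \<omega>) = J \<omega>"
      using bij_betw_listing[OF good_imp_regular] by (simp add: bij_betw_def)
    then show ?case by (simp add: C f_def num_points_def)
  qed
  ultimately show ?case by blast
next
  case Empty
  then show ?case by (intro bexI[of _ "{}"]) auto
next
  case (Compl C)
  then obtain C' where C': "C' \<in> sets hit_algebra" "AE \<omega> in M. \<omega> \<in> C \<longleftrightarrow> \<omega> \<in> C'" by blast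
  have "AE \<omega> in M. \<omega> \<in> space M - C \<longleftrightarrow> \<omega> \<in> space hit_algebra - C'"
    using C'(2) by eventually_elim auto
  then show ?case using sets.compl_sets[OF C'(1)] by blast
next
  case (Union C)
  then obtain C' where C': "\<And>i. C' i \<in> sets hit_algebra" "\<And>i. AE \<omega> in M. \<omega> \<in> C i \<longleftrightarrow> \<omega> \<in> C' i"
    by metis
  then have "AE \<omega> in M. \<forall>i. \<omega> \<in> C i \<longleftrightarrow> \<omega> \<in> C' i" by (simp add: AE_all_countable)
  then have "AE \<omega> in M. \<omega> \<in> (\<Union>i. C i) \<longleftrightarrow> \<omega> \<in> (\<Union>i. C' i)" by eventually_elim auto
  then show ?case using C'(1) by (intro bexI[of _ "\<Union>i. C' i"]) auto
qed

lemma set_integral_cong_AE_set: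
  fixes f :: "'a \<Rightarrow> real"
  assumes "AE \<omega> in M. \<omega> \<in> C \<longleftrightarrow> \<omega> \<in> C'" "C \<in> events" "C' \<in> events" "f \<in> borel_measurable M"
  shows "(LINT \<omega>:C|M. f \<omega>) = (LINT \<omega>:C'|M. f \<omega>)"
  unfolding set_lebesgue_integral_def
proof (rule integral_cong_AE)
  show "AE \<omega> in M. indicat_real C \<omega> *\<^sub>R f \<omega> = indicat_real C' \<omega> *\<^sub>R f \<omega>"
    using assms(1) by eventually_elim (auto simp: indicator_def)
qed (use assms in auto)

text \<open>Replacing \<open>C\<close> by an almost surely equal event of \<open>hit_algebra\<close>
  changes neither integral.\<close>

lemma jump_formula:
  fixes g :: "int \<Rightarrow> real \<Rightarrow> real"
  assumes I: "finite I" and g: "\<And>i. continuous_on UNIV (g i)" "\<And>i x. \<bar>g i x\<bar> \<le> 1" and C: "C \<in> sets jump_algebra"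
  shows "(LINT \<omega>:C|M. indicator (singles q I) \<omega> * (\<Prod>i\<in>I. g i (mark q i \<omega>))) =
    (LINT \<omega>:C|M. indicator (singles q I) \<omega> * (\<Prod>i\<in>I. LINT x|mark_law. g i x))"
proof -
  have [measurable]: "g i \<in> borel_measurable borel" for i
    using g(1) by (rule borel_measurable_continuous_onI)
  note [measurable] = singles_sets[OF I]
  obtain C' where C': "C' \<in> sets hit_algebra" "AE \<omega> in M. \<omega> \<in> C \<longleftrightarrow> \<omega> \<in> C'"
    using jump_algebra_AE_eq[OF C] by blast
  have ev: "C \<in> events" "C' \<in> events" using C C' jump_algebra_subset hit_algebra_subset by auto
  have "(LINT \<omega>:C|M. indicator (singles q I) \<omega> * (\<Prod>i\<in>I. g i (mark q i \<omega>))) =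
      (LINT \<omega>:C'|M. indicator (singles q I) \<omega> * (\<Prod>i\<in>I. g i (mark q i \<omega>)))"
    by (rule set_integral_cong_AE_set[OF C'(2) ev]) measurable
  also have "\<dots> = (LINT \<omega>:C'|M. indicator (singles q I) \<omega> * (\<Prod>i\<in>I. LINT x|mark_law. g i x))"
    by (rule hit_formula[OF I g C'(1)])
  also have "\<dots> = (LINT \<omega>:C|M. indicator (singles q I) \<omega> * (\<Prod>i\<in>I. LINT x|mark_law. g i x))"
    by (rule set_integral_cong_AE_set[OF C'(2) ev, symmetric]) measurable
  finally show ?thesis .
qed

end

section \<open>Independence of the normalized jumps\<close>

lemma abs_cts_step_le: "a < b \<Longrightarrow> \<bar>cts_step a b x\<bar> \<le> 1"
  by (cases "x \<le> a"; cases "b \<le> x") (auto simp: cts_step_def abs_of_nonneg divide_le_eq_1)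

context finite_rate_SSA
begin

section \<open>Jumps at random times and separation of listed points\<close>

lemma measurable_idx_count [measurable (raw)]:
  "f \<in> borel_measurable N \<Longrightarrow> (\<lambda>\<omega>. idx n (f \<omega>)) \<in> measurable N (count_space UNIV)"
  unfolding idx_def by (measurable; simp)

text \<open>The shift by 2 makes the approximations strictly larger than \<open>R\<close>.\<close>

lemma measurable_T_at:
  assumes [measurable]: "R \<in> borel_measurable M" and pos: "\<And>\<omega>. \<omega> \<in> space M \<Longrightarrow> 0 < R \<omega>"
  shows "(\<lambda>\<omega>. T (R \<omega>) \<omega>) \<in> borel_measurable M"
proof (rule borel_measurable_LIMSEQ_metric)
  show "(\<lambda>\<omega>. T (grid n (idx n (R \<omega>) + 2)) \<omega>) \<in> borel_measurable M" for n
    by (rule measurable_compose_countable[where f="\<lambda>j \<omega>. T (grid n (j + 2)) \<omega>" and g="\<lambda>\<omega>. idx n (R \<omega>)"])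
      measurable
  fix \<omega> assume \<omega>: "\<omega> \<in> space M"
  then have R: "0 < R \<omega>" by (rule pos)
  have "(\<lambda>n. grid n 2) \<longlonglongrightarrow> 1"
    using tendsto_mult[OF grid_1_tendsto grid_1_tendsto] grid_add[of _ 1 1] by simp
  then have lim: "(\<lambda>n. grid n (idx n (R \<omega>) + 2)) \<longlonglongrightarrow> R \<omega>"
    using tendsto_mult[OF grid_idx_tendsto[OF R]] by (fastforce simp: grid_add)
  have "grid n (idx n (R \<omega>) + 2) > R \<omega>" for n
    using grid_less_iff_idx[OF R, of n "idx n (R \<omega>) + 2"] idx_bounds(2)[OF R, of n]
      grid_less_iff[of n "idx n (R \<omega>) + 1" "idx n (R \<omega>) + 2"] by linarith
  then have "filterlim (\<lambda>n. grid n (idx n (R \<omega>) + 2)) (at_right (R \<omega>)) sequentially"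
    using lim by (auto simp: filterlim_at less_imp_neq[symmetric])
  moreover have "((\<lambda>s. T s \<omega>) \<longlongrightarrow> T (R \<omega>) \<omega>) (at_right (R \<omega>))"
    using ssa \<omega> R by (auto simp: one_SSA_def cadlag_on_pos_def continuous_within)
  ultimately show "(\<lambda>n. T (grid n (idx n (R \<omega>) + 2)) \<omega>) \<longlonglongrightarrow> T (R \<omega>) \<omega>"
    by (rule filterlim_compose[rotated])
qed

text \<open>Left endpoints of cells lie strictly before \<open>R\<close> and tend to it, so the
  values of \<open>T\<close> there tend to the left limit.\<close>

lemma measurable_left_lim_at:
  assumes [measurable]: "R \<in> borel_measurable M" and pos: "\<And>\<omega>. \<omega> \<in> space M \<Longrightarrow> 0 < R \<omega>"
  shows "(\<lambda>\<omega>. left_lim T (R \<omega>) \<omega>) \<in> borel_measurable M"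
proof (rule borel_measurable_LIMSEQ_metric)
  show "(\<lambda>\<omega>. T (grid n (idx n (R \<omega>))) \<omega>) \<in> borel_measurable M" for n
    by (rule measurable_compose_countable[where f="\<lambda>j \<omega>. T (grid n j) \<omega>" and g="\<lambda>\<omega>. idx n (R \<omega>)"])
      measurable
  fix \<omega> assume \<omega>: "\<omega> \<in> space M"
  then have R: "0 < R \<omega>" by (rule pos)
  have "filterlim (\<lambda>n. grid n (idx n (R \<omega>))) (at_left (R \<omega>)) sequentially"
    using grid_idx_tendsto[OF R] idx_bounds(1)[OF R] by (auto simp: filterlim_at less_imp_neq)
  then show "(\<lambda>n. T (grid n (idx n (R \<omega>))) \<omega>) \<longlonglongrightarrow> left_lim T (R \<omega>) \<omega>"
    by (rule filterlim_compose[OF left_lim_tendsto[OF \<omega> R]])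
qed

text \<open>Only finitely many jump times share the level 0 cell of \<open>s\<close>, and finer
  cells lie inside it; once these times are separated, \<open>s\<close> is alone.\<close>

lemma eventually_jump_cell_single:
  assumes "good \<omega>" "s \<in> J \<omega>"
  shows "\<forall>\<^sub>F n in sequentially. jump_cell T n (idx n s) \<omega> = {s}"
proof -
  have s: "0 < s" using assms jump_times_pos by blast
  let ?P = "jump_cell T 0 (idx 0 s) \<omega>"
  have "\<forall>\<^sub>F n in sequentially. inj_on (idx n) ?P"
    using finite_jump_cell[OF assms(1)] by (rule eventually_inj_idx) (auto simp: jump_cell_def jump_times_pos)
  then show ?thesis
  proof eventually_elim
    case (elim n)
    have "t = s" if "t \<in> jump_cell T n (idx n s) \<omega>" for t
    proof (rule inj_onD[OF elim])
      have "t \<in> J \<omega>" "idx n t = idx n s" using that by (auto simp: jump_cell_def)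
      moreover have "idx 0 t = idx 0 s"
        using calculation idx_div[of t 0 n] idx_div[of s 0 n] s jump_times_pos by simp
      ultimately show "t \<in> ?P" "idx n t = idx n s" by (auto simp: jump_cell_def)
      show "s \<in> ?P" using assms by (simp add: jump_cell_def)
    qed
    then show ?case using assms by (auto simp: jump_cell_def)
  qed
qed

lemma lists_jump_timesD:
  assumes "lists_jump_times M T S"
  shows "S z \<in> borel_measurable M" "\<omega> \<in> space M \<Longrightarrow> 0 < S z \<omega>"
    "AE \<omega> in M. bij_betw (\<lambda>z. S z \<omega>) UNIV (J \<omega>)"
proof -
  have *: "S z \<in> measurable M (restrict_space borel {0<..})" using assms by (simp add: lists_jump_times_def)
  show "S z \<in> borel_measurable M" using * by (rule measurable_restrict_space2_iff[THEN iffD1, THEN conjunct1])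
  show "\<omega> \<in> space M \<Longrightarrow> 0 < S z \<omega>" using measurable_space[OF *] by (auto simp: space_restrict_space)
  show "AE \<omega> in M. bij_betw (\<lambda>z. S z \<omega>) UNIV (J \<omega>)" using assms by (simp add: lists_jump_times_def)
qed

lemma measurable_normalized_jump:
  assumes "lists_jump_times M T S"
  shows "normalized_jump T S z \<in> borel_measurable M"
proof -
  note S [measurable] = lists_jump_timesD(1)[OF assms]
  have [measurable]: "(\<lambda>\<omega>. T (S z \<omega>) \<omega>) \<in> borel_measurable M" "(\<lambda>\<omega>. left_lim T (S z \<omega>) \<omega>) \<in> borel_measurable M"
    using lists_jump_timesD[OF assms] by (auto intro: measurable_T_at measurable_left_lim_at)
  show ?thesis unfolding normalized_jump_def[abs_def] jump_def by measurable
qed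

lemma mark_eq_normalized_jump:
  assumes "good \<omega>" "S z \<omega> \<in> J \<omega>" "card (jump_cell T q (idx q (S z \<omega>)) \<omega>) = 1"
  shows "mark q (idx q (S z \<omega>)) \<omega> = normalized_jump T S z \<omega>"
proof -
  obtain s where s: "jump_cell T q (idx q (S z \<omega>)) \<omega> = {s}" using assms(3) by (rule card_1_singletonE)
  moreover have "S z \<omega> \<in> jump_cell T q (idx q (S z \<omega>)) \<omega>" using assms(2) by (simp add: jump_cell_def)
  ultimately have "jump_cell T q (idx q (S z \<omega>)) \<omega> = {S z \<omega>}" by auto
  then show ?thesis by (simp add: mark_eq[OF assms(1)] normalized_jump_def)
qed

text \<open>Extensional maps into the window form a finite set, and an outcome matches at most one
  of them. Injectivity gives the selected points cells of their own.\<close>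

definition cell_choices :: "nat \<Rightarrow> int set \<Rightarrow> (int \<Rightarrow> int) set" where
  "cell_choices q Z = {a \<in> Z \<rightarrow>\<^sub>E window q. inj_on a Z}"

text \<open>The listed points \<open>S z\<close>, \<open>z \<in> Z\<close>, are confined to the prescribed cells \<open>a z\<close>, so that they can be traded for cells
  in \<open>jump_formula\<close>.\<close>

definition separated :: "(int \<Rightarrow> 'a \<Rightarrow> real) \<Rightarrow> nat \<Rightarrow> int set \<Rightarrow> (int \<Rightarrow> int) \<Rightarrow> 'a set" where
  "separated S q Z a = {\<omega> \<in> space M. \<forall>z\<in>Z. idx q (S z \<omega>) = a z}"

lemma finite_cell_choices: "finite Z \<Longrightarrow> finite (cell_choices q Z)"
  by (rule finite_subset[of _ "Z \<rightarrow>\<^sub>E window q"]) (auto simp: cell_choices_def intro: finite_PiE)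

text \<open>The only choice that an outcome can match is the one recording the cells of its own
  points, so the sum is 0 or 1.\<close>

lemma separated_sum:
  assumes "finite Z" "\<omega> \<in> space M"
  shows "(\<Sum>a\<in>cell_choices q Z. indicator (separated S q Z a \<inter> singles q (a ` Z)) \<omega> :: real) =
    of_bool ((\<lambda>z\<in>Z. idx q (S z \<omega>)) \<in> cell_choices q Z \<and> \<omega> \<in> singles q ((\<lambda>z. idx q (S z \<omega>)) ` Z))"
proof -
  let ?a = "\<lambda>z\<in>Z. idx q (S z \<omega>)"
  have eq: "\<omega> \<in> separated S q Z a \<longleftrightarrow> a = ?a" if "a \<in> cell_choices q Z" for a
    using that assms by (auto simp: separated_def cell_choices_def PiE_def extensional_def fun_eq_iff)
  have "(\<Sum>a\<in>cell_choices q Z. indicator (separated S q Z a \<inter> singles q (a ` Z)) \<omega> :: real) =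
      (\<Sum>a\<in>cell_choices q Z. if a = ?a then of_bool (\<omega> \<in> singles q (?a ` Z)) else 0)"
    using eq by (intro sum.cong) (auto simp: indicator_def)
  also have "\<dots> = of_bool (?a \<in> cell_choices q Z \<and> \<omega> \<in> singles q (?a ` Z))"
    using finite_cell_choices[OF assms(1)] by simp
  also have "?a ` Z = (\<lambda>z. idx q (S z \<omega>)) ` Z" by auto
  finally show ?thesis .
qed

text \<open>At a fine level the finitely many selected points lie in distinct cells of the window,
  and each is alone in its cell.\<close>

lemma eventually_separated_sum:
  assumes Z: "finite Z" and \<omega>: "good \<omega>" and bij: "bij_betw (\<lambda>z. S z \<omega>) UNIV (J \<omega>)"
  shows "\<forall>\<^sub>F q in sequentially.
    (\<Sum>a\<in>cell_choices q Z. indicator (separated S q Z a \<inter> singles q (a ` Z)) \<omega> :: real) = 1"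
proof -
  have S: "S z \<omega> \<in> J \<omega>" for z using bij by (auto simp: bij_betw_def)
  have space: "\<omega> \<in> space M" using \<omega> by (simp add: good_def)
  have inj: "inj_on (\<lambda>z. S z \<omega>) Z" using bij by (auto simp: bij_betw_def intro: inj_on_subset)
  have "\<forall>\<^sub>F q in sequentially. inj_on (idx q) ((\<lambda>z. S z \<omega>) ` Z)"
    using Z S jump_times_pos by (intro eventually_inj_idx) auto
  moreover have "\<forall>\<^sub>F q in sequentially. \<forall>z\<in>Z. idx q (S z \<omega>) \<in> window q"
    using Z S jump_times_pos by (intro eventually_ball_finite ballI eventually_idx_window) auto
  moreover have "\<forall>\<^sub>F q in sequentially. \<forall>z\<in>Z. jump_cell T q (idx q (S z \<omega>)) \<omega> = {S z \<omega>}"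
    using Z S \<omega> by (intro eventually_ball_finite ballI eventually_jump_cell_single) auto
  ultimately show ?thesis
  proof eventually_elim
    case (elim q)
    have "inj_on (\<lambda>z. idx q (S z \<omega>)) Z"
      using comp_inj_on[OF inj elim(1)] by (simp add: o_def)
    then have "inj_on (\<lambda>z\<in>Z. idx q (S z \<omega>)) Z" by (simp add: inj_on_def)
    then show ?case
      using elim space unfolding separated_sum[OF Z space] by (auto simp: cell_choices_def singles_def)
  qed
qed

lemma separated_sets:
  assumes S: "\<And>z. S z \<in> borel_measurable N" and sp: "space N = space M" and "finite Z"
  shows "separated S q Z a \<in> sets N"
proof -
  note [measurable] = S
  have "{\<omega> \<in> space N. idx q (S z \<omega>) = a z} \<in> sets N" for z by measurable
  then show ?thesis
    unfolding separated_def sp[symmetric] using assms(3) by (intro sets.sets_Collect_finite_All) auto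
qed

text \<open>As the listing depends on the jump times only, \<open>separated S q Z a\<close> belongs
  to \<open>jump_algebra\<close> and can be absorbed into \<open>C\<close>. Where moreover the cells
  hold single jumps, the jump at \<open>S z\<close> is the mark of the fixed cell
  \<open>a z\<close>, and \<open>jump_formula\<close> applies to test functions carried to cells by
  the inverse of \<open>a\<close>.\<close>

lemma separated_formula:
  fixes g :: "int \<Rightarrow> real \<Rightarrow> real"
  assumes S: "lists_jump_times M T S" "order_from_jump_times M T S"
    and Z: "finite Z" and g: "\<And>i. continuous_on UNIV (g i)" "\<And>i x. \<bar>g i x\<bar> \<le> 1"
    and C: "C \<in> sets jump_algebra" and a: "a \<in> cell_choices q Z"
  shows "(LINT \<omega>:C|M. indicator (separated S q Z a \<inter> singles q (a ` Z)) \<omega> * (\<Prod>z\<in>Z. g z (normalized_jump T S z \<omega>))) =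
    (LINT \<omega>:C|M. indicator (separated S q Z a \<inter> singles q (a ` Z)) \<omega> * (\<Prod>z\<in>Z. LINT x|mark_law. g z x))"
proof -
  have [measurable]: "g i \<in> borel_measurable borel" for i
    using g(1) by (rule borel_measurable_continuous_onI)
  note [measurable] = measurable_normalized_jump[OF S(1)] singles_sets[OF finite_imageI[OF Z]]
  have SG: "S z \<in> borel_measurable jump_algebra" for z
    using S(2) by (simp add: order_from_jump_times_def)
  let ?B = "separated S q Z a"
  have B: "?B \<in> sets jump_algebra" using SG Z by (intro separated_sets) auto
  then have [measurable]: "?B \<in> events" "C \<in> events" using C jump_algebra_subset by auto
  have inj: "inj_on a Z" using a by (simp add: cell_choices_def)
  define h where "h i = g (inv_into Z a i)" for i
  have h: "continuous_on UNIV (h i)" "\<bar>h i x\<bar> \<le> 1" for i x using g by (auto simp: h_def)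
  have prod_h: "(\<Prod>i\<in>a ` Z. F i (h i)) = (\<Prod>z\<in>Z. F (a z) (g z))" for F :: "int \<Rightarrow> (real \<Rightarrow> real) \<Rightarrow> real"
    using inj by (simp add: prod.reindex h_def)
  have "(LINT \<omega>:C|M. indicator (?B \<inter> singles q (a ` Z)) \<omega> * (\<Prod>z\<in>Z. g z (normalized_jump T S z \<omega>))) =
      (LINT \<omega>:C \<inter> ?B|M. indicator (singles q (a ` Z)) \<omega> * (\<Prod>i\<in>a ` Z. h i (mark q i \<omega>)))"
    unfolding set_lebesgue_integral_def
  proof (rule integral_cong_AE)
    show "AE \<omega> in M. indicat_real C \<omega> *\<^sub>R (indicator (?B \<inter> singles q (a ` Z)) \<omega> * (\<Prod>z\<in>Z. g z (normalized_jump T S z \<omega>))) =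
        indicat_real (C \<inter> ?B) \<omega> *\<^sub>R (indicator (singles q (a ` Z)) \<omega> * (\<Prod>i\<in>a ` Z. h i (mark q i \<omega>)))"
      using AE_good lists_jump_timesD(3)[OF S(1)]
    proof eventually_elim
      case (elim \<omega>)
      have "normalized_jump T S z \<omega> = mark q (a z) \<omega>"
        if "\<omega> \<in> ?B" "\<omega> \<in> singles q (a ` Z)" "z \<in> Z" for z
      proof -
        have "idx q (S z \<omega>) = a z" "card (jump_cell T q (a z) \<omega>) = 1"
          using that by (auto simp: separated_def singles_def)
        moreover have "S z \<omega> \<in> J \<omega>" using elim(2) by (auto simp: bij_betw_def)
        ultimately show ?thesis using mark_eq_normalized_jump[OF elim(1), of S z q] by simp
      qed
      then show ?case
        using prod_h[of "\<lambda>i f. f (mark q i \<omega>)"] by (auto simp: indicator_def)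
    qed
    have [measurable]: "h i \<in> borel_measurable borel" for i by (simp add: h_def)
    show "(\<lambda>\<omega>. indicat_real (C \<inter> ?B) \<omega> *\<^sub>R (indicator (singles q (a ` Z)) \<omega> * (\<Prod>i\<in>a ` Z. h i (mark q i \<omega>)))) \<in> borel_measurable M"
      by measurable
  qed measurable
  also have "\<dots> = (LINT \<omega>:C \<inter> ?B|M. indicator (singles q (a ` Z)) \<omega> * (\<Prod>i\<in>a ` Z. LINT x|mark_law. h i x))"
    using B C by (intro jump_formula finite_imageI Z h) auto
  also have "(\<Prod>i\<in>a ` Z. LINT x|mark_law. h i x) = (\<Prod>z\<in>Z. LINT x|mark_law. g z x)"
    by (rule prod_h[of "\<lambda>i f. LINT x|mark_law. f x"])
  also have "(LINT \<omega>:C \<inter> ?B|M. indicator (singles q (a ` Z)) \<omega> * (\<Prod>z\<in>Z. LINT x|mark_law. g z x)) =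
    (LINT \<omega>:C|M. indicator (?B \<inter> singles q (a ` Z)) \<omega> * (\<Prod>z\<in>Z. LINT x|mark_law. g z x))"
    unfolding set_lebesgue_integral_def by (intro Bochner_Integration.integral_cong) (auto simp: indicator_def)
  finally show ?thesis .
qed

text \<open>Successful separation at level \<open>q\<close> splits into finitely many cases, each
  covered by \<open>separated_formula\<close>, and its indicator tends to 1 almost surely.\<close>

lemma listing_formula:
  fixes g :: "int \<Rightarrow> real \<Rightarrow> real"
  assumes S: "lists_jump_times M T S" "order_from_jump_times M T S"
    and Z: "finite Z" and g: "\<And>i. continuous_on UNIV (g i)" "\<And>i x. \<bar>g i x\<bar> \<le> 1"
    and C: "C \<in> sets jump_algebra"
  shows "(LINT \<omega>:C|M. \<Prod>z\<in>Z. g z (normalized_jump T S z \<omega>)) = prob C * (\<Prod>z\<in>Z. LINT x|mark_law. g z x)"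
proof -
  have [measurable]: "g i \<in> borel_measurable borel" for i
    using g(1) by (rule borel_measurable_continuous_onI)
  note [measurable] = measurable_normalized_jump[OF S(1)] singles_sets[OF finite_imageI[OF Z]]
    separated_sets[OF lists_jump_timesD(1)[OF S(1)] refl Z]
  have [measurable]: "C \<in> events" using C jump_algebra_subset by auto
  \<comment> \<open>The indicator that the selected points are separated at level \<open>q\<close>,
    written as a sum over the possible choices of cells.\<close>
  define \<xi> where "\<xi> q \<omega> = (\<Sum>a\<in>cell_choices q Z. indicator (separated S q Z a \<inter> singles q (a ` Z)) \<omega> :: real)" for q \<omega>
  have [measurable]: "\<xi> q \<in> borel_measurable M" for q unfolding \<xi>_def by measurable
  have \<xi>_le: "\<bar>\<xi> q \<omega>\<bar> \<le> 1" if "\<omega> \<in> space M" for q \<omega>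
    unfolding \<xi>_def separated_sum[OF Z that] by simp
  have lim: "(\<lambda>q. LINT \<omega>:C|M. \<xi> q \<omega> * f \<omega>) \<longlonglongrightarrow> (LINT \<omega>:C|M. f \<omega>)"
    if [measurable]: "f \<in> borel_measurable M" and f: "\<And>\<omega>. \<bar>f \<omega>\<bar> \<le> 1" for f
    unfolding set_lebesgue_integral_def
  proof (rule integral_dominated_convergence[where w="\<lambda>_. 1"])
    show "AE \<omega> in M. (\<lambda>q. indicat_real C \<omega> *\<^sub>R (\<xi> q \<omega> * f \<omega>)) \<longlonglongrightarrow> indicat_real C \<omega> *\<^sub>R f \<omega>"
      using AE_good lists_jump_timesD(3)[OF S(1)]
    proof eventually_elim
      case (elim \<omega>)
      have "\<forall>\<^sub>F q in sequentially. indicat_real C \<omega> *\<^sub>R (\<xi> q \<omega> * f \<omega>) = indicat_real C \<omega> *\<^sub>R f \<omega>"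
        using eventually_separated_sum[where S=S and \<omega>=\<omega>, OF Z elim] unfolding \<xi>_def by eventually_elim simp
      then show ?case by (rule tendsto_eventually)
    qed
    show "AE \<omega> in M. norm (indicat_real C \<omega> *\<^sub>R (\<xi> q \<omega> * f \<omega>)) \<le> 1" for q
      using AE_space
    proof eventually_elim
      case (elim \<omega>)
      have "\<bar>\<xi> q \<omega>\<bar> * \<bar>f \<omega>\<bar> \<le> 1 * 1" using \<xi>_le[OF elim] f by (intro mult_mono) auto
      then show ?case by (simp add: abs_mult indicator_def)
    qed
  qed auto
  have m: "\<bar>\<Prod>z\<in>Z. LINT x|mark_law. g z x\<bar> \<le> 1"
  proof -
    interpret D: real_distribution mark_law by (rule real_distribution_mark_law)
    have "\<bar>LINT x|mark_law. g z x\<bar> \<le> 1" for z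
    proof -
      have "\<bar>LINT x|mark_law. g z x\<bar> \<le> (LINT x|mark_law. \<bar>g z x\<bar>)" by (rule integral_abs_bound)
      also have "\<dots> \<le> (LINT x|mark_law. 1)"
        using g(2) by (intro integral_mono D.integrable_const_bound[of _ 1]) auto
      also have "\<dots> = 1" using D.prob_space by simp
      finally show ?thesis .
    qed
    then show ?thesis unfolding abs_prod by (intro prod_le_1) auto
  qed
  have eq: "(LINT \<omega>:C|M. \<xi> q \<omega> * (\<Prod>z\<in>Z. g z (normalized_jump T S z \<omega>))) =
      (LINT \<omega>:C|M. \<xi> q \<omega> * (\<Prod>z\<in>Z. LINT x|mark_law. g z x))" for q
  proof -
    have expand: "(LINT \<omega>:C|M. \<xi> q \<omega> * f \<omega>) =
        (\<Sum>a\<in>cell_choices q Z. (LINT \<omega>:C|M. indicator (separated S q Z a \<inter> singles q (a ` Z)) \<omega> * f \<omega>))"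
      if [measurable]: "f \<in> borel_measurable M" and f: "\<And>\<omega>. \<bar>f \<omega>\<bar> \<le> 1" for f
    proof -
      have int: "integrable M (\<lambda>\<omega>. indicator C \<omega> * (indicator (separated S q Z a \<inter> singles q (a ` Z)) \<omega> * f \<omega>))" for a
        by (rule integrable_const_bound[of _ 1]) (use f in \<open>auto simp: indicator_def\<close>)
      show ?thesis
        unfolding set_lebesgue_integral_def \<xi>_def real_scaleR_def sum_distrib_right sum_distrib_left
        by (rule Bochner_Integration.integral_sum) (rule int)
    qed
    have b: "\<bar>\<Prod>z\<in>Z. g z (f z)\<bar> \<le> 1" for f
      unfolding abs_prod by (intro prod_le_1) (auto simp: g)
    show ?thesis
      using m b separated_formula[OF S Z g C] by (subst (1 2) expand) auto
  qed
  have b: "\<bar>\<Prod>z\<in>Z. g z (f z)\<bar> \<le> 1" for f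
    unfolding abs_prod by (intro prod_le_1) (auto simp: g)
  have "(LINT \<omega>:C|M. \<Prod>z\<in>Z. g z (normalized_jump T S z \<omega>)) = (LINT \<omega>:C|M. \<Prod>z\<in>Z. LINT x|mark_law. g z x)"
  proof (rule LIMSEQ_unique)
    show "(\<lambda>q. LINT \<omega>:C|M. \<xi> q \<omega> * (\<Prod>z\<in>Z. g z (normalized_jump T S z \<omega>)))
        \<longlonglongrightarrow> (LINT \<omega>:C|M. \<Prod>z\<in>Z. g z (normalized_jump T S z \<omega>))"
      using b by (intro lim) auto
    show "(\<lambda>q. LINT \<omega>:C|M. \<xi> q \<omega> * (\<Prod>z\<in>Z. g z (normalized_jump T S z \<omega>)))
        \<longlonglongrightarrow> (LINT \<omega>:C|M. \<Prod>z\<in>Z. LINT x|mark_law. g z x)"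
      unfolding eq using m by (intro lim) auto
  qed
  also have "\<dots> = prob C * (\<Prod>z\<in>Z. LINT x|mark_law. g z x)"
    by (simp add: set_lebesgue_integral_def)
  finally show ?thesis .
qed

lemma listing_prob:
  assumes S: "lists_jump_times M T S" "order_from_jump_times M T S" and Z: "finite Z" and C: "C \<in> sets jump_algebra"
  shows "prob (C \<inter> {\<omega> \<in> space M. \<forall>z\<in>Z. normalized_jump T S z \<omega> \<le> y z}) = prob C * (\<Prod>z\<in>Z. measure mark_law {..y z})"
proof (rule LIMSEQ_unique)
  interpret D: real_distribution mark_law by (rule real_distribution_mark_law)
  \<comment> \<open>Continuous functions equal to 1 up to \<open>y z\<close> that descend to 0 over
    a vanishing length; they converge to the indicator of the closed half-line.\<close>
  define g where "g m z = cts_step (y z) (y z + inverse (real (Suc m)))" for m z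
  have cont: "continuous_on UNIV (g m z)" for m z
    unfolding g_def by (rule uniformly_continuous_imp_continuous[OF cts_step_uniformly_continuous]) simp
  have bound: "\<bar>g m z x\<bar> \<le> 1" for m z x
    unfolding g_def by (rule abs_cts_step_le) simp
  have lim: "(\<lambda>m. g m z x) \<longlonglongrightarrow> indicator {..y z} x" for z x
  proof (cases "x \<le> y z")
    case True
    then show ?thesis by (simp add: g_def cts_step_def)
  next
    case False
    have "\<forall>\<^sub>F m in sequentially. y z + inverse (real (Suc m)) < x"
      using False LIMSEQ_inverse_real_of_nat_add[of "y z"] by (intro order_tendstoD) auto
    then have "\<forall>\<^sub>F m in sequentially. g m z x = 0"
      by eventually_elim (use False in \<open>auto simp: g_def cts_step_def\<close>)
    then show ?thesis using False by (simp add: tendsto_eventually)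
  qed
  note [measurable] = measurable_normalized_jump[OF S(1)]
  have [measurable]: "g m z \<in> borel_measurable borel" for m z
    using cont by (rule borel_measurable_continuous_onI)
  have [measurable]: "C \<in> events" using C jump_algebra_subset by auto
  have b: "\<bar>\<Prod>z\<in>Z. g m z (f z)\<bar> \<le> 1" for f m
    unfolding abs_prod by (intro prod_le_1) (auto simp: bound)
  let ?A = "{\<omega> \<in> space M. \<forall>z\<in>Z. normalized_jump T S z \<omega> \<le> y z}"
  have [measurable]: "?A \<in> events" using Z by (intro sets.sets_Collect_finite_All) auto
  have "(\<lambda>m. LINT \<omega>:C|M. \<Prod>z\<in>Z. g m z (normalized_jump T S z \<omega>)) \<longlonglongrightarrow> (LINT \<omega>|M. indicator (C \<inter> ?A) \<omega>)"
    unfolding set_lebesgue_integral_def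
  proof (rule integral_dominated_convergence[where w="\<lambda>_. 1"])
    show "AE \<omega> in M. (\<lambda>m. indicat_real C \<omega> *\<^sub>R (\<Prod>z\<in>Z. g m z (normalized_jump T S z \<omega>))) \<longlonglongrightarrow> indicator (C \<inter> ?A) \<omega>"
      using AE_space
    proof eventually_elim
      case (elim \<omega>)
      have "(\<lambda>m. indicat_real C \<omega> *\<^sub>R (\<Prod>z\<in>Z. g m z (normalized_jump T S z \<omega>)))
          \<longlonglongrightarrow> indicat_real C \<omega> *\<^sub>R (\<Prod>z\<in>Z. indicator {..y z} (normalized_jump T S z \<omega>))"
        by (intro tendsto_intros lim)
      also have "(\<Prod>z\<in>Z. indicat_real {..y z} (normalized_jump T S z \<omega>)) = indicator ?A \<omega>"
        using Z elim by (auto simp: indicator_def)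
      finally show ?case by (simp add: indicator_inter_arith)
    qed
    show "AE \<omega> in M. norm (indicat_real C \<omega> *\<^sub>R (\<Prod>z\<in>Z. g m z (normalized_jump T S z \<omega>))) \<le> 1" for m
      using b by (auto simp: indicator_def)
  qed auto
  then show "(\<lambda>m. LINT \<omega>:C|M. \<Prod>z\<in>Z. g m z (normalized_jump T S z \<omega>)) \<longlonglongrightarrow> prob (C \<inter> ?A)"
    by simp
  have "(\<lambda>m. LINT x|mark_law. g m z x) \<longlonglongrightarrow> (LINT x|mark_law. indicator {..y z} x)" for z
    by (rule integral_dominated_convergence[where w="\<lambda>_. 1"]) (use lim bound in auto)
  then have "(\<lambda>m. prob C * (\<Prod>z\<in>Z. LINT x|mark_law. g m z x)) \<longlonglongrightarrow> prob C * (\<Prod>z\<in>Z. measure mark_law {..y z})"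
    by (intro tendsto_intros) simp
  then show "(\<lambda>m. LINT \<omega>:C|M. \<Prod>z\<in>Z. g m z (normalized_jump T S z \<omega>)) \<longlonglongrightarrow> prob C * (\<Prod>z\<in>Z. measure mark_law {..y z})"
    by (simp add: listing_formula[OF S Z cont bound C])
qed

section \<open>Law and independence of the normalized jumps\<close>

lemma space_in_jump_algebra: "space M \<in> sets jump_algebra"
  using sets.top[of jump_algebra] by simp

lemma prob_normalized_jump_le:
  assumes S: "lists_jump_times M T S" "order_from_jump_times M T S"
  shows "prob {\<omega> \<in> space M. normalized_jump T S z \<omega> \<le> y} = measure mark_law {..y}"
  using listing_prob[OF S, of "{z}" "space M" "\<lambda>_. y"] space_in_jump_algebra
  by (simp add: prob_space Int_def conj_ac)

lemma distr_normalized_jump: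
  assumes S: "lists_jump_times M T S" "order_from_jump_times M T S"
  shows "distr M borel (normalized_jump T S z) = mark_law"
proof (rule cdf_unique)
  note [measurable] = measurable_normalized_jump[OF S(1)]
  show "real_distribution (distr M borel (normalized_jump T S z))"
    by (rule real_distribution_distr) simp
  show "real_distribution mark_law" by (rule real_distribution_mark_law)
  show "cdf (distr M borel (normalized_jump T S z)) = cdf mark_law"
    using prob_normalized_jump_le[OF S, of z]
    by (simp add: cdf_def fun_eq_iff measure_distr vimage_def Int_def conj_commute)
qed

text \<open>Half-lines form a \<pi>-system generating the Borel sets, and for them the factorization
  is \<open>listing_prob\<close> with the whole space as \<open>C\<close>.\<close>

lemma indep_normalized_jumps:
  assumes S: "lists_jump_times M T S" "order_from_jump_times M T S"
  shows "indep_vars (\<lambda>_. borel) (normalized_jump T S) UNIV"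
proof -
  note [measurable] = measurable_normalized_jump[OF S(1)]
  let ?X = "normalized_jump T S"
  define E where "E z = {?X z -` A \<inter> space M | A. A \<in> range (\<lambda>a::real. {..a})}" for z
  have E: "E z = range (\<lambda>y. {\<omega> \<in> space M. ?X z \<omega> \<le> y})" for z
    by (auto simp: E_def vimage_def Int_def conj_commute)
  have "indep_sets E UNIV"
  proof (rule indep_setsI)
    show "E z \<subseteq> events" for z unfolding E by auto
    fix A K assume K: "K \<noteq> {}" "K \<subseteq> UNIV" "finite K" and A: "\<forall>j\<in>K. A j \<in> E j"
    then have "\<forall>j\<in>K. \<exists>y. A j = {\<omega> \<in> space M. ?X j \<omega> \<le> y}" unfolding E by auto
    then obtain y where y: "\<forall>j\<in>K. A j = {\<omega> \<in> space M. ?X j \<omega> \<le> y j}" by metis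
    have "(\<Inter>j\<in>K. A j) = space M \<inter> {\<omega> \<in> space M. \<forall>z\<in>K. ?X z \<omega> \<le> y z}" using y K by auto
    then have "prob (\<Inter>j\<in>K. A j) = (\<Prod>z\<in>K. measure mark_law {..y z})"
      using listing_prob[OF S K(3) space_in_jump_algebra, of y] by (simp add: prob_space)
    also have "\<dots> = (\<Prod>z\<in>K. prob (A z))"
      using y prob_normalized_jump_le[OF S] by (intro prod.cong) auto
    finally show "prob (\<Inter>j\<in>K. A j) = (\<Prod>j\<in>K. prob (A j))" .
  qed
  moreover have "Int_stable (E z)" for z
  proof (rule Int_stableI)
    fix A B assume "A \<in> E z" "B \<in> E z"
    then obtain a b where "A = {\<omega> \<in> space M. ?X z \<omega> \<le> a}" "B = {\<omega> \<in> space M. ?X z \<omega> \<le> b}"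
      unfolding E by auto
    then have "A \<inter> B = {\<omega> \<in> space M. ?X z \<omega> \<le> min a b}" by auto
    then show "A \<inter> B \<in> E z" unfolding E by blast
  qed
  ultimately have "indep_sets (\<lambda>z. sigma_sets (space M) (E z)) UNIV"
    by (rule indep_sets_sigma)
  moreover have "{?X z -` A \<inter> space M | A. A \<in> sets borel} = sigma_sets (space M) (E z)" for z
  proof -
    have "sets (borel :: real measure) = sigma_sets UNIV (range (\<lambda>a. {..a}))"
      unfolding borel_eq_atMost by (rule sets_measure_of) auto
    then show ?thesis unfolding E_def using sigma_sets_vimage_commute[of "?X z" "space M" UNIV] by auto
  qed
  ultimately show ?thesis by (auto simp: indep_vars_def2)
qed

text \<open>The times are measurable for \<open>jump_algebra\<close>, and
  \<open>listing_prob\<close> factors each of its events from each finite cylinder of half-lines;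
  both families are \<pi>-systems.\<close>

lemma indep_times_normalized_jumps:
  assumes S: "lists_jump_times M T S" "order_from_jump_times M T S"
  shows "indep_var (PiM UNIV (\<lambda>_. borel)) (\<lambda>\<omega> z. S z \<omega>) (PiM UNIV (\<lambda>_. borel)) (\<lambda>\<omega> z. normalized_jump T S z \<omega>)"
proof -
  note [measurable] = measurable_normalized_jump[OF S(1)] lists_jump_timesD(1)[OF S(1)]
  let ?X = "normalized_jump T S"
  define \<E> where "\<E> = {{\<omega> \<in> space M. \<forall>z\<in>Z. ?X z \<omega> \<le> y z} | Z y. finite Z}"
  have \<E>_events: "\<E> \<subseteq> events"
    by (auto simp: \<E>_def intro!: sets.sets_Collect_finite_All)
  then have \<E>_Pow: "\<E> \<subseteq> Pow (space M)" using sets.space_closed by blast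
  have "indep_set (sets jump_algebra) \<E>"
  proof (rule indep_setI[OF jump_algebra_subset \<E>_events])
    fix C A assume C: "C \<in> sets jump_algebra" and "A \<in> \<E>"
    then obtain Z y where A: "A = {\<omega> \<in> space M. \<forall>z\<in>Z. ?X z \<omega> \<le> y z}" "finite Z" by (auto simp: \<E>_def)
    have "prob A = prob (space M \<inter> A)" unfolding A by (rule arg_cong[where f=prob]) auto
    also have "\<dots> = (\<Prod>z\<in>Z. measure mark_law {..y z})"
      using listing_prob[OF S A(2) space_in_jump_algebra, of y] by (simp add: A prob_space)
    finally show "prob (C \<inter> A) = prob C * prob A"
      using listing_prob[OF S A(2) C, of y] by (simp add: A)
  qed
  moreover have "Int_stable (sets jump_algebra)" by (auto simp: Int_stable_def)
  moreover have "Int_stable \<E>"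
  proof (rule Int_stableI)
    fix A B assume "A \<in> \<E>" "B \<in> \<E>"
    then obtain Z y Z' y' where AB: "A = {\<omega> \<in> space M. \<forall>z\<in>Z. ?X z \<omega> \<le> y z}" "finite Z"
      "B = {\<omega> \<in> space M. \<forall>z\<in>Z'. ?X z \<omega> \<le> y' z}" "finite Z'" by (auto simp: \<E>_def)
    \<comment> \<open>Where both cylinders constrain a coordinate, the smaller bound
      decides.\<close>
    define w where "w z = (if z \<in> Z \<inter> Z' then min (y z) (y' z) else if z \<in> Z then y z else y' z)" for z
    have "A \<inter> B = {\<omega> \<in> space M. \<forall>z\<in>Z \<union> Z'. ?X z \<omega> \<le> w z}"
      unfolding AB w_def by (auto split: if_splits)
    then show "A \<inter> B \<in> \<E>" using AB by (auto simp: \<E>_def)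
  qed
  ultimately have ind: "indep_set (sigma_sets (space M) (sets jump_algebra)) (sigma_sets (space M) \<E>)"
    by (rule indep_set_sigma_sets)
  define N where "N = sigma (space M) \<E>"
  have N: "space N = space M" "sets N = sigma_sets (space M) \<E>" using \<E>_Pow by (auto simp: N_def)
  have "?X z \<in> borel_measurable N" for z
    unfolding borel_measurable_iff_le N
  proof
    fix y
    have "{\<omega> \<in> space M. ?X z \<omega> \<le> y} \<in> \<E>"
      unfolding \<E>_def by (intro CollectI exI[of _ "{z}"] exI[of _ "\<lambda>_. y"]) simp
    then show "{\<omega> \<in> space M. ?X z \<omega> \<le> y} \<in> sigma_sets (space M) \<E>" by blast
  qed
  then have X: "(\<lambda>\<omega> z. ?X z \<omega>) \<in> measurable N (PiM UNIV (\<lambda>_. borel))"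
    by (intro measurable_PiM_single') auto
  have SP: "(\<lambda>\<omega> z. S z \<omega>) \<in> measurable jump_algebra (PiM UNIV (\<lambda>_. borel))"
    using S(2) by (intro measurable_PiM_single') (auto simp: order_from_jump_times_def)
  show ?thesis
    unfolding indep_var_eq
  proof (intro conjI)
    show "random_variable (PiM UNIV (\<lambda>_. borel)) (\<lambda>\<omega> z. S z \<omega>)"
      "random_variable (PiM UNIV (\<lambda>_. borel)) (\<lambda>\<omega> z. ?X z \<omega>)"
      by (auto intro!: measurable_PiM_single')
    have 1: "sigma_sets (space M) {(\<lambda>\<omega> z. S z \<omega>) -` A \<inter> space M |A. A \<in> sets (PiM UNIV (\<lambda>_. borel))}
        \<subseteq> sigma_sets (space M) (sets jump_algebra)"
      using measurable_sets[OF SP] by (intro sigma_sets_mono') auto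
    have 2: "sigma_sets (space M) {(\<lambda>\<omega> z. ?X z \<omega>) -` A \<inter> space M |A. A \<in> sets (PiM UNIV (\<lambda>_. borel))}
        \<subseteq> sigma_sets (space M) \<E>"
      using measurable_sets[OF X] by (intro sigma_sets_mono) (auto simp: N)
    show "indep_set (sigma_sets (space M) {(\<lambda>\<omega> z. S z \<omega>) -` A \<inter> space M |A. A \<in> sets (PiM UNIV (\<lambda>_. borel))})
        (sigma_sets (space M) {(\<lambda>\<omega> z. ?X z \<omega>) -` A \<inter> space M |A. A \<in> sets (PiM UNIV (\<lambda>_. borel))})"
      unfolding indep_set_def
      by (rule indep_sets_mono_sets[OF ind[unfolded indep_set_def]]) (use 1 2 in \<open>auto split: bool.split\<close>)
  qed
qed

end

section \<open>Existence of the listing and properties of every listing\<close>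

context finite_rate_SSA
begin

lemma measurable_from_hit_algebra:
  "f \<in> borel_measurable hit_algebra \<Longrightarrow> f \<in> borel_measurable M"
  using hit_algebra_subset by (intro measurable_from_subalg[of M hit_algebra]) (simp_all add: subalgebra_def)

lemma lists_listing: "lists_jump_times M T listing"
proof -
  have "listing z \<in> measurable M (restrict_space borel {0<..})" for z
    using measurable_from_hit_algebra[OF measurable_listing] listing_pos
    by (intro measurable_restrict_space2) auto
  moreover have "AE \<omega> in M. bij_betw (\<lambda>z. listing z \<omega>) UNIV (J \<omega>)"
    using AE_good by eventually_elim (rule bij_betw_listing[OF good_imp_regular])
  ultimately show ?thesis by (simp add: lists_jump_times_def)
qed

lemma order_listing: "order_from_jump_times M T listing"
proof -
  have "listing z \<in> borel_measurable jump_algebra" for z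
    using hit_algebra_subset_jump_algebra measurable_listing
    by (intro measurable_from_subalg[of jump_algebra hit_algebra]) (simp_all add: subalgebra_def)
  then show ?thesis by (simp add: order_from_jump_times_def)
qed

lemma increasing_listing: "increasing_from_1 M listing"
  unfolding increasing_from_1_def
  using AE_good
proof eventually_elim
  case (elim \<omega>)
  then have r: "regular \<omega>" by (rule good_imp_regular)
  interpret bilateral_points "J \<omega>" using r by (rule bilateral_points_regular)
  show ?case using r strict_mono_enum enum_around_1 by (simp add: listing_def)
qed

text \<open>The summands over \<open>(0,s]\<close> vanish off the jump times and the listing
  reindexes the rest; the factor \<open>S z\<close> undoes the normalization. Summation by
  \<open>has_sum\<close> is unconditional, so any order of listing will do.\<close>

lemma jump_sum_over_listing:
  assumes S: "lists_jump_times M T S"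
  shows "AE \<omega> in M. \<forall>s>0.
    ((\<lambda>z. S z \<omega> * normalized_jump T S z \<omega> * of_bool (S z \<omega> \<le> s)) has_sum T s \<omega>) UNIV"
  using AE_good lists_jump_timesD(3)[OF S]
proof eventually_elim
  case (elim \<omega>)
  show ?case
  proof (intro allI impI)
    fix s :: real assume s: "0 < s"
    have "((\<lambda>r. jump T r \<omega>) has_sum T s \<omega>) {0<..s}"
      using elim(1) s by (simp add: good_def)
    then have "((\<lambda>r. jump T r \<omega> * of_bool (r \<le> s)) has_sum T s \<omega>) (J \<omega>)"
      by (rule has_sum_cong_neutral[THEN iffD1, rotated -1])
        (use jump_neq_0_iff[OF elim(1)] jump_times_pos[of _ \<omega>] in auto)
    then have "((\<lambda>z. jump T (S z \<omega>) \<omega> * of_bool (S z \<omega> \<le> s)) has_sum T s \<omega>) UNIV"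
      using has_sum_reindex_bij_betw[OF elim(2), of "\<lambda>r. jump T r \<omega> * of_bool (r \<le> s)"] by simp
    moreover have "S z \<omega> \<noteq> 0" for z
      using bij_betw_apply[OF elim(2), of z] jump_times_pos[of "S z \<omega>" \<omega>] by auto
    ultimately show "((\<lambda>z. S z \<omega> * normalized_jump T S z \<omega> * of_bool (S z \<omega> \<le> s)) has_sum T s \<omega>) UNIV"
      by (simp add: normalized_jump_def)
  qed
qed

text \<open>For each fixed set the two counts agree almost surely, and each clause about laws
  involves finitely many sets. Containment in the half-line is demanded for every outcome and holds
  because \<open>S z\<close> is positive everywhere.\<close>

lemma scale_invariant_ppp_listing:
  assumes S: "lists_jump_times M T S"
  shows "scale_invariant_ppp M \<theta> (\<lambda>\<omega>. range (\<lambda>z. S z \<omega>))"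
proof -
  let ?X = "\<lambda>\<omega>. range (\<lambda>z. S z \<omega>)" and ?\<mu> = "scale_invariant_intensity \<theta>"
  have eq: "AE \<omega> in M. num_points ?X A \<omega> = num_points J A \<omega>" for A
    using lists_jump_timesD(3)[OF S] by eventually_elim (simp add: bij_betw_def num_points_def)
  have meas: "num_points ?X A \<in> borel_measurable M" if "A \<in> sets ?\<mu>" for A
    using that lists_jump_timesD(1)[OF S]
    by (intro measurable_count_range) (auto simp: sets_scale_invariant_intensity)
  have measJ: "num_points J A \<in> borel_measurable M" if "A \<in> sets ?\<mu>" for A
    using that measurable_num_points by (auto simp: sets_scale_invariant_intensity)
  show ?thesis
    unfolding scale_invariant_ppp_def poisson_point_process_def
  proof (intro conjI ballI impI allI)
    show "?X \<omega> \<subseteq> space ?\<mu>" if "\<omega> \<in> space M" for \<omega>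
      using lists_jump_timesD(2)[OF S that] by auto
    show "num_points ?X A \<in> borel_measurable M" if "A \<in> sets ?\<mu>" for A using that by (rule meas)
    show "AE \<omega> in M. num_points ?X A \<omega> = \<infinity>" if "A \<in> sets ?\<mu>" "emeasure ?\<mu> A = \<infinity>" for A
    proof -
      have "AE \<omega> in M. num_points J A \<omega> = \<infinity>"
        using ppp that by (auto simp: poisson_point_process_def)
      with eq[of A] show ?thesis by eventually_elim simp
    qed
    show "prob {\<omega> \<in> space M. num_points ?X A \<omega> = of_nat n} =
        measure ?\<mu> A ^ n / fact n * exp (- measure ?\<mu> A)"
      if A: "A \<in> sets ?\<mu>" "emeasure ?\<mu> A < \<infinity>" for A n
    proof -
      note [measurable] = meas[OF A(1)] measJ[OF A(1)]
      have "prob {\<omega> \<in> space M. num_points ?X A \<omega> = of_nat n} = prob {\<omega> \<in> space M. num_points J A \<omega> = of_nat n}"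
      proof (rule measure_eq_AE)
        show "AE \<omega> in M. \<omega> \<in> {\<omega> \<in> space M. num_points ?X A \<omega> = of_nat n} \<longleftrightarrow>
            \<omega> \<in> {\<omega> \<in> space M. num_points J A \<omega> = of_nat n}"
          using eq[of A] by eventually_elim simp
      qed measurable
      also have "\<dots> = measure ?\<mu> A ^ n / fact n * exp (- measure ?\<mu> A)"
        using ppp A by (rule poisson_prob_num_points)
      finally show ?thesis .
    qed
    fix A :: "nat \<Rightarrow> real set" and n assume A: "(\<forall>i<n. A i \<in> sets ?\<mu>) \<and> disjoint_family_on A {..<n}"
    then have ind: "indep_vars (\<lambda>_. borel) (\<lambda>i. num_points J (A i)) {..<n}"
      using ppp by (auto simp: poisson_point_process_def)
    show "indep_vars (\<lambda>_. borel) (\<lambda>i. num_points ?X (A i)) {..<n}"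
    proof (rule indep_vars_cong_AE[OF ind])
      show "AE \<omega> in M. num_points J (A i) \<omega> = num_points ?X (A i) \<omega>" for i
        using eq[of "A i"] by eventually_elim simp
    qed (use A meas in auto)
  qed
qed

text \<open>The canonical listing realizes \<open>mark_law\<close> as the law of a normalized jump
  taken at an actual jump time.\<close>

lemma AE_mark_law_pos: "AE x in mark_law. 0 < x"
proof -
  note [measurable] = measurable_normalized_jump[OF lists_listing]
  have "AE \<omega> in M. 0 < normalized_jump T listing 0 \<omega>"
    using AE_good lists_jump_timesD(3)[OF lists_listing]
  proof eventually_elim
    case (elim \<omega>)
    then have "listing 0 \<omega> \<in> J \<omega>" by (auto simp: bij_betw_def)
    then show ?case
      using listing_pos[of 0 \<omega>] by (simp add: normalized_jump_def jump_times_def jump_def)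
  qed
  then have "AE x in distr M borel (normalized_jump T listing 0). 0 < x"
    by (subst AE_distr_iff) auto
  then show ?thesis unfolding distr_normalized_jump[OF lists_listing order_listing] .
qed

end

section \<open>Injectivity of the Laplace transform\<close>

text \<open>Substituting \<open>y = e\<^sup>-\<^sup>x\<close> turns the integer values of the Laplace transform into moments on \<open>[0,1]\<close>.\<close>

lemma laplace_zero:
  fixes w :: "real \<Rightarrow> real"
  assumes int: "set_integrable lborel {0<..} w"
    and zero: "\<And>n. (LINT x:{0<..}|lborel. exp (- real n * x) * w x) = 0"
    and rc: "\<And>x. 0 < x \<Longrightarrow> continuous (at_right x) w" and a: "0 < a"
  shows "w a = 0"
proof -
  define v where "v x = indicator {0<..} x * w x" for x
  have v: "integrable lborel v" using int by (simp add: set_integrable_def v_def[abs_def])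
  then have [measurable]: "v \<in> borel_measurable borel" using borel_measurable_integrable by fastforce
  have bounded_int: "integrable lborel (\<lambda>x. f x * v x)"
    if "f \<in> borel_measurable borel" "\<And>x. 0 < x \<Longrightarrow> \<bar>f x\<bar> \<le> 1" for f
  proof (rule Bochner_Integration.integrable_bound[OF integrable_abs[OF v]])
    show "(\<lambda>x. f x * v x) \<in> borel_measurable lborel" using that by simp
    show "AE x in lborel. norm (f x * v x) \<le> norm \<bar>v x\<bar>"
      using that(2) by (auto simp: v_def abs_mult indicator_def mult_left_le_one_le)
  qed
  have mono: "(LINT x|lborel. exp (- x) ^ n * v x) = 0" for n
    using zero[of n] by (simp add: set_lebesgue_integral_def v_def exp_of_nat_mult[symmetric] mult_ac)
  have mono_int: "integrable lborel (\<lambda>x. exp (- x) ^ n * v x)" for n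
    by (rule bounded_int) (auto intro: power_le_one)
  have poly: "(LINT x|lborel. p (exp (- x)) * v x) = 0" if p0: "real_polynomial_function p" for p
  proof -
    obtain c n where p: "p = (\<lambda>x. \<Sum>i\<le>n. c i * x ^ i)"
      using p0 by (auto simp: real_polynomial_function_iff_sum)
    have "(LINT x|lborel. p (exp (- x)) * v x) = (LINT x|lborel. (\<Sum>i\<le>n. c i * (exp (- x) ^ i * v x)))"
      by (simp add: p sum_distrib_right mult.assoc)
    also have "\<dots> = (\<Sum>i\<le>n. (LINT x|lborel. c i * (exp (- x) ^ i * v x)))"
      by (intro Bochner_Integration.integral_sum integrable_mult_right mono_int)
    also have "\<dots> = 0" by (simp add: mono)
    finally show ?thesis .
  qed
  have cont: "(LINT x|lborel. g (exp (- x)) * v x) = 0"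
    if g: "continuous_on UNIV g" "\<And>x. \<bar>g x\<bar> \<le> 1" for g :: "real \<Rightarrow> real"
  proof -
    have [measurable]: "g \<in> borel_measurable borel" using g(1) by (rule borel_measurable_continuous_onI)
    \<comment> \<open>Polynomial approximation on \<open>[0,1]\<close>, which contains
      \<open>exp (- x)\<close> for all \<open>x > 0\<close>; an error \<open>e\<close> in the test
      function costs at most \<open>e\<close> times the integral of
      \<open>\<bar>v x\<bar>\<close>.\<close>
    have eb: "\<bar>LINT x|lborel. g (exp (- x)) * v x\<bar> \<le> e * (LINT x|lborel. \<bar>v x\<bar>)" if e: "0 < e" for e
    proof -
      obtain p where p: "real_polynomial_function p" "\<And>x. x \<in> {0..1} \<Longrightarrow> \<bar>g x - p x\<bar> < e"
        using Stone_Weierstrass_real_polynomial_function[of "{0..1}" g e] g(1) e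
        by (auto intro: continuous_on_subset)
      have [measurable]: "p \<in> borel_measurable borel"
        using continuous_on_polymonial_function[of p UNIV] p(1)
        by (intro borel_measurable_continuous_onI) (simp add: real_polynomial_function_eq)
      have gi: "integrable lborel (\<lambda>x. g (exp (- x)) * v x)" by (rule bounded_int) (use g in auto)
      have d: "\<bar>(g (exp (- x)) - p (exp (- x))) * v x\<bar> \<le> e * \<bar>v x\<bar>" for x
      proof (cases "0 < x")
        case True
        then have "\<bar>g (exp (- x)) - p (exp (- x))\<bar> \<le> e"
          by (intro less_imp_le p(2)) simp
        then show ?thesis by (simp add: abs_mult mult_right_mono)
      qed (simp add: v_def)
      have di: "integrable lborel (\<lambda>x. (g (exp (- x)) - p (exp (- x))) * v x)"
        by (rule Bochner_Integration.integrable_bound[OF integrable_mult_right[OF integrable_abs[OF v], of e]])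
          (use d e in \<open>auto simp: abs_mult\<close>)
      have pi: "integrable lborel (\<lambda>x. p (exp (- x)) * v x)"
        using Bochner_Integration.integrable_diff[OF gi di] by (simp add: algebra_simps)
      have "(LINT x|lborel. g (exp (- x)) * v x) = (LINT x|lborel. (g (exp (- x)) - p (exp (- x))) * v x)"
        using gi pi poly[OF p(1)] by (simp add: left_diff_distrib)
      also have "\<bar>\<dots>\<bar> \<le> (LINT x|lborel. \<bar>(g (exp (- x)) - p (exp (- x))) * v x\<bar>)"
        by (rule integral_abs_bound)
      also have "\<dots> \<le> (LINT x|lborel. e * \<bar>v x\<bar>)"
        using d by (intro integral_mono integrable_abs di integrable_mult_right v) auto
      finally show ?thesis by simp
    qed
    have "\<bar>LINT x|lborel. g (exp (- x)) * v x\<bar> \<le> 0"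
    proof (rule field_le_epsilon)
      fix e :: real assume e: "0 < e"
      \<comment> \<open>Adding 1 keeps the divisor positive even when \<open>v\<close> vanishes
        almost everywhere.\<close>
      define N where "N = (LINT x|lborel. \<bar>v x\<bar>) + 1"
      have N: "0 < N" "(LINT x|lborel. \<bar>v x\<bar>) \<le> N"
        unfolding N_def by (auto intro: add_nonneg_pos Bochner_Integration.integral_nonneg)
      have "\<bar>LINT x|lborel. g (exp (- x)) * v x\<bar> \<le> e / N * (LINT x|lborel. \<bar>v x\<bar>)"
        using e N by (intro eb) simp
      also have "\<dots> \<le> e / N * N"
        using e N by (intro mult_left_mono) auto
      finally show "\<bar>LINT x|lborel. g (exp (- x)) * v x\<bar> \<le> 0 + e" using N by simp
    qed
    then show ?thesis by simp
  qed
  have tail: "(LINT x|lborel. indicator {b..} x * v x) = 0" if b: "0 < b" for b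
  proof (rule LIMSEQ_unique)
    \<comment> \<open>In the variable \<open>exp (- x)\<close> the half-line
      \<open>x \<ge> b\<close> becomes the values up to \<open>exp (- b)\<close>, whose indicator is
      a limit of continuous steps.\<close>
    define g where "g m = cts_step (exp (- b)) (exp (- b) + inverse (real (Suc m)))" for m
    have gc: "continuous_on UNIV (g m)" for m
      unfolding g_def by (rule uniformly_continuous_imp_continuous[OF cts_step_uniformly_continuous]) simp
    have gb: "\<bar>g m x\<bar> \<le> 1" for m x
      unfolding g_def by (rule abs_cts_step_le) simp
    have [measurable]: "g m \<in> borel_measurable borel" for m using gc by (rule borel_measurable_continuous_onI)
    have lim: "(\<lambda>m. g m (exp (- x))) \<longlonglongrightarrow> indicator {b..} x" for x
    proof (cases "b \<le> x")
      case True
      then show ?thesis by (simp add: g_def cts_step_def)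
    next
      case False
      then have "\<forall>\<^sub>F m in sequentially. exp (- b) + inverse (real (Suc m)) < exp (- x)"
        using LIMSEQ_inverse_real_of_nat_add[of "exp (- b)"] by (intro order_tendstoD) auto
      then have "\<forall>\<^sub>F m in sequentially. g m (exp (- x)) = 0"
        by eventually_elim (use False in \<open>auto simp: g_def cts_step_def\<close>)
      then show ?thesis using False by (simp add: tendsto_eventually)
    qed
    show "(\<lambda>m. LINT x|lborel. g m (exp (- x)) * v x) \<longlonglongrightarrow> (LINT x|lborel. indicator {b..} x * v x)"
    proof (rule integral_dominated_convergence[where w="\<lambda>x. \<bar>v x\<bar>"])
      show "AE x in lborel. (\<lambda>m. g m (exp (- x)) * v x) \<longlonglongrightarrow> indicator {b..} x * v x"
        by (intro AE_I2 tendsto_intros lim)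
      show "AE x in lborel. norm (g m (exp (- x)) * v x) \<le> \<bar>v x\<bar>" for m
        using gb by (auto simp: abs_mult mult_left_le_one_le)
    qed (use v in auto)
    show "(\<lambda>m. LINT x|lborel. g m (exp (- x)) * v x) \<longlonglongrightarrow> 0"
      by (simp add: cont[OF gc gb])
  qed
  have interval: "(LINT x|lborel. indicator {a..<b} x * v x) = 0" if "a < b" for b
  proof -
    have ii: "integrable lborel (\<lambda>x. indicator {c..} x * v x)" for c
      by (rule bounded_int) (auto simp: indicator_def)
    have "(\<lambda>x. indicator {a..<b} x * v x) = (\<lambda>x. indicator {a..} x * v x - indicator {b..} x * v x)"
      using that by (auto simp: indicator_def)
    then show ?thesis
      using Bochner_Integration.integral_diff[OF ii[of a] ii[of b]] tail[of a] tail[of b] a that by simp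
  qed
  \<comment> \<open>Right continuity keeps the sign of a nonzero \<open>w a\<close> on a short
    interval to the right of \<open>a\<close>, against the vanishing integral there;
    \<open>s\<close> treats both signs at once.\<close>
  have False if s: "s = 1 \<or> s = - 1" "0 < s * w a" for s :: real
  proof -
    have "continuous (at_right a) (\<lambda>x. s * w x)" using rc[OF a] by (intro continuous_intros)
    then have "((\<lambda>x. s * w x) \<longlongrightarrow> s * w a) (at_right a)" by (simp add: continuous_within)
    then have "\<forall>\<^sub>F x in at_right a. s * w a / 2 < s * w x" using s by (intro order_tendstoD) auto
    then obtain b where b: "a < b" "\<And>x. a < x \<Longrightarrow> x < b \<Longrightarrow> s * w a / 2 < s * w x"
      by (auto simp: eventually_at_right_field)
    have "s * w a / 2 * (b - a) = (LINT x|lborel. indicator {a..<b} x * (s * w a / 2))"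
      using b(1) by simp
    also have "\<dots> \<le> (LINT x|lborel. s * (indicator {a..<b} x * v x))"
    proof (rule integral_mono)
      show "integrable lborel (\<lambda>x. s * (indicator {a..<b} x * v x))"
        by (intro integrable_mult_right bounded_int) (auto simp: indicator_def)
      show "indicator {a..<b} x * (s * w a / 2) \<le> s * (indicator {a..<b} x * v x)" for x
      proof (cases "a < x")
        case True
        then show ?thesis using b(2)[of x] a by (auto simp: indicator_def v_def)
      next
        case False
        then show ?thesis using a b(1) s by (cases "x = a") (auto simp: indicator_def v_def)
      qed
    qed (use b(1) in \<open>simp add: integrable_mult_left_iff\<close>)
    also have "\<dots> = 0" using interval[OF b(1)] by simp
    finally have "s * w a / 2 * (b - a) \<le> 0" .
    moreover have "0 < s * w a / 2 * (b - a)" using s(2) b(1) by simp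
    ultimately show False by linarith
  qed
  from this[of 1] this[of "- 1"] show "w a = 0" by fastforce
qed

section \<open>The key function\<close>

lemma minus_ln_bounds:
  assumes "0 \<le> y" "y < (1::real)"
  shows "y \<le> - ln (1 - y)" "- ln (1 - y) \<le> y / (1 - y)"
proof -
  show "y \<le> - ln (1 - y)" using ln_le_minus_one[of "1 - y"] assms by simp
  have "- ln (1 - y) = ln (1 / (1 - y))" using assms by (simp add: ln_div)
  also have "\<dots> \<le> 1 / (1 - y) - 1" using assms by (intro ln_le_minus_one) auto
  also have "\<dots> = y / (1 - y)" using assms by (simp add: field_simps)
  finally show "- ln (1 - y) \<le> y / (1 - y)" .
qed

text \<open>Domination for the difference quotient in \<open>ln u\<close>, uniform in
  \<open>d\<close>. The factor 2 is the bound on \<open>exp d\<close> for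
  \<open>d \<le> ln 2\<close>.\<close>

lemma exp_diff_bounds:
  fixes u x d :: real
  assumes u: "0 \<le> u" and x: "0 < x" and d: "0 < d" "d \<le> ln 2"
  shows "0 \<le> exp (- u * x) - exp (- (u * exp d) * x)"
    "exp (- u * x) - exp (- (u * exp d) * x) \<le> 2 * d * (u * x * exp (- u * x))"
proof -
  have e1: "1 \<le> exp d" using d by simp
  have e2: "exp d \<le> 2" using d exp_le_cancel_iff[of d "ln 2"] by simp
  have "1 - d \<le> exp (- d)" using exp_ge_add_one_self[of "- d"] by simp
  then have "exp d * (1 - d) \<le> exp d * exp (- d)" by (intro mult_left_mono) auto
  then have "exp d - 1 \<le> exp d * d" by (simp add: exp_minus algebra_simps)
  also have "\<dots> \<le> 2 * d" using e2 d by (intro mult_right_mono) auto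
  finally have e3: "exp d - 1 \<le> 2 * d" .
  have "u * x * 1 \<le> u * x * exp d" using e1 u x by (intro mult_left_mono) auto
  then show "0 \<le> exp (- u * x) - exp (- (u * exp d) * x)" by (simp add: mult_ac)
  have split: "exp (- (u * exp d) * x) = exp (- u * x) * exp (- (u * x * (exp d - 1)))"
    by (simp add: exp_add[symmetric] algebra_simps)
  have "1 - u * x * (exp d - 1) \<le> exp (- (u * x * (exp d - 1)))"
    using exp_ge_add_one_self[of "- (u * x * (exp d - 1))"] by simp
  moreover have "exp (- u * x) - exp (- (u * exp d) * x) = exp (- u * x) * (1 - exp (- (u * x * (exp d - 1))))"
    unfolding split by (simp only: right_diff_distrib mult_1_right)
  ultimately have "exp (- u * x) - exp (- (u * exp d) * x) \<le> exp (- u * x) * (u * x * (exp d - 1))"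
    by (simp only:) (intro mult_left_mono, auto)
  also have "\<dots> \<le> exp (- u * x) * (u * x * (2 * d))"
    using e3 u x by (intro mult_left_mono) auto
  finally show "exp (- u * x) - exp (- (u * exp d) * x) \<le> 2 * d * (u * x * exp (- u * x))"
    by (simp only: mult_ac)
qed

text \<open>The quotient is that of the function \<open>- exp (- (u * exp t) * x)\<close> of
  \<open>t\<close> between 0 and \<open>d n\<close>.\<close>

lemma exp_difference_quotient_tendsto:
  fixes u x :: real
  assumes d: "d \<longlonglongrightarrow> 0" "\<And>n. d n \<noteq> 0"
  shows "(\<lambda>n. (exp (- u * x) - exp (- (u * exp (d n)) * x)) / d n) \<longlonglongrightarrow> u * x * exp (- u * x)"
proof -
  have "((\<lambda>t. - exp (- (u * exp t) * x)) has_real_derivative (u * x * exp (- u * x))) (at 0)"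
    by (auto intro!: derivative_eq_intros simp: mult_ac)
  then have "((\<lambda>h. (- exp (- (u * exp (0 + h)) * x) - - exp (- (u * exp 0) * x)) / h) \<longlongrightarrow> u * x * exp (- u * x)) (at 0)"
    unfolding DERIV_def .
  moreover have "filterlim d (at 0) sequentially" using d by (auto simp: filterlim_at)
  ultimately have "(\<lambda>n. (- exp (- (u * exp (0 + d n)) * x) - - exp (- (u * exp 0) * x)) / d n) \<longlonglongrightarrow> u * x * exp (- u * x)"
    by (rule filterlim_compose)
  then show ?thesis by simp
qed

text \<open>Up to 1 the exponential is bounded by 1, beyond 1 the bound
  \<open>y * exp (- y) \<le> 1\<close> is used. The shape \<open>min x 1\<close> is that of the
  integrability condition on the key function.\<close>

lemma times_exp_le_min:
  fixes u x :: real
  assumes "0 \<le> u" "0 < x"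
  shows "u * x * exp (- u * x) \<le> (u + 1) * min x 1"
proof (cases "x \<le> 1")
  case True
  have "u * x * exp (- u * x) \<le> u * x * 1" using assms by (intro mult_left_mono) auto
  then show ?thesis using True assms by (simp add: algebra_simps)
next
  case False
  have "u * x \<le> exp (u * x)" using exp_ge_add_one_self[of "u * x"] by linarith
  then have "u * x * exp (- u * x) \<le> exp (u * x) * exp (- u * x)" by (intro mult_right_mono) auto
  also have "\<dots> = 1" by (simp add: exp_minus)
  finally show ?thesis using False assms by simp
qed

lemma nn_integral_exp_interval:
  assumes "0 \<le> (x::real)" "0 \<le> u"
  shows "(\<integral>\<^sup>+y. ennreal (u * exp (- u * y)) * indicator {0<..<x} y \<partial>lborel) = ennreal (1 - exp (- u * x))"
proof -
  have "(\<integral>\<^sup>+y. ennreal (u * exp (- u * y)) * indicator {0<..<x} y \<partial>lborel) =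
      (\<integral>\<^sup>+y. ennreal (u * exp (- u * y)) * indicator {0..x} y \<partial>lborel)"
    by (rule nn_integral_cong_AE)
      (use AE_lborel_singleton[of 0] AE_lborel_singleton[of x] in eventually_elim, auto simp: indicator_def)
  also have "\<dots> = ennreal ((- exp (- u * x)) - (- exp (- u * 0)))"
    using assms by (intro nn_integral_FTC_Icc) (auto intro!: derivative_eq_intros)
  finally show ?thesis by simp
qed

section \<open>The tail of the generic jump\<close>

context finite_rate_SSA
begin

definition mark_tail :: "real \<Rightarrow> real" where
  "mark_tail x = measure mark_law {x<..}"

lemma mark_tail_eq: "mark_tail x = 1 - cdf mark_law x"
proof -
  interpret D: real_distribution mark_law by (rule real_distribution_mark_law)
  have "UNIV - {..x} = {x<..}" by auto
  then show ?thesis using D.prob_compl[of "{..x}"] by (simp add: mark_tail_def cdf_def)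
qed

lemma mark_tail_right_cont: "continuous (at_right x) mark_tail"
proof -
  interpret D: real_distribution mark_law by (rule real_distribution_mark_law)
  show ?thesis unfolding mark_tail_eq[abs_def]
    by (intro continuous_intros D.cdf_is_right_cont)
qed

lemma mark_tail_0: "mark_tail 0 = 1"
proof -
  interpret D: real_distribution mark_law by (rule real_distribution_mark_law)
  have "D.prob {x \<in> space mark_law. 0 < x} = 1"
    using AE_mark_law_pos by (subst D.prob_Collect_eq_1) auto
  then show ?thesis by (simp add: mark_tail_def greaterThan_def)
qed

lemma mark_tail_bounds: "0 \<le> mark_tail x" "mark_tail x \<le> 1"
proof -
  interpret D: real_distribution mark_law by (rule real_distribution_mark_law)
  show "0 \<le> mark_tail x" "mark_tail x \<le> 1" by (auto simp: mark_tail_def)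
qed

lemma measurable_mark_tail [measurable]: "mark_tail \<in> borel_measurable borel"
proof -
  interpret D: real_distribution mark_law by (rule real_distribution_mark_law)
  have "cdf mark_law \<in> borel_measurable borel"
    using D.cdf_nondecreasing by (intro borel_measurable_mono) (auto simp: mono_def)
  then show ?thesis unfolding mark_tail_eq[abs_def] by measurable
qed

text \<open>Fubini, with \<open>1 - exp (- u * x)\<close> written as the integral of
  \<open>u * exp (- u * y)\<close> over \<open>0 < y < x\<close>. Truncation by
  \<open>max 0 x\<close> makes the integrand bounded on the whole line and changes nothing where the
  law lives.\<close>

lemma integral_mark_tail:
  assumes u: "0 < u"
  shows "set_integrable lborel {0<..} (\<lambda>y. u * exp (- u * y) * mark_tail y)"
    and "(LINT x|mark_law. 1 - exp (- u * max 0 x)) = (LINT y:{0<..}|lborel. u * exp (- u * y) * mark_tail y)"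
proof -
  interpret D: real_distribution mark_law by (rule real_distribution_mark_law)
  interpret P: pair_sigma_finite mark_law lborel ..
  define f where "f x y = ennreal (u * exp (- u * y)) * indicator {0<..<x} y" for x y :: real
  have f: "case_prod f \<in> borel_measurable (mark_law \<Otimes>\<^sub>M lborel)"
  proof -
    have "case_prod f = (\<lambda>p. ennreal (u * exp (- u * snd p)) * (if 0 < snd p \<and> snd p < fst p then 1 else 0))"
      by (auto simp: f_def indicator_def fun_eq_iff)
    moreover have "fst \<in> borel_measurable (mark_law \<Otimes>\<^sub>M lborel)" "snd \<in> borel_measurable (mark_law \<Otimes>\<^sub>M lborel)"
      by (auto intro!: measurable_fst'' measurable_snd'' simp: measurable_ident_sets)
    ultimately show ?thesis by simp
  qed
  have "(\<integral>\<^sup>+x. ennreal (1 - exp (- u * max 0 x)) \<partial>mark_law) = (\<integral>\<^sup>+x. \<integral>\<^sup>+y. f x y \<partial>lborel \<partial>mark_law)"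
  proof (rule nn_integral_cong_AE)
    show "AE x in mark_law. ennreal (1 - exp (- u * max 0 x)) = (\<integral>\<^sup>+y. f x y \<partial>lborel)"
      using AE_mark_law_pos
    proof eventually_elim
      case (elim x)
      then show ?case using nn_integral_exp_interval[of x u] u by (simp add: f_def max_def)
    qed
  qed
  also have "\<dots> = (\<integral>\<^sup>+y. \<integral>\<^sup>+x. f x y \<partial>mark_law \<partial>lborel)"
    using P.Fubini'[OF f] by simp
  also have "\<dots> = (\<integral>\<^sup>+y. ennreal (indicator {0<..} y *\<^sub>R (u * exp (- u * y) * mark_tail y)) \<partial>lborel)"
  proof (intro nn_integral_cong)
    fix y :: real
    have "(\<integral>\<^sup>+x. f x y \<partial>mark_law) = (\<integral>\<^sup>+x. (ennreal (u * exp (- u * y)) * indicator {0<..} y) * indicator {y<..} x \<partial>mark_law)"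
      by (intro nn_integral_cong) (auto simp: f_def indicator_def)
    also have "\<dots> = (ennreal (u * exp (- u * y)) * indicator {0<..} y) * emeasure mark_law {y<..}"
      by (subst nn_integral_cmult_indicator) auto
    also have "\<dots> = ennreal (indicator {0<..} y *\<^sub>R (u * exp (- u * y) * mark_tail y))"
      using u by (auto simp: indicator_def mark_tail_def D.emeasure_eq_measure ennreal_mult)
    finally show "(\<integral>\<^sup>+x. f x y \<partial>mark_law) = ennreal (indicator {0<..} y *\<^sub>R (u * exp (- u * y) * mark_tail y))" .
  qed
  finally have eq: "(\<integral>\<^sup>+y. ennreal (indicator {0<..} y *\<^sub>R (u * exp (- u * y) * mark_tail y)) \<partial>lborel) =
      (\<integral>\<^sup>+x. ennreal (1 - exp (- u * max 0 x)) \<partial>mark_law)" by simp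
  have int: "integrable mark_law (\<lambda>x. 1 - exp (- u * max 0 x))"
    by (rule D.integrable_const_bound[of _ 1]) (use u in auto)
  have nonneg: "0 \<le> 1 - exp (- u * max 0 x)" for x using u by simp
  have nonneg': "0 \<le> indicator {0<..} y *\<^sub>R (u * exp (- u * y) * mark_tail y)" for y
    using u mark_tail_bounds by simp
  have "(\<integral>\<^sup>+x. ennreal (1 - exp (- u * max 0 x)) \<partial>mark_law) = ennreal (LINT x|mark_law. 1 - exp (- u * max 0 x))"
    using int nonneg by (intro nn_integral_eq_integral) auto
  with eq have *: "(\<integral>\<^sup>+y. ennreal (indicator {0<..} y *\<^sub>R (u * exp (- u * y) * mark_tail y)) \<partial>lborel) =
      ennreal (LINT x|mark_law. 1 - exp (- u * max 0 x))" by simp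
  show si: "set_integrable lborel {0<..} (\<lambda>y. u * exp (- u * y) * mark_tail y)"
    unfolding set_integrable_def
    by (rule integrableI_nn_integral_finite[OF _ _ *]) (use nonneg' in auto)
  show "(LINT x|mark_law. 1 - exp (- u * max 0 x)) = (LINT y:{0<..}|lborel. u * exp (- u * y) * mark_tail y)"
    unfolding set_lebesgue_integral_def
    by (rule integral_eq_nn_integral[THEN trans, symmetric])
      (use nonneg' * integral_nonneg_AE[of "\<lambda>x. 1 - exp (- u * max 0 x)" mark_law] nonneg in auto)
qed

section \<open>The Laplace transform of \<open>T 1\<close> and its logarithmic derivative\<close>

definition lap :: "real \<Rightarrow> real" where
  "lap u = expectation (\<lambda>\<omega>. exp (- u * T 1 \<omega>))"

lemma T_nonneg:
  assumes "good \<omega>" "0 < s"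
  shows "0 \<le> T s \<omega>"
proof (rule has_sum_nonneg)
  show "((\<lambda>r. jump T r \<omega>) has_sum T s \<omega>) {0<..s}" using assms by (simp add: good_def)
qed (use jump_nonneg[OF assms(1)] in auto)

lemma T_mono: "good \<omega> \<Longrightarrow> 0 < s \<Longrightarrow> s \<le> t \<Longrightarrow> T s \<omega> \<le> T t \<omega>"
  by (auto simp: good_def mono_on_def)

lemma lap_scale:
  assumes r: "0 < r"
  shows "expectation (\<lambda>\<omega>. exp (- u * T r \<omega>)) = lap (u * r)"
proof -
  define f where "f x = exp (- u * x 1)" for x :: "real \<Rightarrow> real"
  have "f \<in> borel_measurable (PiM {1} (\<lambda>_. borel))"
    unfolding f_def by measurable
  then have "distr M borel (\<lambda>\<omega>. f (\<lambda>s\<in>{1}. T (r * s) \<omega>)) = distr M borel (\<lambda>\<omega>. f (\<lambda>s\<in>{1}. r * T s \<omega>))"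
    using r by (intro distr_self_similar) auto
  then have "distr M borel (\<lambda>\<omega>. exp (- u * T r \<omega>)) = distr M borel (\<lambda>\<omega>. exp (- u * (r * T 1 \<omega>)))"
    by (simp add: f_def)
  then have "(LINT x|distr M borel (\<lambda>\<omega>. exp (- u * T r \<omega>)). x) = (LINT x|distr M borel (\<lambda>\<omega>. exp (- u * (r * T 1 \<omega>))). x)"
    by simp
  then show ?thesis
    using r by (simp add: integral_distr lap_def mult.assoc)
qed

lemma lap_pos: "0 < lap u" if "0 \<le> u"
proof -
  have int: "integrable M (\<lambda>\<omega>. exp (- u * T 1 \<omega>))"
  proof (rule integrable_const_bound[of _ 1])
    show "AE \<omega> in M. norm (exp (- u * T 1 \<omega>)) \<le> 1"
      using AE_good by eventually_elim (use that T_nonneg in simp)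
  qed simp
  have "lap u \<noteq> 0"
  proof
    assume "lap u = 0"
    then have "AE \<omega> in M. exp (- u * T 1 \<omega>) = 0"
      using int by (simp add: lap_def integral_nonneg_eq_0_iff_AE)
    then show False by simp
  qed
  moreover have "0 \<le> lap u" by (simp add: lap_def)
  ultimately show ?thesis by simp
qed

text \<open>\<open>T\<close> at \<open>grid n 1\<close> is \<open>T 1\<close> plus the increment
  over cell 0, but independence is given only for increments between positive times. So
  \<open>T 1\<close> is replaced by \<open>T 1 - T (e m)\<close>, and \<open>e m\<close> tends to 0,
  where the path tends to 0. Self-similarity then evaluates the left-hand side.\<close>

lemma lap_factor:
  assumes u: "0 \<le> u"
  shows "lap (u * grid n 1) = lap u * expectation (\<lambda>\<omega>. exp (- u * cell_incr T n 0 \<omega>))"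
proof -
  let ?R = "grid n 1"
  have R: "1 < ?R" using grid_less_iff[of n 0 1] by simp
  \<comment> \<open>The offset 2 keeps all these times strictly below 1.\<close>
  define e where "e m = inverse (real (m + 2))" for m
  have e: "0 < e m" "e m < 1" for m by (auto simp: e_def inverse_less_1_iff)
  have e_lim: "filterlim e (at_right 0) sequentially"
  proof -
    have "e \<longlonglongrightarrow> 0"
      unfolding e_def using LIMSEQ_ignore_initial_segment[OF LIMSEQ_inverse_real_of_nat, of 1] by (simp add: add_ac)
    then show ?thesis using e(1) by (auto simp: filterlim_at less_imp_neq[symmetric])
  qed
  have lim: "(\<lambda>m. expectation (\<lambda>\<omega>. exp (- u * (T s \<omega> - T (e m) \<omega>)))) \<longlonglongrightarrow> expectation (\<lambda>\<omega>. exp (- u * T s \<omega>))"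
    if s: "1 \<le> s" for s
  proof (rule integral_dominated_convergence[where w="\<lambda>_. 1"])
    show "AE \<omega> in M. (\<lambda>m. exp (- u * (T s \<omega> - T (e m) \<omega>))) \<longlonglongrightarrow> exp (- u * T s \<omega>)"
      using AE_good
    proof eventually_elim
      case (elim \<omega>)
      then have "((\<lambda>s. T s \<omega>) \<longlongrightarrow> 0) (at_right 0)" by (simp add: good_def)
      from filterlim_compose[OF this e_lim] have "(\<lambda>m. T (e m) \<omega>) \<longlonglongrightarrow> 0" .
      then have "(\<lambda>m. exp (- u * (T s \<omega> - T (e m) \<omega>))) \<longlonglongrightarrow> exp (- u * (T s \<omega> - 0))"
        by (intro tendsto_intros)
      then show ?case by simp
    qed
    show "AE \<omega> in M. norm (exp (- u * (T s \<omega> - T (e m) \<omega>))) \<le> 1" for m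
      using AE_good
    proof eventually_elim
      case (elim \<omega>)
      have "T (e m) \<omega> \<le> T s \<omega>" using elim e[of m] s by (intro T_mono) auto
      then show ?case using u by simp
    qed
  qed (use s e in simp_all)
  have factor: "expectation (\<lambda>\<omega>. exp (- u * (T ?R \<omega> - T (e m) \<omega>))) =
      expectation (\<lambda>\<omega>. exp (- u * (T 1 \<omega> - T (e m) \<omega>))) * expectation (\<lambda>\<omega>. exp (- u * cell_incr T n 0 \<omega>))" for m
  proof -
    define t where "t i = (if i = 0 then e m else if i = 1 then 1 else ?R)" for i :: nat
    have "indep_vars (\<lambda>_. borel) (\<lambda>i \<omega>. T (t (Suc i)) \<omega> - T (t i) \<omega>) {..<2}"
    proof -
      have "0 < t 0 \<and> (\<forall>i<2. t i < t (Suc i))" using e[of m] R by (auto simp: t_def less_2_cases_iff)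
      then show ?thesis using ssa unfolding one_SSA_def independent_increments_def by blast
    qed
    then have ind: "indep_vars (\<lambda>_. borel) (\<lambda>i \<omega>. exp (- u * (T (t (Suc i)) \<omega> - T (t i) \<omega>))) {..<2}"
      by (rule indep_vars_compose2[where Y="\<lambda>i x. exp (- u * x)"]) measurable
    have mono: "AE \<omega> in M. T (t i) \<omega> \<le> T (t (Suc i)) \<omega>" if "i < 2" for i
      using AE_good
    proof eventually_elim
      case (elim \<omega>)
      then show ?case using e[of m] R that by (intro T_mono) (auto simp: t_def less_2_cases_iff)
    qed
    have int: "integrable M (\<lambda>\<omega>. exp (- u * (T (t (Suc i)) \<omega> - T (t i) \<omega>)))" if "i \<in> {..<2}" for i
    proof (rule integrable_const_bound[of _ 1])
      show "AE \<omega> in M. norm (exp (- u * (T (t (Suc i)) \<omega> - T (t i) \<omega>))) \<le> 1"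
        using mono[of i] that u by auto
      have "0 < t i" "0 < t (Suc i)" using e[of m] by (auto simp: t_def)
      then show "(\<lambda>\<omega>. exp (- u * (T (t (Suc i)) \<omega> - T (t i) \<omega>))) \<in> borel_measurable M" by simp
    qed
    have "expectation (\<lambda>\<omega>. \<Prod>i\<in>{..<2}. exp (- u * (T (t (Suc i)) \<omega> - T (t i) \<omega>))) =
        (\<Prod>i\<in>{..<2}. expectation (\<lambda>\<omega>. exp (- u * (T (t (Suc i)) \<omega> - T (t i) \<omega>))))"
      by (rule indep_vars_lebesgue_integral[OF _ ind int]) auto
    moreover have "(\<Prod>i\<in>{..<2}. exp (- u * (T (t (Suc i)) \<omega> - T (t i) \<omega>))) = exp (- u * (T ?R \<omega> - T (e m) \<omega>))" for \<omega>
      by (simp add: t_def lessThan_Suc numeral_2_eq_2 exp_add[symmetric] algebra_simps)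
    ultimately show ?thesis
      by (simp add: t_def lessThan_Suc numeral_2_eq_2 cell_incr_def mult_ac)
  qed
  have "(\<lambda>m. expectation (\<lambda>\<omega>. exp (- u * (T ?R \<omega> - T (e m) \<omega>)))) \<longlonglongrightarrow>
      expectation (\<lambda>\<omega>. exp (- u * T 1 \<omega>)) * expectation (\<lambda>\<omega>. exp (- u * cell_incr T n 0 \<omega>))"
    unfolding factor by (intro tendsto_intros lim) simp
  moreover have "(\<lambda>m. expectation (\<lambda>\<omega>. exp (- u * (T ?R \<omega> - T (e m) \<omega>)))) \<longlonglongrightarrow> expectation (\<lambda>\<omega>. exp (- u * T ?R \<omega>))"
    using R by (intro lim) simp
  ultimately have "expectation (\<lambda>\<omega>. exp (- u * T ?R \<omega>)) =
      expectation (\<lambda>\<omega>. exp (- u * T 1 \<omega>)) * expectation (\<lambda>\<omega>. exp (- u * cell_incr T n 0 \<omega>))"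
    by (rule LIMSEQ_unique[rotated])
  then show ?thesis by (simp only: lap_scale[OF grid_pos] lap_def[of u])
qed

text \<open>The truncation makes this bounded and continuous on the whole line, as
  \<open>cond_mean_tendsto\<close> requires, and leaves nonnegative arguments alone.\<close>

definition loss :: "real \<Rightarrow> real \<Rightarrow> real" where
  "loss u x = 1 - exp (- u * max 0 x)"

lemma loss_bounds: "0 \<le> u \<Longrightarrow> 0 \<le> loss u x" "0 \<le> u \<Longrightarrow> \<bar>loss u x\<bar> \<le> 1"
  by (auto simp: loss_def)

lemma continuous_loss: "continuous_on A (loss u)"
  unfolding loss_def[abs_def] by (intro continuous_intros)

lemma measurable_loss [measurable]: "loss u \<in> borel_measurable borel"
  using continuous_loss by (rule borel_measurable_continuous_onI)

text \<open>\<open>loss u\<close> vanishes at 0, so only hit cells contribute to its mean.\<close>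

lemma cell_incr_laplace:
  assumes u: "0 \<le> u"
  shows "expectation (\<lambda>\<omega>. exp (- u * cell_incr T n 0 \<omega>)) = 1 - hit_prob n * cond_mean n (loss u)"
proof -
  have nonneg: "AE \<omega> in M. 0 \<le> cell_incr T n 0 \<omega>"
    using AE_good
  proof eventually_elim
    case (elim \<omega>)
    have "T 1 \<omega> \<le> T (grid n 1) \<omega>" using elim grid_less_iff[of n 0 1] by (intro T_mono) auto
    then show ?case by (simp add: cell_incr_def)
  qed
  have "expectation (\<lambda>\<omega>. exp (- u * cell_incr T n 0 \<omega>)) = expectation (\<lambda>\<omega>. 1 - loss u (cell_incr T n 0 \<omega>))"
  proof (rule integral_cong_AE)
    show "AE \<omega> in M. exp (- u * cell_incr T n 0 \<omega>) = 1 - loss u (cell_incr T n 0 \<omega>)"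
      using nonneg by eventually_elim (simp add: loss_def max_def)
  qed simp_all
  also have "\<dots> = expectation (\<lambda>_. 1) - expectation (\<lambda>\<omega>. loss u (cell_incr T n 0 \<omega>))"
  proof (rule Bochner_Integration.integral_diff)
    show "integrable M (\<lambda>\<omega>. loss u (cell_incr T n 0 \<omega>))"
      by (rule integrable_const_bound[of _ 1]) (use loss_bounds u in auto)
  qed simp
  also have "expectation (\<lambda>\<omega>. loss u (cell_incr T n 0 \<omega>)) =
      expectation (\<lambda>\<omega>. if cell_incr T n 0 \<omega> = 0 then 0 else loss u (cell_incr T n 0 \<omega>))"
    by (intro Bochner_Integration.integral_cong refl) (simp add: loss_def)
  also have "\<dots> = hit_prob n * cond_mean n (loss u)"
    by (rule expectation_if_cell_incr) simp
  finally show ?thesis by (simp add: prob_space)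
qed

text \<open>The length of a level \<open>n\<close> cell in logarithmic scale.\<close>

definition mesh :: "nat \<Rightarrow> real" where
  "mesh n = ln 2 / 2 ^ n"

lemma mesh: "0 < mesh n" "mesh n \<le> ln 2" "mesh \<longlonglongrightarrow> 0" "grid n 1 = exp (mesh n)"
proof -
  show "0 < mesh n" by (simp add: mesh_def)
  show "mesh n \<le> ln 2" by (simp add: mesh_def divide_le_eq)
  have "(\<lambda>n. ln 2 * (1 / 2) ^ n) \<longlonglongrightarrow> ln 2 * (0::real)"
    by (intro tendsto_intros LIMSEQ_realpow_zero) auto
  then show "mesh \<longlonglongrightarrow> 0" by (simp add: mesh_def[abs_def] power_divide)
  show "grid n 1 = exp (mesh n)" by (simp add: grid_def mesh_def powr_def mult.commute)
qed

lemma hit_prob_mesh: "hit_prob n = 1 - exp (- \<theta> * mesh n)"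
  by (simp add: hit_prob mesh_def)

text \<open>The limit is the derivative of \<open>- exp (- \<theta> * t)\<close> at 0: to first
  order, a cell is hit with probability rate times logarithmic length.\<close>

lemma hit_prob_div_mesh: "(\<lambda>n. hit_prob n / mesh n) \<longlonglongrightarrow> \<theta>"
proof -
  have "((\<lambda>t. - exp (- \<theta> * t)) has_real_derivative \<theta>) (at 0)"
    by (auto intro!: derivative_eq_intros)
  then have "((\<lambda>h. (- exp (- \<theta> * (0 + h)) - - exp (- \<theta> * 0)) / h) \<longlongrightarrow> \<theta>) (at 0)"
    unfolding DERIV_def .
  moreover have "filterlim mesh (at 0) sequentially"
    using mesh(1,3) by (auto simp: filterlim_at less_imp_neq[symmetric])
  ultimately have "(\<lambda>n. (- exp (- \<theta> * (0 + mesh n)) - - exp (- \<theta> * 0)) / mesh n) \<longlonglongrightarrow> \<theta>"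
    by (rule filterlim_compose)
  then show ?thesis by (simp add: hit_prob_mesh)
qed

text \<open>By \<open>lap_factor\<close> the ratio of the two transforms is \<open>1 - y n\<close>,
  where \<open>y n / mesh n\<close> converges, and \<open>- ln (1 - y n)\<close> is squeezed between
  \<open>y n\<close> and \<open>y n / (1 - y n)\<close>. The quotient plays the role of
  \<open>- u L'(u) / L(u)\<close>; the limit is taken along the mesh, without differentiating
  \<open>lap\<close>.\<close>

lemma log_lap_quotient_tendsto:
  assumes u: "0 \<le> u"
  shows "(\<lambda>n. (ln (lap u) - ln (lap (u * grid n 1))) / mesh n) \<longlonglongrightarrow> \<theta> * (LINT x|mark_law. loss u x)"
proof -
  define y where "y n = hit_prob n * cond_mean n (loss u)" for n
  have y_lap: "lap (u * grid n 1) = lap u * (1 - y n)" for n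
    using lap_factor[OF u, of n] cell_incr_laplace[OF u, of n] by (simp add: y_def)
  have y1: "y n < 1" for n
    using lap_pos[OF u] lap_pos[of "u * grid n 1"] u y_lap[of n] less_imp_le[OF grid_pos[of n 1]]
    by (simp add: zero_less_mult_iff)
  have y0: "0 \<le> y n" for n
    unfolding y_def cond_mean_def using hit_prob_pos[of n] u loss_bounds(1)
    by (auto intro!: mult_nonneg_nonneg divide_nonneg_nonneg Bochner_Integration.integral_nonneg)
  have q: "(ln (lap u) - ln (lap (u * grid n 1))) / mesh n = - ln (1 - y n) / mesh n" for n
    unfolding y_lap using lap_pos[OF u] y1[of n] by (simp add: ln_mult)
  have c: "(\<lambda>n. cond_mean n (loss u)) \<longlonglongrightarrow> (LINT x|mark_law. loss u x)"
    using u by (intro cond_mean_tendsto continuous_loss loss_bounds)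
  have lo: "(\<lambda>n. y n / mesh n) \<longlonglongrightarrow> \<theta> * (LINT x|mark_law. loss u x)"
    using tendsto_mult[OF hit_prob_div_mesh c] by (simp add: y_def)
  have "(\<lambda>n. y n / mesh n * mesh n) \<longlonglongrightarrow> \<theta> * (LINT x|mark_law. loss u x) * 0"
    by (intro tendsto_mult lo mesh)
  then have "y \<longlonglongrightarrow> 0" using mesh(1) by (simp add: less_imp_neq[symmetric])
  then have hi: "(\<lambda>n. y n / mesh n / (1 - y n)) \<longlonglongrightarrow> \<theta> * (LINT x|mark_law. loss u x) / (1 - 0)"
    by (intro tendsto_intros lo) auto
  have "(\<lambda>n. - ln (1 - y n) / mesh n) \<longlonglongrightarrow> \<theta> * (LINT x|mark_law. loss u x)"
  proof (rule tendsto_sandwich[OF _ _ lo])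
    show "\<forall>\<^sub>F n in sequentially. y n / mesh n \<le> - ln (1 - y n) / mesh n"
      using minus_ln_bounds(1)[OF y0 y1] mesh(1) by (intro always_eventually allI divide_right_mono) (auto intro: less_imp_le)
    show "\<forall>\<^sub>F n in sequentially. - ln (1 - y n) / mesh n \<le> y n / mesh n / (1 - y n)"
    proof (intro always_eventually allI)
      fix n
      have "- ln (1 - y n) / mesh n \<le> (y n / (1 - y n)) / mesh n"
        using minus_ln_bounds(2)[OF y0 y1, of n] mesh(1)[of n] by (intro divide_right_mono) auto
      then show "- ln (1 - y n) / mesh n \<le> y n / mesh n / (1 - y n)" by (simp add: mult.commute)
    qed
    show "(\<lambda>n. y n / mesh n / (1 - y n)) \<longlonglongrightarrow> \<theta> * (LINT x|mark_law. loss u x)" using hi by simp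
  qed
  then show ?thesis by (simp add: q)
qed

section \<open>Comparison with the key function\<close>

context
  fixes k :: "real \<Rightarrow> real"
  assumes key: "key_function M T k"
begin

lemma key_nonneg: "0 < x \<Longrightarrow> 0 \<le> k x"
  using key by (simp add: key_function_def)

text \<open>The integrand of the integrability condition. Integrands containing \<open>k\<close> are
  written as multiples of it, which supplies their measurability and, with a bounded multiplier,
  their integrability.\<close>

definition weight :: "real \<Rightarrow> real" where
  "weight x = indicator {0<..} x *\<^sub>R (min x 1 * (k x / x))"

lemma integrable_weight: "integrable lborel weight"
  using key by (simp add: key_function_def set_integrable_def weight_def[abs_def])

lemma measurable_weight [measurable]: "weight \<in> borel_measurable borel"
  using borel_measurable_integrable[OF integrable_weight] by simp

lemma set_integrable_key:
  assumes [measurable]: "f \<in> borel_measurable borel" and f: "\<And>x. 0 < x \<Longrightarrow> \<bar>f x\<bar> \<le> c * min x 1"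
  shows "set_integrable lborel {0<..} (\<lambda>x. f x * (k x / x))"
  unfolding set_integrable_def
proof (rule Bochner_Integration.integrable_bound[OF integrable_mult_right[OF integrable_weight, of c]])
  have "(\<lambda>x. indicat_real {0<..} x *\<^sub>R (f x * (k x / x))) = (\<lambda>x. weight x * (f x / min x 1))"
    by (auto simp: weight_def fun_eq_iff indicator_def)
  then show "(\<lambda>x. indicat_real {0<..} x *\<^sub>R (f x * (k x / x))) \<in> borel_measurable lborel" by simp
  have "norm (indicat_real {0<..} x *\<^sub>R (f x * (k x / x))) \<le> norm (c * weight x)" for x
  proof (cases "0 < x")
    case True
    have "\<bar>f x\<bar> * (k x / x) \<le> c * min x 1 * (k x / x)"
      using True key_nonneg[of x] f by (intro mult_right_mono) auto
    also have "\<dots> = c * weight x" using True by (simp add: weight_def mult.assoc)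
    also have "\<dots> \<le> \<bar>c * weight x\<bar>" by (rule abs_ge_self)
    finally show ?thesis using True key_nonneg[of x] by (simp add: abs_mult)
  qed simp
  then show "AE x in lborel. norm (indicat_real {0<..} x *\<^sub>R (f x * (k x / x))) \<le> norm (c * weight x)" by simp
qed

lemma set_integrable_exp_key:
  assumes u: "0 \<le> u"
  shows "set_integrable lborel {0<..} (\<lambda>x. u * x * exp (- u * x) * (k x / x))"
proof (rule set_integrable_key[where c="u + 1"])
  show "\<bar>u * x * exp (- u * x)\<bar> \<le> (u + 1) * min x 1" if "0 < x" for x
    using times_exp_le_min[OF u that] u that by simp
qed simp

lemma log_lap_diff:
  assumes u: "0 \<le> u"
  shows "ln (lap u) - ln (lap (u * exp d)) =
    (LINT x:{0<..}|lborel. (exp (- u * x) - exp (- (u * exp d) * x)) * (k x / x))"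
proof -
  have si: "set_integrable lborel {0<..} (\<lambda>x. (exp (- v * x) - 1) * (k x / x))" if v: "0 \<le> v" for v
  proof (rule set_integrable_key[where c="v + 1"])
    fix x :: real assume x: "0 < x"
    have "1 - exp (- v * x) \<le> v * x" using exp_ge_add_one_self[of "- v * x"] by simp
    moreover have "v * x \<le> (v + 1) * x" using x by (simp add: algebra_simps)
    ultimately have "1 - exp (- v * x) \<le> (v + 1) * x" by (rule order_trans)
    moreover have "1 - exp (- v * x) \<le> v + 1" using v by (smt (verit) exp_gt_zero)
    moreover have "0 \<le> 1 - exp (- v * x)" using v x by simp
    ultimately show "\<bar>exp (- v * x) - 1\<bar> \<le> (v + 1) * min x 1" by (auto simp: min_def)
  qed simp
  have eq: "ln (lap v) = (LINT x:{0<..}|lborel. (exp (- v * x) - 1) * (k x / x))" if "0 \<le> v" for v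
    using key that by (simp add: key_function_def lap_def)
  have v: "0 \<le> u * exp d" using u by simp
  have "ln (lap u) - ln (lap (u * exp d)) =
      (LINT x:{0<..}|lborel. (exp (- u * x) - 1) * (k x / x)) - (LINT x:{0<..}|lborel. (exp (- (u * exp d) * x) - 1) * (k x / x))"
    by (simp only: eq[OF u] eq[OF v])
  also have "\<dots> = (LINT x:{0<..}|lborel. (exp (- u * x) - 1) * (k x / x) - (exp (- (u * exp d) * x) - 1) * (k x / x))"
    by (rule set_integral_diff(2)[OF si[OF u] si[OF v], symmetric])
  also have "\<dots> = (LINT x:{0<..}|lborel. (exp (- u * x) - exp (- (u * exp d) * x)) * (k x / x))"
    by (simp add: algebra_simps)
  finally show ?thesis .
qed

text \<open>The difference quotient of \<open>log_lap_quotient_tendsto\<close> is computed a second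
  time, from the key function formula, with \<open>exp_diff_bounds\<close> providing the dominating
  function; the two limits must agree.\<close>

lemma laplace_key:
  assumes u: "0 \<le> u"
  shows "(LINT x:{0<..}|lborel. u * x * exp (- u * x) * (k x / x)) = \<theta> * (LINT x|mark_law. loss u x)"
proof (rule LIMSEQ_unique[OF _ log_lap_quotient_tendsto[OF u]])
  have "(\<lambda>n. LINT x:{0<..}|lborel. (exp (- u * x) - exp (- (u * exp (mesh n)) * x)) / mesh n * (k x / x))
      \<longlonglongrightarrow> (LINT x:{0<..}|lborel. u * x * exp (- u * x) * (k x / x))"
    unfolding set_lebesgue_integral_def
  proof (rule integral_dominated_convergence[where w="\<lambda>x. 2 * (indicator {0<..} x *\<^sub>R (u * x * exp (- u * x) * (k x / x)))"])
    show "integrable lborel (\<lambda>x. 2 * (indicator {0<..} x *\<^sub>R (u * x * exp (- u * x) * (k x / x))))"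
      using set_integrable_exp_key[OF u] by (intro integrable_mult_right) (simp add: set_integrable_def)
    show "(\<lambda>x. indicator {0<..} x *\<^sub>R (u * x * exp (- u * x) * (k x / x))) \<in> borel_measurable lborel"
      using set_integrable_exp_key[OF u] by (auto simp: set_integrable_def)
    show "(\<lambda>x. indicator {0<..} x *\<^sub>R ((exp (- u * x) - exp (- (u * exp (mesh n)) * x)) / mesh n * (k x / x))) \<in> borel_measurable lborel" for n
    proof -
      have "(\<lambda>x. indicator {0<..} x *\<^sub>R ((exp (- u * x) - exp (- (u * exp (mesh n)) * x)) / mesh n * (k x / x))) =
          (\<lambda>x. weight x * (((exp (- u * x) - exp (- (u * exp (mesh n)) * x)) / mesh n) / min x 1))"
        by (auto simp: weight_def fun_eq_iff indicator_def mult_ac)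
      then show ?thesis by simp
    qed
    show "AE x in lborel. (\<lambda>n. indicator {0<..} x *\<^sub>R ((exp (- u * x) - exp (- (u * exp (mesh n)) * x)) / mesh n * (k x / x)))
        \<longlonglongrightarrow> indicator {0<..} x *\<^sub>R (u * x * exp (- u * x) * (k x / x))"
      using mesh(1,3) by (intro AE_I2 tendsto_intros exp_difference_quotient_tendsto) (auto simp: less_imp_neq[symmetric])
    show "AE x in lborel. norm (indicator {0<..} x *\<^sub>R ((exp (- u * x) - exp (- (u * exp (mesh n)) * x)) / mesh n * (k x / x)))
        \<le> 2 * (indicator {0<..} x *\<^sub>R (u * x * exp (- u * x) * (k x / x)))" for n
    proof (rule AE_I2)
      fix x :: real
      show "norm (indicator {0<..} x *\<^sub>R ((exp (- u * x) - exp (- (u * exp (mesh n)) * x)) / mesh n * (k x / x)))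
        \<le> 2 * (indicator {0<..} x *\<^sub>R (u * x * exp (- u * x) * (k x / x)))"
      proof (cases "0 < x")
        case True
        define D where "D = exp (- u * x) - exp (- (u * exp (mesh n)) * x)"
        have D: "0 \<le> D" "D \<le> 2 * mesh n * (u * x * exp (- u * x))"
          unfolding D_def using exp_diff_bounds[OF u True mesh(1,2)] by auto
        have kx: "0 \<le> k x / x" using True key_nonneg by simp
        have "D / mesh n \<le> 2 * (u * x * exp (- u * x))"
          using D(2) mesh(1)[of n] by (simp add: divide_le_eq mult_ac)
        then have "D / mesh n * (k x / x) \<le> 2 * (u * x * exp (- u * x)) * (k x / x)"
          using kx by (rule mult_right_mono)
        moreover have "0 \<le> D / mesh n * (k x / x)"
          by (rule mult_nonneg_nonneg[OF divide_nonneg_pos[OF D(1) mesh(1)] kx])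
        ultimately show ?thesis unfolding D_def[symmetric] using True by (simp add: mult.assoc)
      qed simp
    qed
  qed
  moreover have "(LINT x:{0<..}|lborel. (exp (- u * x) - exp (- (u * exp (mesh n)) * x)) / mesh n * (k x / x)) =
      (ln (lap u) - ln (lap (u * grid n 1))) / mesh n" for n
    unfolding mesh(4) log_lap_diff[OF u]
    by (simp add: set_integral_divide_zero[symmetric] mult_ac)
  ultimately show "(\<lambda>n. (ln (lap u) - ln (lap (u * grid n 1))) / mesh n)
      \<longlonglongrightarrow> (LINT x:{0<..}|lborel. u * x * exp (- u * x) * (k x / x))" by simp
qed

text \<open>By \<open>integral_mark_tail\<close> the right-hand side of \<open>laplace_key\<close>
  involves the transform of the tail. After cancelling \<open>u\<close>, both functions have the
  same Laplace transform for all \<open>u > 0\<close>, and right continuity gives equality at every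
  point.\<close>

lemma key_eq_mark_tail:
  assumes "0 < a"
  shows "k a = \<theta> * mark_tail a"
proof -
  \<comment> \<open>The factor \<open>exp (- x)\<close> makes \<open>w\<close> integrable and moves
    the evaluation points from \<open>n\<close> to \<open>Suc n\<close>, avoiding
    \<open>u = 0\<close>, where the integral of \<open>k\<close> may be infinite.\<close>
  define w where "w x = exp (- x) * (k x - \<theta> * mark_tail x)" for x
  have i1: "set_integrable lborel {0<..} (\<lambda>x. exp (- u * x) * k x)"
    and i2: "set_integrable lborel {0<..} (\<lambda>x. exp (- u * x) * mark_tail x)"
    and eq: "(LINT x:{0<..}|lborel. exp (- u * x) * k x) = \<theta> * (LINT x:{0<..}|lborel. exp (- u * x) * mark_tail x)"
    if u: "0 < u" for u
  proof -
    have e: "u * (exp (- u * x) * k x) = u * x * exp (- u * x) * (k x / x)" if "x \<in> {0<..}" for x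
      using that by simp
    have "set_integrable lborel {0<..} (\<lambda>x. u * (exp (- u * x) * k x))"
      using set_integrable_exp_key[of u] u by (subst set_integrable_cong[OF refl refl e]) auto
    then show "set_integrable lborel {0<..} (\<lambda>x. exp (- u * x) * k x)"
      using u by (simp add: set_integrable_mult_right_iff)
    show "set_integrable lborel {0<..} (\<lambda>x. exp (- u * x) * mark_tail x)"
      using integral_mark_tail(1)[OF u] u by (simp add: mult.assoc set_integrable_mult_right_iff)
    have "u * (LINT x:{0<..}|lborel. exp (- u * x) * k x) = (LINT x:{0<..}|lborel. u * (exp (- u * x) * k x))"
      by (rule set_integral_mult_right[symmetric])
    also have "\<dots> = (LINT x:{0<..}|lborel. u * x * exp (- u * x) * (k x / x))"
      using e by (intro set_lebesgue_integral_cong) auto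
    also have "\<dots> = \<theta> * (LINT x|mark_law. loss u x)" using u by (intro laplace_key) simp
    also have "\<dots> = \<theta> * (LINT x:{0<..}|lborel. u * (exp (- u * x) * mark_tail x))"
      using integral_mark_tail(2)[OF u] by (simp add: loss_def mult.assoc)
    also have "\<dots> = u * (\<theta> * (LINT x:{0<..}|lborel. exp (- u * x) * mark_tail x))"
      by (simp only: set_integral_mult_right mult.left_commute)
    finally show "(LINT x:{0<..}|lborel. exp (- u * x) * k x) = \<theta> * (LINT x:{0<..}|lborel. exp (- u * x) * mark_tail x)"
      using u by simp
  qed
  have "w a = 0"
  proof (rule laplace_zero[OF _ _ _ assms])
    have form: "exp (- real n * x) * w x = exp (- real (Suc n) * x) * k x - \<theta> * (exp (- real (Suc n) * x) * mark_tail x)" for n x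
      by (simp add: w_def exp_add[symmetric] algebra_simps)
    have int: "set_integrable lborel {0<..} (\<lambda>x. exp (- real n * x) * w x)" for n
      unfolding form using i1[of "real (Suc n)"] i2[of "real (Suc n)"]
      by (intro set_integral_diff set_integrable_mult_right) auto
    show "set_integrable lborel {0<..} w" using int[of 0] by simp
    show "(LINT x:{0<..}|lborel. exp (- real n * x) * w x) = 0" for n
    proof -
      have "(LINT x:{0<..}|lborel. exp (- real n * x) * w x) =
          (LINT x:{0<..}|lborel. exp (- real (Suc n) * x) * k x) - (LINT x:{0<..}|lborel. \<theta> * (exp (- real (Suc n) * x) * mark_tail x))"
        unfolding form using i1[of "real (Suc n)"] i2[of "real (Suc n)"]
        by (intro set_integral_diff set_integrable_mult_right) auto
      also have "\<dots> = 0" using eq[of "real (Suc n)"] by (simp only: set_integral_mult_right)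
      finally show ?thesis .
    qed
    show "continuous (at_right x) w" if "0 < x" for x
      unfolding w_def using key that
      by (intro continuous_intros mark_tail_right_cont) (auto simp: key_function_def)
  qed
  then show ?thesis by (simp add: w_def)
qed

text \<open>Right continuity of the tail at 0, together with \<open>mark_tail 0 = 1\<close>, which
  expresses that the generic jump is positive.\<close>

lemma key_tendsto: "(k \<longlongrightarrow> \<theta>) (at_right 0)"
proof -
  have "((\<lambda>x. \<theta> * mark_tail x) \<longlongrightarrow> \<theta> * mark_tail 0) (at_right 0)"
    using mark_tail_right_cont[of 0] by (intro tendsto_intros) (simp add: continuous_within)
  then have "((\<lambda>x. \<theta> * mark_tail x) \<longlongrightarrow> \<theta>) (at_right 0)" by (simp add: mark_tail_0)
  then show ?thesis
    by (rule Lim_transform_eventually)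
      (auto simp: eventually_at_right_field key_eq_mark_tail intro!: exI[of _ 1])
qed

end

end

theorem theorem4p1:
  fixes M :: "'a measure" and T :: "real \<Rightarrow> 'a \<Rightarrow> real" and k :: "real \<Rightarrow> real" and \<theta> :: real
  assumes "prob_space M"
    and "one_SSA M T"
    and "nondecreasing_process M T"
    and "no_drift M T"
    and "0 < \<theta>"
    and "has_rate M T \<theta>"
    and "key_function M T k"
  shows "(k \<longlongrightarrow> \<theta>) (at_right 0) \<and>
    (\<exists>S. lists_jump_times M T S \<and> order_from_jump_times M T S \<and> increasing_from_1 M S) \<and>
    (\<forall>S. lists_jump_times M T S \<longrightarrow>
      (AE \<omega> in M. \<forall>s>0.
        ((\<lambda>z. S z \<omega> * normalized_jump T S z \<omega> * of_bool (S z \<omega> \<le> s)) has_sum T s \<omega>) UNIV) \<and>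
      scale_invariant_ppp M \<theta> (\<lambda>\<omega>. range (\<lambda>z. S z \<omega>)) \<and>
      (order_from_jump_times M T S \<longrightarrow>
        (\<exists>D. real_distribution D \<and> (AE x in D. 0 < x) \<and>
          (\<forall>x\<ge>0. measure D {x<..} = (if x = 0 then Lim (at_right 0) k else k x) / \<theta>) \<and>
          (\<forall>z. distr M borel (normalized_jump T S z) = D) \<and>
          prob_space.indep_vars M (\<lambda>_. borel) (normalized_jump T S) UNIV) \<and>
        prob_space.indep_var M
          (PiM UNIV (\<lambda>_. borel)) (\<lambda>\<omega> z. S z \<omega>)
          (PiM UNIV (\<lambda>_. borel)) (\<lambda>\<omega> z. normalized_jump T S z \<omega>)))"
proof -
  interpret prob_space M by fact
  interpret finite_rate_SSA M T \<theta> by standard fact+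
  note key = assms(7)
  have lim: "Lim (at_right 0) k = \<theta>"
    using key_tendsto[OF key] by (intro tendsto_Lim) auto
  \<comment> \<open>At \<open>x = 0\<close> both sides are 1: the limit of \<open>k\<close> is
    \<open>\<theta>\<close>, and the mark law lives on the positive half-line.\<close>
  have tail: "measure mark_law {x<..} = (if x = 0 then Lim (at_right 0) k else k x) / \<theta>" if "0 \<le> x" for x
    using that mark_tail_0 key_eq_mark_tail[OF key, of x] \<theta>_pos unfolding lim by (auto simp: mark_tail_def)
  show ?thesis
  proof (intro conjI allI impI)
    show "(k \<longlongrightarrow> \<theta>) (at_right 0)" by (rule key_tendsto[OF key])
    show "\<exists>S. lists_jump_times M T S \<and> order_from_jump_times M T S \<and> increasing_from_1 M S"
      using lists_listing order_listing increasing_listing by blast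
    fix S assume S: "lists_jump_times M T S"
    show "AE \<omega> in M. \<forall>s>0.
        ((\<lambda>z. S z \<omega> * normalized_jump T S z \<omega> * of_bool (S z \<omega> \<le> s)) has_sum T s \<omega>) UNIV"
      using S by (rule jump_sum_over_listing)
    show "scale_invariant_ppp M \<theta> (\<lambda>\<omega>. range (\<lambda>z. S z \<omega>))"
      using S by (rule scale_invariant_ppp_listing)
    assume order: "order_from_jump_times M T S"
    \<comment> \<open>The witness is \<open>mark_law\<close>, the same for every listing.\<close>
    show "\<exists>D. real_distribution D \<and> (AE x in D. 0 < x) \<and>
        (\<forall>x\<ge>0. measure D {x<..} = (if x = 0 then Lim (at_right 0) k else k x) / \<theta>) \<and>
        (\<forall>z. distr M borel (normalized_jump T S z) = D) \<and>
        indep_vars (\<lambda>_. borel) (normalized_jump T S) UNIV"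
      using real_distribution_mark_law AE_mark_law_pos tail distr_normalized_jump[OF S order]
        indep_normalized_jumps[OF S order] by blast
    show "indep_var (PiM UNIV (\<lambda>_. borel)) (\<lambda>\<omega> z. S z \<omega>)
        (PiM UNIV (\<lambda>_. borel)) (\<lambda>\<omega> z. normalized_jump T S z \<omega>)"
      using S order by (rule indep_times_normalized_jumps)
  qed
qed

end
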